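(* Let $d\ge 2$ and $\lambda\in(-d,-d+2]$. Then the uniform surface probability measure $\sigma$ on the sphere $\mathbb S^d$ uniquely minimizes the energy integral $I_\lambda(\mu)$ among all Borel probability measures $\mu$ on $\mathbb S^d$, where uniqueness is understood up to identifying measures $\mu,\nu$ with $\mu(E\cup -E)=\nu(E\cup -E)$ for all Borel sets $E\subset\mathbb S^d$.
   Context: $\mathbb S^d\subset\mathbb R^{d+1}$ is the unit sphere. For $x,y\in\mathbb S^d$ let $\theta(x,y)=\min\{\arccos(x\cdot y),\pi-\arccos(x\cdot y)\}=\arccos|x\cdot y|$ be the non-obtuse angle between the lines generated by $x$ and $y$. For $\lambda\in\mathbb R$, $\lambda\neq 0$, and a Borel probability measure $\mu$ on $\mathbb S^d$, $I_\lambda(\mu)=\int_{\mathbb S^d}\int_{\mathbb S^d}\theta(x,y)^\lambda\,d\mu(x)\,d\mu(y)$; for $\lambda=0$ the kernel $\theta(x,y)^\lambda$ is replaced by $-\log\theta(x,y)$. For $\lambda\le 0$ the kernel equals $+\infty$ when $\theta(x,y)=0$. *)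

theory Defs
  imports "HOL-Analysis.Analysis" "HOL-Probability.Probability_Measure"
begin

text \<open>A Borel probability measure on the unit sphere is a measure whose underlying space is the
  sphere itself, not a measure on the ambient space that is carried by the sphere.\<close>

definition sphere_prob_measures :: "'a::euclidean_space measure set" where
  "sphere_prob_measures =
     {\<mu>. prob_space \<mu> \<and> sets \<mu> = sets (restrict_space borel (sphere 0 1))}"

text \<open>Normalised surface measure, obtained as the cone measure: the mass of \<open>E\<close> is the proportion
  of the unit ball filled by the cone \<open>{r x | x \<in> E, 0 < r < 1}\<close>. (The origin, where
  \<open>sgn\<close> leaves the sphere, is a null set.)\<close>

definition uniform_sphere_measure :: "'a::euclidean_space measure" where
  "uniform_sphere_measure =
     restrict_space (distr (uniform_measure lborel (ball 0 1)) borel sgn) (sphere 0 1)"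

definition line_angle :: "'a::euclidean_space \<Rightarrow> 'a \<Rightarrow> real" where
  "line_angle x y = min (arccos (x \<bullet> y)) (pi - arccos (x \<bullet> y))"

text \<open>The value \<open>\<infinity>\<close> is set explicitly, because in HOL \<open>0 powr l = 0\<close> and \<open>ln 0 = 0\<close>.\<close>

definition angle_kernel :: "real \<Rightarrow> 'a::euclidean_space \<Rightarrow> 'a \<Rightarrow> ereal" where
  "angle_kernel l x y =
     (if l \<le> 0 \<and> line_angle x y = 0 then \<infinity>
      else if l = 0 then ereal (- ln (line_angle x y))
      else ereal (line_angle x y powr l))"

text \<open>Integral of an extended real function as the difference of the integrals of its positive and
  negative parts (\<open>e2ennreal\<close> sends negative values to 0). The kernel above is bounded below by
  \<open>- ln (pi / 2)\<close> on the sphere, so for probability measures \<open>\<infinity> - \<infinity>\<close> does not occur.\<close>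

definition ereal_integral :: "'a measure \<Rightarrow> ('a \<Rightarrow> ereal) \<Rightarrow> ereal" where
  "ereal_integral M f =
     enn2ereal (\<integral>\<^sup>+ x. e2ennreal (f x) \<partial>M) - enn2ereal (\<integral>\<^sup>+ x. e2ennreal (- f x) \<partial>M)"

definition angle_energy :: "real \<Rightarrow> 'a::euclidean_space measure \<Rightarrow> ereal" where
  "angle_energy l \<mu> = ereal_integral \<mu> (\<lambda>y. ereal_integral \<mu> (\<lambda>x. angle_kernel l x y))"

definition antipodally_equal ::
    "'a::euclidean_space measure \<Rightarrow> 'a measure \<Rightarrow> bool" where
  "antipodally_equal \<mu> \<nu> \<longleftrightarrow>
     (\<forall>E. E \<in> sets borel \<and> E \<subseteq> sphere 0 1 \<longrightarrow>
        emeasure \<mu> (E \<union> uminus ` E) = emeasure \<nu> (E \<union> uminus ` E))"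

lemma borel_measurable_sgn [measurable]:
  "(sgn :: 'a::euclidean_space \<Rightarrow> 'a) \<in> borel_measurable borel"
  unfolding sgn_div_norm by measurable

lemma emeasure_uniform_sphere_measure:
  assumes "E \<in> sets borel" "E \<subseteq> sphere (0::'a::euclidean_space) 1"
  shows "emeasure uniform_sphere_measure E =
           emeasure lborel {x \<in> ball 0 1. sgn x \<in> E} / emeasure lborel (ball (0::'a) 1)"
proof -
  have "sgn -` E \<in> sets (borel :: 'a measure)"
    using measurable_sets[OF borel_measurable_sgn assms(1)] by simp
  moreover have "ball 0 1 \<inter> sgn -` E = {x \<in> ball (0::'a) 1. sgn x \<in> E}" by auto
  ultimately show ?thesis
    using assms unfolding uniform_sphere_measure_def
    by (subst emeasure_restrict_space)
       (auto simp: emeasure_distr emeasure_uniform_measure sets_restrict_space)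
qed

lemma uniform_sphere_measure_in_sphere_prob_measures:
  "(uniform_sphere_measure :: 'a::euclidean_space measure) \<in> sphere_prob_measures"
proof -
  let ?\<sigma> = "uniform_sphere_measure :: 'a measure"
  have b: "sphere (0::'a) 1 \<in> sets borel" by simp
  have pos: "emeasure lborel (ball (0::'a) 1) \<noteq> 0" "emeasure lborel (ball (0::'a) 1) \<noteq> \<infinity>"
    using emeasure_lborel_ball_finite[of "0::'a" 1] content_ball_pos[of 1 "0::'a"]
    by (auto simp: measure_def)
  have "{x \<in> ball (0::'a) 1. sgn x \<in> sphere 0 1} = ball 0 1 - {0}"
    by (auto simp: norm_sgn)
  moreover have "emeasure lborel (ball (0::'a) 1 - {0}) = emeasure lborel (ball (0::'a) 1)"
    by (rule emeasure_Diff_null_set) auto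
  ultimately have "emeasure ?\<sigma> (sphere 0 1) = 1"
    using pos by (subst emeasure_uniform_sphere_measure)
      (auto intro!: ennreal_divide_self simp: top.not_eq_extremum)
  moreover have "space ?\<sigma> = sphere 0 1"
    by (simp add: uniform_sphere_measure_def space_restrict_space)
  ultimately have "prob_space ?\<sigma>" by (intro prob_spaceI) simp
  moreover have "sets ?\<sigma> = sets (restrict_space borel (sphere 0 1))"
    by (simp add: uniform_sphere_measure_def sets_restrict_space)
  ultimately show ?thesis by (simp add: sphere_prob_measures_def)
qed

end

theory Submission
  imports Defs "HOL-Computational_Algebra.Polynomial" "HOL-Real_Asymp.Real_Asymp"
begin

text \<open>Let \<open>K(x, y)\<close> be the angle kernel, increased by a constant if \<open>l = 0\<close> so that it is positive, and \<open>d\<close> the dimension of the sphere. For a zonal kernel the potential of the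
uniform measure \<open>\<sigma>\<close> is constant, so \<open>I(\<mu>) - I(\<sigma>)\<close> is the energy of the signed measure \<open>\<mu> - \<sigma>\<close>, and everything
depends on the eigenvalues of \<open>K\<close> on the spherical harmonics of even degree: if they are positive in
all degrees other than 0, then \<open>\<sigma>\<close> is a minimiser, and it is the only one up to antipodal symmetrisation.

The eigenvalues are positive for the following reason. The exponent satisfies \<open>l \<le> 2 - d\<close>. Therefore \<open>K(x, \<cdot>)\<close> is strictly subharmonic away from
the points \<open>x\<close> and \<open>- x\<close> (\<open>h_subharmonic\<close>), and its kink at the equator is convex. Formally
\<open>- \<Delta>K\<close> is then minus a positive function off the diagonal, that is, the kernel of a Dirichlet form, which is
a positive operator; as it is the product of \<open>K\<close> with the positive operator \<open>- \<Delta>\<close>, the operator \<open>K\<close> is positive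
as well. The rigorous version, \<open>eigenvalue_pos\<close>, replaces the Laplacian by second differences: it
compares the values of \<open>K\<phi>\<close> at the pole of a zonal harmonic \<open>\<phi>\<close> and at nearby points, using that \<open>\<phi>\<close> is
largest at its pole.

The zonal harmonics are obtained abstractly. By a reflection argument, a zonal kernel maps the functions \<open>p((e \<bullet> y)\<^sup>2)\<close> with
\<open>p\<close> a polynomial of degree at most \<open>n\<close> into themselves (\<open>funk_hecke_poly\<close>). As the operator is symmetric, the orthogonal polynomials
of the surface measure are eigenvectors of every zonal kernel (\<open>orth_eigen\<close>). Suitably normalised they
are reproducing kernels, which gives their maximum at the pole and the nonnegativity of their quadratic forms.

It remains to pass from harmonics to measures. The kernel is singular, so its energy cannot simply be expanded in zonal
harmonics. Convolution with the kernels \<open>c\<^sub>m * (x \<bullet> y) ^ (2 * m)\<close>, which are positive definite polynomials and form an approximate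
identity, gives finite expansions. The convolutions converge to \<open>K\<close> off the diagonal, and because \<open>l > - d\<close> they are bounded
by a constant multiple of \<open>K\<close> (\<open>peak_poly_kappa_bound\<close>). By dominated convergence,
\<open>I(\<mu>) \<ge> I(\<sigma>) + a\<^sub>n * E\<^sub>n(\<mu>)\<close> for every \<open>n \<ge> 1\<close>, where \<open>a\<^sub>n > 0\<close> is the eigenvalue in degree \<open>2 * n\<close> and
\<open>E\<^sub>n(\<mu>) \<ge> 0\<close> the energy of \<open>\<mu>\<close> for the reproducing kernel of that degree (\<open>energy_lower_bound\<close>). This proves minimality. In the
case of equality all \<open>E\<^sub>n(\<mu>)\<close> vanish, the convolutions of \<open>\<mu>\<close> with the approximate identity are constant
(\<open>integral_eq_uniform\<close>), and \<open>\<mu>\<close> agrees with \<open>\<sigma>\<close> on symmetric sets (\<open>emeasure_symmetric_set_eqI\<close>).\<close>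

section \<open>Rotation invariance of the surface measure\<close>

lemma nn_integral_lborel_affine:
  fixes f :: "'a::euclidean_space \<Rightarrow> ennreal"
  assumes [measurable]: "f \<in> borel_measurable borel" and "\<bar>c\<bar> = 1"
  shows "(\<integral>\<^sup>+x. f (t + c *\<^sub>R x) \<partial>lborel) = (\<integral>\<^sup>+x. f x \<partial>lborel)"
proof -
  have "c \<noteq> 0" using assms(2) by auto
  then have "(lborel :: 'a measure) = distr lborel borel (\<lambda>x. t + c *\<^sub>R x)"
    using lborel_affine[of c t] assms(2) by (simp add: density_1)
  then have "(\<integral>\<^sup>+x. f x \<partial>lborel) = (\<integral>\<^sup>+x. f x \<partial>distr lborel borel (\<lambda>x. t + c *\<^sub>R x))"
    by simp
  also have "\<dots> = (\<integral>\<^sup>+x. f (t + c *\<^sub>R x) \<partial>lborel)"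
    by (subst nn_integral_distr) auto
  finally show ?thesis by simp
qed

lemma orthogonal_transformation_borel_measurable:
  fixes T :: "'a::euclidean_space \<Rightarrow> 'a"
  shows "orthogonal_transformation T \<Longrightarrow> T \<in> borel_measurable borel"
  by (intro borel_measurable_continuous_onI linear_continuous_on)
     (metis linear_conv_bounded_linear orthogonal_transformation_linear)

text \<open>Lebesgue measure and its image under \<open>T\<close> are both translation invariant, and two such measures
  agree up to a factor: integrating \<open>1_ball x * f (x + T y)\<close> over both variables in either order
  compares them, and the factor is 1 because \<open>T\<close> maps the unit ball onto itself.\<close>

lemma nn_integral_lborel_orthogonal:
  fixes T :: "'a::euclidean_space \<Rightarrow> 'a"
  assumes T: "orthogonal_transformation T" and f[measurable]: "f \<in> borel_measurable borel"
  shows "(\<integral>\<^sup>+x. f (T x) \<partial>lborel) = (\<integral>\<^sup>+x. f x \<partial>lborel)"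
proof -
  note [measurable] = orthogonal_transformation_borel_measurable[OF T]
  have lin: "linear T" using T by (simp add: orthogonal_transformation_linear)
  obtain S where S: "\<And>x. T (S x) = x"
    using orthogonal_transformation_surj[OF T] by (metis surjD)
  define b where "b = emeasure lborel (ball (0::'a) 1)"
  have b: "b \<noteq> 0" "b \<noteq> \<infinity>"
    using emeasure_lborel_ball_finite[of "0::'a" 1] content_ball_pos[of 1 "0::'a"]
    by (auto simp: b_def measure_def)
  let ?A = "indicator (ball (0::'a) 1) :: 'a \<Rightarrow> ennreal"
  have [measurable]: "ball (0::'a) 1 \<in> sets borel" by simp
  have [measurable]: "T \<in> lborel \<rightarrow>\<^sub>M borel" by simp
  have m1: "(\<lambda>p. ?A (snd p) * f (snd p + T (fst p))) \<in> borel_measurable (lborel \<Otimes>\<^sub>M lborel)"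
    and m2: "(\<lambda>p. ?A (fst p - T (snd p)) * f (fst p)) \<in> borel_measurable (lborel \<Otimes>\<^sub>M lborel)"
    by (auto intro!: borel_measurable_times_ennreal borel_measurable_indicator'
        measurable_compose[OF _ f] borel_measurable_add borel_measurable_diff)
  have m3: "(\<lambda>x. ?A (x - z) * f x) \<in> borel_measurable borel" for z
    by (intro borel_measurable_times_ennreal measurable_compose[of "\<lambda>x. x - z" borel borel ?A]) auto
  have 1: "(\<integral>\<^sup>+y. f (x + T y) \<partial>lborel) = (\<integral>\<^sup>+y. f (T y) \<partial>lborel)" for x
  proof -
    have "(\<integral>\<^sup>+y. f (x + T y) \<partial>lborel) = (\<integral>\<^sup>+y. f (T (S x + 1 *\<^sub>R y)) \<partial>lborel)"
      by (simp add: linear_add[OF lin] S)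
    also have "\<dots> = (\<integral>\<^sup>+y. f (T y) \<partial>lborel)"
      by (rule nn_integral_lborel_affine[where f="\<lambda>y. f (T y)"]) auto
    finally show ?thesis .
  qed
  have 2: "(\<integral>\<^sup>+y. ?A (x - T y) \<partial>lborel) = b" for x
  proof -
    have "(\<integral>\<^sup>+y. ?A (x - T y) \<partial>lborel) = (\<integral>\<^sup>+y. ?A (T (S x + (-1) *\<^sub>R y)) \<partial>lborel)"
      by (simp add: linear_diff[OF lin] S)
    also have "\<dots> = (\<integral>\<^sup>+y. ?A (T y) \<partial>lborel)"
      by (rule nn_integral_lborel_affine[where f="\<lambda>y. ?A (T y)"])
         (rule measurable_compose[of T borel borel ?A], auto)
    also have "\<dots> = (\<integral>\<^sup>+y. ?A y \<partial>lborel)"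
      by (intro nn_integral_cong) (auto simp: indicator_def orthogonal_transformation_norm[OF T])
    also have "\<dots> = b" by (simp add: b_def)
    finally show ?thesis .
  qed
  have "b * (\<integral>\<^sup>+y. f (T y) \<partial>lborel) = (\<integral>\<^sup>+x. (\<integral>\<^sup>+y. ?A x * f (x + T y) \<partial>lborel) \<partial>lborel)"
  proof -
    have "b * c = (\<integral>\<^sup>+x. ?A x * c \<partial>lborel)" for c
      unfolding b_def by (subst nn_integral_multc) auto
    then show ?thesis by (simp add: nn_integral_cmult 1)
  qed
  also have "\<dots> = (\<integral>\<^sup>+y. (\<integral>\<^sup>+x. ?A x * f (x + T y) \<partial>lborel) \<partial>lborel)"
    by (rule lborel_pair.Fubini') (use m1 in \<open>simp add: case_prod_beta'\<close>)
  also have "\<dots> = (\<integral>\<^sup>+y. (\<integral>\<^sup>+x. ?A (x - T y) * f x \<partial>lborel) \<partial>lborel)"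
  proof (rule nn_integral_cong)
    fix y :: 'a
    show "(\<integral>\<^sup>+x. ?A x * f (x + T y) \<partial>lborel) = (\<integral>\<^sup>+x. ?A (x - T y) * f x \<partial>lborel)"
      using nn_integral_lborel_affine[OF m3, of 1 "T y" "T y"]
      by (simp add: add.commute)
  qed
  also have "\<dots> = (\<integral>\<^sup>+x. (\<integral>\<^sup>+y. ?A (x - T y) * f x \<partial>lborel) \<partial>lborel)"
    by (rule lborel_pair.Fubini') (use m2 in \<open>simp add: case_prod_beta'\<close>)
  also have "\<dots> = (\<integral>\<^sup>+x. b * f x \<partial>lborel)"
    by (intro nn_integral_cong) (simp add: nn_integral_multc 2)
  also have "\<dots> = b * (\<integral>\<^sup>+x. f x \<partial>lborel)" by (simp add: nn_integral_cmult)
  finally show ?thesis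
    using b by (metis ennreal_mult_cancel_left infinity_ennreal_def)
qed

text \<open>The surface measure as a Borel measure on the whole space that is carried by the sphere. Ambient
  Borel functions can then be integrated without restricting their domain.\<close>

definition sph :: "'a::euclidean_space measure" where
  "sph = distr (uniform_measure lborel (ball 0 1)) borel sgn"

lemma sets_sph[simp, measurable_cong]: "sets sph = sets borel"
  and space_sph[simp]: "space sph = UNIV"
  by (simp_all add: sph_def)

lemma ball_volume_pos_finite:
  "emeasure lborel (ball (0::'a::euclidean_space) 1) \<noteq> 0"
  "emeasure lborel (ball (0::'a::euclidean_space) 1) \<noteq> \<infinity>"
  using emeasure_lborel_ball_finite[of "0::'a" 1] content_ball_pos[of 1 "0::'a"]
  by (auto simp: measure_def)

lemma prob_space_sph: "prob_space (sph :: 'a::euclidean_space measure)"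
  unfolding sph_def
  by (intro prob_space.prob_space_distr prob_space_uniform_measure)
     (use ball_volume_pos_finite[where 'a='a] in auto)

interpretation sph: prob_space "sph :: 'a::euclidean_space measure" by (rule prob_space_sph)

lemma AE_sph_norm: "AE x in (sph :: 'a::euclidean_space measure). norm x = 1"
proof -
  have "AE x in lborel. x \<noteq> (0::'a)" by (rule AE_lborel_singleton)
  then have "AE x in (uniform_measure lborel (ball (0::'a) 1)). norm (sgn x) = 1"
    by (intro AE_uniform_measureI) (auto simp: norm_sgn)
  then show ?thesis unfolding sph_def by (subst AE_distr_iff) auto
qed

lemma emeasure_sph:
  fixes A :: "'a::euclidean_space set"
  assumes [measurable]: "A \<in> sets borel"
  shows "emeasure sph A = emeasure lborel {x \<in> ball 0 1. sgn x \<in> A} / emeasure lborel (ball (0::'a) 1)"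
proof -
  have "sgn -` A \<in> sets (borel :: 'a measure)"
    using measurable_sets[OF borel_measurable_sgn assms(1)] by simp
  moreover have "ball 0 1 \<inter> sgn -` A = {x \<in> ball (0::'a) 1. sgn x \<in> A}" by auto
  ultimately show ?thesis
    unfolding sph_def by (subst emeasure_distr) (auto simp: emeasure_uniform_measure)
qed

lemma distr_uniform_sphere_measure:
  "distr uniform_sphere_measure borel (\<lambda>x. x) = (sph :: 'a::euclidean_space measure)"
proof (rule measure_eqI)
  fix A :: "'a set" assume "A \<in> sets (distr uniform_sphere_measure borel (\<lambda>x. x))"
  then have A[measurable]: "A \<in> sets borel" by simp
  have "emeasure (distr uniform_sphere_measure borel (\<lambda>x. x)) A
      = emeasure uniform_sphere_measure (A \<inter> sphere 0 1)"
    by (subst emeasure_distr)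
       (auto simp: uniform_sphere_measure_def space_restrict_space intro!: measurable_restrict_space1)
  also have "\<dots> = emeasure sph (A \<inter> sphere 0 1)"
    by (simp add: emeasure_sph emeasure_uniform_sphere_measure)
  also have "\<dots> = emeasure sph A"
    using AE_sph_norm by (intro emeasure_eq_AE) (auto elim!: eventually_mono)
  finally show "emeasure (distr uniform_sphere_measure borel (\<lambda>x. x)) A = emeasure sph A" .
qed simp

lemma nn_integral_sph_orthogonal:
  fixes T :: "'a::euclidean_space \<Rightarrow> 'a"
  assumes T: "orthogonal_transformation T" and f[measurable]: "f \<in> borel_measurable borel"
  shows "(\<integral>\<^sup>+x. f (T x) \<partial>sph) = (\<integral>\<^sup>+x. f x \<partial>sph)"
proof -
  note [measurable] = orthogonal_transformation_borel_measurable[OF T]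
  have lin: "linear T" using T by (simp add: orthogonal_transformation_linear)
  have eq: "(\<integral>\<^sup>+x. g x \<partial>sph) =
      (\<integral>\<^sup>+x. g (sgn x) * indicator (ball 0 1) x \<partial>lborel) / emeasure lborel (ball (0::'a) 1)"
    if [measurable]: "g \<in> borel_measurable borel" for g :: "'a \<Rightarrow> ennreal"
    unfolding sph_def by (subst nn_integral_distr) (auto simp: nn_integral_uniform_measure)
  have sg: "T (sgn x) = sgn (T x)" for x
    by (simp add: sgn_div_norm linear_cmul[OF lin] orthogonal_transformation_norm[OF T])
  have "(\<integral>\<^sup>+x. f (T (sgn x)) * indicator (ball 0 1) x \<partial>lborel)
      = (\<integral>\<^sup>+x. f (sgn (T x)) * indicator (ball (0::'a) 1) (T x) \<partial>lborel)"
    by (intro nn_integral_cong)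
       (auto simp: indicator_def sg orthogonal_transformation_norm[OF T])
  also have "\<dots> = (\<integral>\<^sup>+x. f (sgn x) * indicator (ball (0::'a) 1) x \<partial>lborel)"
    by (rule nn_integral_lborel_orthogonal[OF T,
          where f="\<lambda>x. f (sgn x) * indicator (ball (0::'a) 1) x"])
       (intro borel_measurable_times_ennreal borel_measurable_indicator measurable_compose[OF borel_measurable_sgn f], auto)
  finally show ?thesis by (simp add: eq)
qed

lemma distr_sph_orthogonal:
  assumes T: "orthogonal_transformation (T :: 'a::euclidean_space \<Rightarrow> 'a)"
  shows "distr sph borel T = sph"
proof (rule measure_eqI)
  note [measurable] = orthogonal_transformation_borel_measurable[OF T]
  fix A :: "'a set" assume "A \<in> sets (distr sph borel T)"
  then have A[measurable]: "A \<in> sets borel" by simp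
  have "emeasure (distr sph borel T) A = (\<integral>\<^sup>+x. indicator A x \<partial>distr sph borel T)" by simp
  also have "\<dots> = (\<integral>\<^sup>+x. indicator A (T x) \<partial>sph)" by (subst nn_integral_distr) auto
  also have "\<dots> = (\<integral>\<^sup>+x. indicator A x \<partial>sph)"
    by (rule nn_integral_sph_orthogonal[OF T]) auto
  finally show "emeasure (distr sph borel T) A = emeasure sph A" by simp
qed simp

definition reflect :: "'a::real_inner \<Rightarrow> 'a \<Rightarrow> 'a" where
  "reflect a x = x - (2 * (x \<bullet> a) / (a \<bullet> a)) *\<^sub>R a"

lemma orthogonal_transformation_reflect: "orthogonal_transformation (reflect a)"
proof -
  have "linear (reflect a)"
    unfolding reflect_def
    by (rule linearI) (simp_all add: inner_add_left algebra_simps add_divide_distrib)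
  moreover have "reflect a v \<bullet> reflect a w = v \<bullet> w" for v w
    by (cases "a = 0") (simp_all add: reflect_def inner_diff_left inner_diff_right inner_commute field_simps)
  ultimately show ?thesis by (simp add: orthogonal_transformation_def)
qed

lemma reflect_swap: "norm u = norm v \<Longrightarrow> reflect (u - v) u = v"
proof (cases "u = v")
  case False
  assume n: "norm u = norm v"
  have uv: "u \<bullet> u = v \<bullet> v" using n by (simp add: norm_eq)
  have "(u - v) \<bullet> (u - v) = 2 * (u \<bullet> (u - v))"
    using uv by (simp add: inner_diff_left inner_diff_right inner_commute)
  moreover have "(u - v) \<bullet> (u - v) \<noteq> 0" using False by simp
  ultimately have "2 * (u \<bullet> (u - v)) / ((u - v) \<bullet> (u - v)) = 1" by (metis divide_self)
  then show ?thesis by (simp only: reflect_def) simp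
qed (simp add: reflect_def)

text \<open>Two reflections suffice: the first moves \<open>x\<close> to \<open>x'\<close>, the second moves the image of \<open>e\<close> to \<open>e'\<close>
  and fixes \<open>x'\<close> because its mirror contains \<open>x'\<close>.\<close>

lemma orthogonal_transformation_pair:
  fixes x e x' e' :: "'a::euclidean_space"
  assumes "norm x = norm x'" "norm e = norm e'" "x \<bullet> e = x' \<bullet> e'"
  obtains T where "orthogonal_transformation T" "T x = x'" "T e = e'"
proof -
  let ?R = "reflect (x - x')"
  let ?Q = "reflect (?R e - e')"
  have R: "orthogonal_transformation ?R" and Q: "orthogonal_transformation ?Q"
    by (rule orthogonal_transformation_reflect)+
  have 1: "?R x = x'" by (rule reflect_swap) fact
  have 2: "?Q (?R e) = e'"
    by (rule reflect_swap) (simp add: orthogonal_transformation_norm[OF R] assms)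
  have "x' \<bullet> ?R e = x \<bullet> e"
    using R unfolding orthogonal_transformation_def by (metis 1)
  then have "x' \<bullet> (?R e - e') = 0" using assms(3) by (simp add: inner_diff_right)
  then have "?Q x' = x'" by (simp add: reflect_def)
  then show ?thesis
    using that[of "?Q \<circ> ?R"] 1 2 orthogonal_transformation_compose[OF Q R] by auto
qed

lemma nn_integral_sph_pair:
  fixes x e x' e' :: "'a::euclidean_space"
  assumes "norm x = norm x'" "norm e = norm e'" "x \<bullet> e = x' \<bullet> e'"
  assumes F[measurable]: "(\<lambda>p. F (fst p) (snd p)) \<in> borel_measurable (borel \<Otimes>\<^sub>M borel)"
  shows "(\<integral>\<^sup>+y. F (x \<bullet> y) (e \<bullet> y) \<partial>sph) = (\<integral>\<^sup>+y. F (x' \<bullet> y) (e' \<bullet> y) \<partial>sph)"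
proof -
  obtain T where T: "orthogonal_transformation T" "T x = x'" "T e = e'"
    using orthogonal_transformation_pair[OF assms(1-3)] .
  have m: "(\<lambda>y. F (x' \<bullet> y) (e' \<bullet> y)) \<in> borel_measurable borel"
    using measurable_compose[OF _ F, of "\<lambda>y. (x' \<bullet> y, e' \<bullet> y)" borel] by simp
  have "x \<bullet> y = x' \<bullet> T y" "e \<bullet> y = e' \<bullet> T y" for y
    using T by (auto simp: orthogonal_transformation_def)
  then show ?thesis using nn_integral_sph_orthogonal[OF T(1) m] by simp
qed

text \<open>The joint law of \<open>(x \<bullet> y, e \<bullet> y)\<close> under the surface measure depends on the pair \<open>(x, e)\<close> only
  through its inner products. Every use of the rotation group below is an instance of this.\<close>

lemma integral_sph_pair:
  fixes x e x' e' :: "'a::euclidean_space" and F :: "real \<Rightarrow> real \<Rightarrow> real"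
  assumes "norm x = norm x'" "norm e = norm e'" "x \<bullet> e = x' \<bullet> e'"
  assumes F[measurable]: "(\<lambda>p. F (fst p) (snd p)) \<in> borel_measurable (borel \<Otimes>\<^sub>M borel)"
  shows "(\<integral>y. F (x \<bullet> y) (e \<bullet> y) \<partial>sph) = (\<integral>y. F (x' \<bullet> y) (e' \<bullet> y) \<partial>sph)"
proof -
  obtain T where T: "orthogonal_transformation T" "T x = x'" "T e = e'"
    using orthogonal_transformation_pair[OF assms(1-3)] .
  note [measurable] = orthogonal_transformation_borel_measurable[OF T(1)]
  have m: "(\<lambda>y. F (x' \<bullet> y) (e' \<bullet> y)) \<in> borel_measurable borel"
    using measurable_compose[OF _ F, of "\<lambda>y. (x' \<bullet> y, e' \<bullet> y)" borel] by simp
  have "x \<bullet> y = x' \<bullet> T y" "e \<bullet> y = e' \<bullet> T y" for y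
    using T by (auto simp: orthogonal_transformation_def)
  then have "(\<integral>y. F (x \<bullet> y) (e \<bullet> y) \<partial>sph) = (\<integral>y. F (x' \<bullet> T y) (e' \<bullet> T y) \<partial>sph)" by simp
  also have "\<dots> = (\<integral>y. F (x' \<bullet> y) (e' \<bullet> y) \<partial>distr sph borel T)"
    by (subst integral_distr) (use m in auto)
  finally show ?thesis by (simp add: distr_sph_orthogonal[OF T(1)])
qed

lemma nn_integral_sph_zonal:
  fixes x x' :: "'a::euclidean_space"
  assumes "norm x = norm x'" and [measurable]: "F \<in> borel_measurable borel"
  shows "(\<integral>\<^sup>+y. F (x \<bullet> y) \<partial>sph) = (\<integral>\<^sup>+y. F (x' \<bullet> y) \<partial>sph)"
  by (rule nn_integral_sph_pair[of x x' x x' "\<lambda>a b. F a"]) (use assms in \<open>auto simp: norm_eq\<close>)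

lemma integral_sph_zonal:
  fixes x x' :: "'a::euclidean_space" and F :: "real \<Rightarrow> real"
  assumes "norm x = norm x'" and [measurable]: "F \<in> borel_measurable borel"
  shows "(\<integral>y. F (x \<bullet> y) \<partial>sph) = (\<integral>y. F (x' \<bullet> y) \<partial>sph)"
  by (rule integral_sph_pair[of x x' x x' "\<lambda>a b. F a"]) (use assms in \<open>auto simp: norm_eq\<close>)

lemma integrable_sph_zonal:
  fixes x x' :: "'a::euclidean_space" and F :: "real \<Rightarrow> real"
  assumes "norm x = norm x'" and [measurable]: "F \<in> borel_measurable borel"
   and "integrable sph (\<lambda>y. F (x \<bullet> y))"
 shows "integrable sph (\<lambda>y. F (x' \<bullet> y))"
  using assms(3) nn_integral_sph_zonal[OF assms(1), of "\<lambda>t. ennreal (norm (F t))"]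
  by (simp add: integrable_iff_bounded)

section \<open>Projective distance and spherical caps\<close>

text \<open>For unit vectors this is the smaller one of \<open>norm (x - y)\<close> and \<open>norm (x + y)\<close>, so it is a
  metric on lines. It is comparable to the angle and has an elementary triangle inequality.\<close>

definition chord :: "'a::real_inner \<Rightarrow> 'a \<Rightarrow> real" where
  "chord x y = sqrt (2 - 2 * \<bar>x \<bullet> y\<bar>)"

lemma chord_commute: "chord x y = chord y x"
  by (simp add: chord_def inner_commute)

lemma chord_minus[simp]: "chord (- x) y = chord x y" "chord x (- y) = chord x y"
  by (simp_all add: chord_def)

lemma abs_inner_unit_le: "norm x = 1 \<Longrightarrow> norm y = 1 \<Longrightarrow> \<bar>x \<bullet> y\<bar> \<le> 1"
  using Cauchy_Schwarz_ineq2[of x y] by simp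

lemma chord_eq_norm:
  assumes "norm x = 1" "norm y = 1"
  shows "0 \<le> x \<bullet> y \<Longrightarrow> chord x y = norm (x - y)" "chord x y \<le> norm (x - y)"
proof -
  have "(norm (x - y))\<^sup>2 = 2 - 2 * (x \<bullet> y)"
    using assms by (simp add: power2_norm_eq_inner inner_diff_left inner_diff_right inner_commute norm_eq_1)
  then have n: "norm (x - y) = sqrt (2 - 2 * (x \<bullet> y))"
    by (metis norm_ge_zero real_sqrt_unique)
  show "0 \<le> x \<bullet> y \<Longrightarrow> chord x y = norm (x - y)" by (simp add: n chord_def)
  show "chord x y \<le> norm (x - y)" by (simp add: n chord_def)
qed

lemma chord_triangle:
  fixes x y z :: "'a::real_inner"
  assumes "norm x = 1" "norm y = 1" "norm z = 1"
  shows "chord x y \<le> chord x z + chord z y"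
proof -
  obtain x' where x': "norm x' = 1" "0 \<le> x' \<bullet> z" "\<And>w. chord x' w = chord x w"
  proof (cases "0 \<le> x \<bullet> z")
    case True then show ?thesis using that[of x] assms by auto
  next
    case False then show ?thesis using that[of "-x"] assms by auto
  qed
  obtain y' where y': "norm y' = 1" "0 \<le> z \<bullet> y'" "\<And>w. chord w y' = chord w y"
  proof (cases "0 \<le> z \<bullet> y")
    case True then show ?thesis using that[of y] assms by auto
  next
    case False then show ?thesis using that[of "-y"] assms by auto
  qed
  have "chord x y = chord x' y'" by (simp add: x' y')
  also have "\<dots> \<le> norm (x' - y')" by (rule chord_eq_norm) (use x' y' in auto)
  also have "\<dots> \<le> norm (x' - z) + norm (z - y')" using norm_triangle_ineq[of "x' - z" "z - y'"] by simp
  also have "\<dots> = chord x' z + chord z y'"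
    using chord_eq_norm(1)[of x' z] chord_eq_norm(1)[of z y'] x'(1,2) y'(1,2) assms by simp
  finally show ?thesis by (simp add: x' y')
qed

lemma chord_bounds: "norm x = 1 \<Longrightarrow> norm y = 1 \<Longrightarrow> 0 \<le> chord x y \<and> chord x y \<le> sqrt 2"
  using abs_inner_unit_le[of x y] by (simp add: chord_def)

lemma chord_measurable[measurable (raw)]:
  fixes f g :: "'b \<Rightarrow> 'a::euclidean_space"
  assumes [measurable]: "f \<in> borel_measurable M" "g \<in> borel_measurable M"
  shows "(\<lambda>x. chord (f x) (g x)) \<in> borel_measurable M"
  unfolding chord_def by measurable

definition cap :: "'a::real_inner \<Rightarrow> real \<Rightarrow> 'a set" where
  "cap e s = {y. chord e y < s}"

lemma cap_sets[measurable, simp]: "cap (e::'a::euclidean_space) s \<in> sets borel"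
  unfolding cap_def by measurable

lemma emeasure_cap_eq:
  fixes e e' :: "'a::euclidean_space"
  assumes "norm e = norm e'"
  shows "emeasure sph (cap e s) = emeasure sph (cap e' s)"
proof -
  have "emeasure sph (cap e s) = (\<integral>\<^sup>+y. indicator {..<s} (sqrt (2 - 2 * \<bar>e \<bullet> y\<bar>)) \<partial>sph)" for e :: 'a
    by (subst nn_integral_indicator[symmetric], simp, intro nn_integral_cong)
       (auto simp: cap_def chord_def indicator_def)
  then show ?thesis
    using nn_integral_sph_zonal[OF assms, of "\<lambda>t. indicator {..<s} (sqrt (2 - 2 * \<bar>t\<bar>))"]
    by simp
qed

lemma prod_Basis_if:
  assumes "k \<in> (Basis :: 'a::euclidean_space set)"
  shows "(\<Prod>b\<in>(Basis :: 'a set). if b = k then a else (c::real)) = a * c ^ (DIM('a) - 1)"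
  using assms by (subst prod.remove[of _ k]) auto

lemma inner_Basis_sum:
  assumes "b \<in> (Basis :: 'a::euclidean_space set)"
  shows "(\<Sum>i\<in>(Basis::'a set). (if i = k then p else q) *\<^sub>R i) \<bullet> b = (if b = k then p else q)"
  using assms by (rule inner_sum_left_Basis)

lemma content_axis_box:
  fixes k :: "'a::euclidean_space"
  assumes k: "k \<in> Basis" and "p \<le> p'" "q \<le> q'"
  shows "emeasure lborel (cbox (\<Sum>i\<in>Basis. (if i = k then p else q) *\<^sub>R i)
           (\<Sum>i\<in>Basis. (if i = k then p' else q') *\<^sub>R i)) = ennreal ((p' - p) * (q' - q) ^ (DIM('a) - 1))"
proof -
  have "(\<Prod>b\<in>Basis. ((\<Sum>i\<in>Basis. (if i = k then p' else q') *\<^sub>R i)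
           - (\<Sum>i\<in>Basis. (if i = k then p else q) *\<^sub>R i)) \<bullet> b)
      = (\<Prod>b\<in>(Basis::'a set). if b = k then p' - p else q' - q)"
    by (intro prod.cong refl) (auto simp: inner_diff_left inner_Basis_sum)
  then show ?thesis
    by (subst emeasure_lborel_cbox) (use assms in \<open>auto simp: inner_Basis_sum prod_Basis_if\<close>)
qed

lemma sum_Basis_square: "(\<Sum>b\<in>Basis. (y \<bullet> b)\<^sup>2) = (norm (y::'a::euclidean_space))\<^sup>2"
  unfolding power2_norm_eq_inner by (simp only: power2_eq_square euclidean_inner[of y y])

text \<open>A cap of radius \<open>s\<close> has measure of order \<open>s ^ (DIM('a) - 1)\<close>. For the upper bound the cone
  over the cap inside the unit ball is enclosed in a box of length 2 and width \<open>2 * s\<close>.\<close>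

lemma cap_upper:
  "\<exists>C>0. \<forall>(e::'a::euclidean_space) s. norm e = 1 \<longrightarrow> 0 < s \<longrightarrow>
     emeasure sph (cap e s) \<le> ennreal (C * s ^ (DIM('a) - 1))"
proof -
  let ?d = "DIM('a) - 1"
  define v where "v = measure lborel (ball (0::'a) 1)"
  have v: "v > 0" "emeasure lborel (ball (0::'a) 1) = ennreal v"
    using content_ball_pos[of 1 "0::'a"] emeasure_lborel_ball_finite[of "0::'a" 1]
    by (auto simp: v_def emeasure_eq_ennreal_measure)
  define C where "C = max 1 (2 * 2 ^ ?d / v)"
  obtain k :: 'a where k: "k \<in> Basis" using nonempty_Basis by blast
  have "emeasure sph (cap e s) \<le> ennreal (C * s ^ ?d)" if e: "norm e = 1" and s: "0 < s" for e :: 'a and s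
  proof (cases "s\<^sup>2 \<le> 2")
    case False
    then have "1 \<le> s" by (smt (verit) one_power2 power_mono s)
    then have "1 * 1 \<le> C * s ^ ?d" by (intro mult_mono) (auto simp: C_def)
    then show ?thesis
      using sph.emeasure_le_1[of "cap e s"] by (metis ennreal_1 ennreal_leI mult_1 order_trans)
  next
    case True
    let ?B = "cbox (\<Sum>i\<in>Basis. (if i = k then -1 else -s) *\<^sub>R i) (\<Sum>i\<in>Basis. (if i = k then 1 else s) *\<^sub>R i)"
    have "emeasure sph (cap e s) = emeasure sph (cap k s)"
      by (rule emeasure_cap_eq) (use e k in simp)
    also have "\<dots> = emeasure lborel {x \<in> ball 0 1. sgn x \<in> cap k s} / emeasure lborel (ball (0::'a) 1)"
      by (simp add: emeasure_sph)
    also have "\<dots> \<le> emeasure lborel ?B / emeasure lborel (ball (0::'a) 1)"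
    proof (intro divide_right_mono_ennreal emeasure_mono subsetI)
      fix x assume "x \<in> {x \<in> ball 0 1. sgn x \<in> cap k s}"
      then have x: "norm x < 1" "chord k (sgn x) < s" by (auto simp: cap_def)
      have xk: "\<bar>x \<bullet> k\<bar> \<le> 1" using Basis_le_norm[OF k, of x] x by simp
      have "\<bar>x \<bullet> b\<bar> \<le> s" if b: "b \<in> Basis" "b \<noteq> k" for b
      proof (cases "x = 0")
        case False
        define y where "y = sgn x"
        have y: "norm y = 1" using False by (simp add: y_def norm_sgn)
        have "2 - 2 * \<bar>k \<bullet> y\<bar> < s\<^sup>2"
        proof -
          have "sqrt (2 - 2 * \<bar>k \<bullet> y\<bar>) < sqrt (s\<^sup>2)" using x(2) s by (simp add: chord_def y_def)
          then show ?thesis by (simp only: real_sqrt_less_iff)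
        qed
        then have "1 - s\<^sup>2/2 < \<bar>k \<bullet> y\<bar>" by simp
        then have "(1 - s\<^sup>2/2)\<^sup>2 \<le> (k \<bullet> y)\<^sup>2"
          using True by (intro abs_le_square_iff[THEN iffD1]) auto
        moreover have "(1 - s\<^sup>2/2)\<^sup>2 = 1 - s\<^sup>2 + (s\<^sup>2/2)\<^sup>2" by (simp add: power2_diff)
        ultimately have "1 - s\<^sup>2 \<le> (k \<bullet> y)\<^sup>2" using zero_le_power2[of "s\<^sup>2/2"] by linarith
        moreover have "(\<Sum>b\<in>{b, k}. (y \<bullet> b)\<^sup>2) \<le> (\<Sum>b\<in>Basis. (y \<bullet> b)\<^sup>2)"
          using b k by (intro sum_mono2) auto
        ultimately have "(y \<bullet> b)\<^sup>2 \<le> s\<^sup>2"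
          using b y by (simp add: sum_Basis_square) (simp add: inner_commute)
        then have "\<bar>y \<bullet> b\<bar> \<le> s" using s by (simp add: abs_le_square_iff[symmetric])
        moreover have "x \<bullet> b = norm x * (y \<bullet> b)" using False by (simp add: y_def sgn_div_norm)
        then have "\<bar>x \<bullet> b\<bar> = norm x * \<bar>y \<bullet> b\<bar>" by (simp add: abs_mult)
        ultimately show ?thesis
          using x(1) mult_mono[of "norm x" 1 "\<bar>y \<bullet> b\<bar>" s] by auto
      qed (use s in simp)
      then have "- s \<le> x \<bullet> b \<and> x \<bullet> b \<le> s" if "b \<in> Basis" "b \<noteq> k" for b
        using that by (simp add: abs_le_iff) (metis minus_le_iff)
      moreover have "- 1 \<le> x \<bullet> k \<and> x \<bullet> k \<le> 1" using xk by (auto simp: abs_le_iff)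
      ultimately show "x \<in> ?B" by (simp add: mem_box inner_Basis_sum)
    qed auto
    also have "\<dots> = ennreal (2 * (2 * s) ^ ?d) / ennreal v"
      using s by (subst content_axis_box[OF k]) (auto simp: v)
    also have "\<dots> = ennreal (2 * (2 * s) ^ ?d / v)"
      using s v by (intro divide_ennreal) auto
    also have "\<dots> \<le> ennreal (C * s ^ ?d)"
    proof (intro ennreal_leI)
      have "2 * (2 * s) ^ ?d / v = (2 * 2 ^ ?d / v) * s ^ ?d" by (simp add: power_mult_distrib)
      also have "\<dots> \<le> C * s ^ ?d" using s by (intro mult_right_mono) (auto simp: C_def)
      finally show "2 * (2 * s) ^ ?d / v \<le> C * s ^ ?d" .
    qed
    finally show ?thesis .
  qed
  moreover have "C > 0" by (simp add: C_def)
  ultimately show ?thesis by (intro exI[of _ C] conjI allI impI)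
qed

text \<open>The cone over the cap contains a box around the segment from \<open>1/2\<close> to \<open>3/4\<close> on its axis, whose
  width is a fixed multiple of \<open>s\<close>.\<close>

lemma cap_lower:
  "\<exists>c>0. \<forall>(e::'a::euclidean_space) s. norm e = 1 \<longrightarrow> 0 < s \<longrightarrow> s \<le> sqrt 2 \<longrightarrow>
     ennreal (c * s ^ (DIM('a) - 1)) \<le> emeasure sph (cap e s)"
proof -
  let ?d = "DIM('a) - 1"
  define v where "v = measure lborel (ball (0::'a) 1)"
  have v: "v > 0" "emeasure lborel (ball (0::'a) 1) = ennreal v"
    using content_ball_pos[of 1 "0::'a"] emeasure_lborel_ball_finite[of "0::'a" 1]
    by (auto simp: v_def emeasure_eq_ennreal_measure)
  define n where "n = real DIM('a)"
  have n: "n \<ge> 1" using DIM_positive[where 'a='a] by (simp add: n_def Suc_leI del: DIM_positive)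
  define h where "h = 1 / (4 * n)"
  have h: "h > 0" using n by (simp add: h_def)
  define c where "c = (1/4) * (2 * h) ^ ?d / v"
  obtain k :: 'a where k: "k \<in> Basis" using nonempty_Basis by blast
  have "ennreal (c * s ^ ?d) \<le> emeasure sph (cap e s)"
    if e: "norm e = 1" and s: "0 < s" "s \<le> sqrt 2" for e :: 'a and s
  proof -
    let ?B = "cbox (\<Sum>i\<in>Basis. (if i = k then 1/2 else - (h * s)) *\<^sub>R i)
                   (\<Sum>i\<in>Basis. (if i = k then 3/4 else h * s) *\<^sub>R i)"
    have s2: "s\<^sup>2 \<le> 2" using s by (metis less_eq_real_def power_mono real_sqrt_pow2 zero_le_numeral)
    have "ennreal (c * s ^ ?d) = ennreal ((1/4) * (2 * (h * s)) ^ ?d / v)"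
      by (simp add: c_def power_mult_distrib mult_ac)
    also have "\<dots> = ennreal ((1/4) * (2 * (h * s)) ^ ?d) / ennreal v"
      using s v h by (intro divide_ennreal[symmetric]) auto
    also have "\<dots> = emeasure lborel ?B / emeasure lborel (ball (0::'a) 1)"
      using s h by (subst content_axis_box[OF k]) (auto simp: v)
    also have "\<dots> \<le> emeasure lborel {x \<in> ball 0 1. sgn x \<in> cap k s} / emeasure lborel (ball (0::'a) 1)"
    proof (intro divide_right_mono_ennreal emeasure_mono subsetI)
      fix x assume x: "x \<in> ?B"
      have xb: "\<bar>x \<bullet> b\<bar> \<le> h * s" if "b \<in> Basis" "b \<noteq> k" for b
        using x that by (force simp: mem_box inner_Basis_sum abs_le_iff)
      have xk: "1/2 \<le> x \<bullet> k" "x \<bullet> k \<le> 3/4" using x k by (force simp: mem_box inner_Basis_sum)+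
      define r where "r = (\<Sum>b\<in>Basis - {k}. (x \<bullet> b)\<^sup>2)"
      have nx: "(norm x)\<^sup>2 = (x \<bullet> k)\<^sup>2 + r"
        using k unfolding sum_Basis_square[symmetric] r_def by (subst sum.remove[of _ k]) auto
      have "r \<le> (\<Sum>b\<in>Basis - {k}. (h * s)\<^sup>2)" unfolding r_def
      proof (intro sum_mono)
        fix b assume "b \<in> Basis - {k}"
        then show "(x \<bullet> b)\<^sup>2 \<le> (h * s)\<^sup>2"
          using xb[of b] s h by (auto simp: abs_le_square_iff[symmetric])
      qed
      also have "\<dots> \<le> n * (h * s)\<^sup>2"
        using k by (simp add: n_def mult_right_mono)
      also have "\<dots> = s\<^sup>2 / (16 * n)" using n by (simp add: h_def power_mult_distrib power_divide power2_eq_square)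
      also have "\<dots> \<le> s\<^sup>2 / 16" using n by (intro divide_left_mono) auto
      finally have r: "r \<le> s\<^sup>2 / 16" .
      have "(x \<bullet> k)\<^sup>2 \<le> (3/4)\<^sup>2" using xk by (intro power_mono) auto
      then have n1: "(norm x)\<^sup>2 < 1\<^sup>2" unfolding nx using r s2 by (simp add: power2_eq_square)
      then have nx1: "norm x < 1" by (rule power2_less_imp_less) simp
      have "(1/2)\<^sup>2 \<le> (x \<bullet> k)\<^sup>2" using xk by (intro power_mono) auto
      then have k4: "1/4 \<le> (x \<bullet> k)\<^sup>2" by (simp add: power2_eq_square)
      have r0: "r \<ge> 0" by (simp add: r_def sum_nonneg)
      have n4: "1/4 \<le> (norm x)\<^sup>2" using nx k4 r0 by simp
      then have x0: "x \<noteq> 0" by auto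
      define t where "t = k \<bullet> sgn x"
      have t: "t = (x \<bullet> k) / norm x" by (simp add: t_def sgn_div_norm inner_commute divide_inverse mult.commute)
      have t0: "0 < t" using t xk x0 by simp
      have t1: "t \<le> 1" using abs_inner_unit_le[of k "sgn x"] x0 k by (simp add: t_def norm_sgn)
      have "t\<^sup>2 * (norm x)\<^sup>2 = (x \<bullet> k)\<^sup>2" using x0 by (simp add: t power_divide)
      then have "t\<^sup>2 * (norm x)\<^sup>2 = (norm x)\<^sup>2 - r" using nx by simp
      then have "(1 - t\<^sup>2) * (norm x)\<^sup>2 = r" by (simp add: algebra_simps)
      moreover have "(1 - t\<^sup>2) * (1/4) \<le> (1 - t\<^sup>2) * (norm x)\<^sup>2"
        using n4 t0 t1 by (intro mult_left_mono) (auto simp: power_le_one)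
      ultimately have "1 - t\<^sup>2 \<le> s\<^sup>2 / 4" using r by simp
      moreover have "t\<^sup>2 \<le> t" using t0 t1 by (simp add: power2_eq_square)
      moreover have "0 < s\<^sup>2" using s by simp
      ultimately have "2 - 2 * t < s\<^sup>2" by linarith
      then have "chord k (sgn x) < s"
        using t0 s by (simp add: chord_def t_def[symmetric] real_less_lsqrt)
      then show "x \<in> {x \<in> ball 0 1. sgn x \<in> cap k s}" using nx1 by (simp add: cap_def)
    qed measurable
    also have "\<dots> = emeasure sph (cap k s)" by (simp add: emeasure_sph)
    also have "\<dots> = emeasure sph (cap e s)"
      by (rule emeasure_cap_eq) (use e k in simp)
    finally show ?thesis .
  qed
  moreover have "c > 0" using h v by (simp add: c_def)
  ultimately show ?thesis by (intro exI[of _ c] conjI allI impI)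
qed

text \<open>A pair of antipodal points lies in caps of arbitrarily small radius.\<close>

lemma AE_sph_abs_inner_less_1:
  fixes e :: "'a::euclidean_space"
  assumes e: "norm e = 1" and d: "DIM('a) \<ge> 2"
  shows "AE y in sph. \<bar>e \<bullet> y\<bar> < 1"
proof -
  obtain C where C: "C > 0" "\<forall>(e::'a) s. norm e = 1 \<longrightarrow> 0 < s \<longrightarrow>
        emeasure sph (cap e s) \<le> ennreal (C * s ^ (DIM('a) - 1))" using cap_upper[where 'a='a] by (elim exE conjE)
  let ?N = "{y. 1 \<le> \<bar>e \<bullet> y\<bar>}"
  have N: "?N \<in> sets borel" by measurable
  have "emeasure sph ?N \<le> ennreal \<epsilon>" if "\<epsilon> > 0" for \<epsilon> :: real
  proof -
    define s where "s = min 1 (\<epsilon> / C)"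
    have s: "0 < s" "s \<le> 1" "s \<le> \<epsilon> / C" using that C by (auto simp: s_def)
    have "?N \<subseteq> cap e s"
    proof
      fix y assume "y \<in> ?N"
      then have "chord e y \<le> 0" by (simp add: chord_def)
      then show "y \<in> cap e s" using s by (simp add: cap_def)
    qed
    then have "emeasure sph ?N \<le> emeasure sph (cap e s)" by (intro emeasure_mono) auto
    also have "\<dots> \<le> ennreal (C * s ^ (DIM('a) - 1))" using C e s by blast
    also have "\<dots> \<le> ennreal \<epsilon>"
    proof (intro ennreal_leI)
      have "s ^ (DIM('a) - 1) \<le> s ^ 1" using s d by (intro power_decreasing) auto
      then have "C * s ^ (DIM('a) - 1) \<le> C * s" using C(1) by simp
      also have "\<dots> \<le> \<epsilon>" using s(3) C(1) by (simp add: field_simps)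
      finally show "C * s ^ (DIM('a) - 1) \<le> \<epsilon>" .
    qed
    finally show ?thesis .
  qed
  note le = this
  have "emeasure sph ?N \<le> 0"
  proof (rule ennreal_le_epsilon)
    fix \<epsilon> :: real assume "0 < \<epsilon>"
    from le[OF this] show "emeasure sph ?N \<le> 0 + ennreal \<epsilon>" by (simp only: add_0)
  qed
  then have "?N \<in> null_sets sph" using N by (auto simp: null_sets_def)
  then show ?thesis by (rule AE_I') (auto simp: not_less)
qed

section \<open>Zonal kernels and the Funk-Hecke property\<close>

interpretation sph2: pair_prob_space "sph :: 'a::euclidean_space measure" "sph :: 'a measure" ..

lemma borel_measurable_poly[measurable (raw)]:
  fixes f :: "'b \<Rightarrow> real"
  assumes "f \<in> borel_measurable M"
  shows "(\<lambda>x. poly p (f x)) \<in> borel_measurable M"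
  using measurable_compose[OF assms, of "poly p" borel]
  by (simp add: borel_measurable_continuous_onI continuous_on_poly)

lemma integrable_mult_bounded:
  fixes f g :: "'b \<Rightarrow> real"
  assumes f: "integrable M f" and [measurable]: "g \<in> borel_measurable M"
    and g: "AE x in M. \<bar>g x\<bar> \<le> B"
  shows "integrable M (\<lambda>x. f x * g x)"
proof (rule Bochner_Integration.integrable_bound)
  show "integrable M (\<lambda>x. B * f x)" using f by simp
  show "(\<lambda>x. f x * g x) \<in> borel_measurable M" using f by measurable
  show "AE x in M. norm (f x * g x) \<le> norm (B * f x)"
    using g
  proof eventually_elim
    case (elim x)
    then have "\<bar>g x\<bar> * \<bar>f x\<bar> \<le> \<bar>B\<bar> * \<bar>f x\<bar>" by (intro mult_right_mono) auto
    then show ?case by (simp add: abs_mult mult.commute)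
  qed
qed

lemma poly_sq_bound:
  fixes p :: "real poly"
  shows "\<exists>B. \<forall>t. \<bar>t\<bar> \<le> 1 \<longrightarrow> \<bar>poly p (t\<^sup>2)\<bar> \<le> B"
proof -
  have "compact ((\<lambda>t. poly p (t\<^sup>2)) ` {-1..1})"
    by (intro compact_continuous_image continuous_intros) auto
  then have "bounded ((\<lambda>t. poly p (t\<^sup>2)) ` {-1..1})" by (rule compact_imp_bounded)
  then obtain B where B: "B > 0" "\<forall>x\<in>(\<lambda>t. poly p (t\<^sup>2)) ` {-1..1}. norm x \<le> B"
    by (auto simp: bounded_pos)
  have "\<bar>poly p (t\<^sup>2)\<bar> \<le> B" if "\<bar>t\<bar> \<le> 1" for t
  proof -
    have "t \<in> {-1..1}" using that by (auto simp: abs_le_iff)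
    then show ?thesis using B(2) by (metis image_eqI real_norm_def)
  qed
  then show ?thesis by (intro exI[of _ B]) simp
qed

lemma AE_sph_inner_le_1: "norm (e::'a::euclidean_space) = 1 \<Longrightarrow> AE y in sph. \<bar>e \<bullet> y\<bar> \<le> 1"
  using AE_sph_norm by eventually_elim (rule abs_inner_unit_le)

lemma AE_sph2_norm:
  "AE p in (sph \<Otimes>\<^sub>M sph :: ('a::euclidean_space \<times> 'a) measure). norm (fst p) = 1 \<and> norm (snd p) = 1"
proof (rule sph2.AE_pair_measure)
  show "{p \<in> space (sph \<Otimes>\<^sub>M sph). norm (fst p :: 'a) = 1 \<and> norm (snd p :: 'a) = 1} \<in> sets (sph \<Otimes>\<^sub>M sph)"
    by measurable
  show "AE x in sph. AE y in sph. norm (fst (x::'a, y::'a)) = 1 \<and> norm (snd (x, y)) = 1"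
    using AE_sph_norm AE_sph_norm[where 'a='a] by (auto elim!: eventually_mono)
qed

lemma even_pow: "(z :: real) ^ (2 * q) = (z\<^sup>2) ^ q"
  by (simp add: power_mult)

text \<open>Fixing the type as a phantom parameter allows constants such as the poles, the zonal polynomials and
  the eigenvalues to depend on the dimension.\<close>

locale sphere_dim =
  fixes dummy :: "'a::euclidean_space itself"
  assumes dim: "2 \<le> DIM('a)"
begin

definition pole :: 'a where "pole = (SOME b. b \<in> Basis)"
definition equat :: 'a where "equat = (SOME b. b \<in> Basis \<and> b \<noteq> pole)"

lemma pole_Basis[simp]: "pole \<in> Basis"
  unfolding pole_def using nonempty_Basis by (metis ex_in_conv someI_ex)

lemma equat: "equat \<in> Basis" "equat \<noteq> pole"
proof -
  have "\<exists>b. b \<in> Basis \<and> b \<noteq> pole"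
  proof (rule ccontr)
    assume "\<nexists>b. b \<in> Basis \<and> b \<noteq> pole"
    then have "(Basis :: 'a set) \<subseteq> {pole}" by auto
    then have "DIM('a) \<le> card {pole :: 'a}" by (intro card_mono) auto
    then show False using dim by simp
  qed
  then show "equat \<in> Basis" "equat \<noteq> pole" unfolding equat_def by (metis (mono_tags, lifting) someI_ex)+
qed

lemma norm_pole[simp]: "norm pole = 1" by simp
lemma pole_pole[simp]: "pole \<bullet> pole = 1" by simp
lemma norm_equat[simp]: "norm equat = 1" by (simp add: equat)
lemma equat_equat[simp]: "equat \<bullet> equat = 1" by (simp add: equat)
lemma pole_equat[simp]: "pole \<bullet> equat = 0" "equat \<bullet> pole = 0"
  using equat by (auto simp: inner_Basis)

text \<open>The function \<open>k\<close> represents the kernel \<open>k (x \<bullet> y)\<close>, which lives on lines because \<open>k\<close> is even.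
  By invariance, integrability against one pole is integrability against every unit vector.\<close>

definition zonal_kernel :: "(real \<Rightarrow> real) \<Rightarrow> bool" where
  "zonal_kernel k \<longleftrightarrow> k \<in> borel_measurable borel \<and> (\<forall>t. k (- t) = k t) \<and>
     integrable (sph :: 'a measure) (\<lambda>y. k (pole \<bullet> y))"

lemma zonal_kernel_measurable[measurable_dest]: "zonal_kernel k \<Longrightarrow> k \<in> borel_measurable borel"
  by (simp add: zonal_kernel_def)

lemma zonal_kernel_integrable:
  assumes "zonal_kernel k" "norm x = 1"
  shows "integrable (sph :: 'a measure) (\<lambda>y. k (x \<bullet> y))"
  using integrable_sph_zonal[of pole x k] assms by (simp add: zonal_kernel_def)

lemma zonal_integral_eq:
  assumes "zonal_kernel k" "norm x = 1"
  shows "(\<integral>y. k (x \<bullet> y) \<partial>(sph :: 'a measure)) = (\<integral>y. k (pole \<bullet> y) \<partial>(sph :: 'a measure))"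
  by (rule integral_sph_zonal) (use assms in \<open>auto simp: zonal_kernel_def\<close>)

lemma zonal_kernel_poly: "zonal_kernel (\<lambda>t. poly p (t\<^sup>2))"
proof -
  obtain B where B: "\<forall>t. \<bar>t\<bar> \<le> 1 \<longrightarrow> \<bar>poly p (t\<^sup>2)\<bar> \<le> B" using poly_sq_bound[of p] by auto
  have "integrable (sph :: 'a measure) (\<lambda>y. 1 * poly p ((pole \<bullet> y)\<^sup>2))"
  proof (rule integrable_mult_bounded[where B=B])
    show "AE y in (sph :: 'a measure). \<bar>poly p ((pole \<bullet> y)\<^sup>2)\<bar> \<le> B"
      using AE_sph_inner_le_1[OF norm_pole] by eventually_elim (use B in simp)
  qed auto
  then show ?thesis by (simp add: zonal_kernel_def)
qed

lemma zonal_kernel_mult_poly: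
  assumes "zonal_kernel k" "norm x = 1" "norm e = 1"
  shows "integrable (sph :: 'a measure) (\<lambda>y. k (x \<bullet> y) * poly p ((e \<bullet> y)\<^sup>2))"
proof -
  obtain B where B: "\<forall>t. \<bar>t\<bar> \<le> 1 \<longrightarrow> \<bar>poly p (t\<^sup>2)\<bar> \<le> B" using poly_sq_bound[of p] by auto
  show ?thesis
  proof (rule integrable_mult_bounded[where B=B])
    show "AE y in (sph :: 'a measure). \<bar>poly p ((e \<bullet> y)\<^sup>2)\<bar> \<le> B"
      using AE_sph_inner_le_1[OF assms(3)] by eventually_elim (use B in simp)
  qed (use zonal_kernel_integrable assms in auto)
qed

lemma zonal_kernel_integrable2:
  assumes k: "zonal_kernel k" and [measurable]: "g \<in> borel_measurable (sph \<Otimes>\<^sub>M sph)"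
    and g: "\<And>x y. norm x = 1 \<Longrightarrow> norm y = 1 \<Longrightarrow> \<bar>g (x, y)\<bar> \<le> B"
  shows "integrable (sph \<Otimes>\<^sub>M sph :: ('a \<times> 'a) measure) (\<lambda>p. k (fst p \<bullet> snd p) * g p)"
proof (rule integrable_mult_bounded)
  note [measurable] = zonal_kernel_measurable[OF k]
  have ka: "zonal_kernel (\<lambda>t. \<bar>k t\<bar>)" using k by (auto simp: zonal_kernel_def)
  show "integrable (sph \<Otimes>\<^sub>M sph) (\<lambda>p. k (fst p \<bullet> snd (p :: 'a \<times> 'a)))"
  proof (rule sph2.Fubini_integrable)
    have "integrable (sph :: 'a measure) (\<lambda>x. (\<integral>y. \<bar>k (pole \<bullet> y)\<bar> \<partial>(sph :: 'a measure)))" by simp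
    then show "integrable (sph :: 'a measure) (\<lambda>x. \<integral>y. norm (k (fst (x, y :: 'a) \<bullet> snd (x, y))) \<partial>sph)"
    proof (rule integrable_cong_AE_imp)
      show "AE x in sph. (\<integral>y. \<bar>k (pole \<bullet> y)\<bar> \<partial>(sph :: 'a measure)) = (\<integral>y. norm (k (fst (x, y :: 'a) \<bullet> snd (x, y))) \<partial>sph)"
        using AE_sph_norm
      proof eventually_elim
        case (elim x)
        show ?case using zonal_integral_eq[OF ka elim] by simp
      qed
    qed measurable
    show "AE x in sph. integrable sph (\<lambda>y. k (fst (x, y) \<bullet> snd (x, y :: 'a)))"
      using AE_sph_norm
    proof eventually_elim
      case (elim x)
      show ?case using zonal_kernel_integrable[OF k elim] by simp
    qed
  qed measurable
  show "AE p in sph \<Otimes>\<^sub>M sph. \<bar>g p\<bar> \<le> B"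
    using AE_sph2_norm by eventually_elim (metis g prod.collapse)
qed measurable

text \<open>Writing \<open>e = t x + s v\<close> with \<open>v\<close> orthogonal to \<open>x\<close> and \<open>s\<^sup>2 = 1 - t\<^sup>2\<close>, the binomial expansion
  of \<open>(e \<bullet> y) ^ (2 * q)\<close> leaves integrals of \<open>k (x \<bullet> y) * (x \<bullet> y) ^ j * (v \<bullet> y) ^ (2 * q - j)\<close>, which do
  not depend on the pair \<open>(x, v)\<close>; those with odd \<open>j\<close> vanish under \<open>v \<mapsto> - v\<close>. What remains is a
  polynomial in \<open>t\<^sup>2\<close> and \<open>s\<^sup>2\<close>, hence in \<open>t\<^sup>2\<close>.\<close>

lemma funk_hecke_monomial:
  assumes k: "zonal_kernel k"
  shows "\<exists>r. degree r \<le> q \<and> (\<forall>x e. norm x = 1 \<longrightarrow> norm e = 1 \<longrightarrow>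
    (\<integral>y. k (x \<bullet> y) * (e \<bullet> y) ^ (2 * q) \<partial>(sph :: 'a measure)) = poly r ((x \<bullet> e)\<^sup>2))"
proof -
  note [measurable] = zonal_kernel_measurable[OF k]
  let ?u = "\<lambda>y::'a. pole \<bullet> y" and ?v = "\<lambda>y::'a. equat \<bullet> y"
  define M where "M j = (\<integral>y. k (?u y) * (?u y ^ j * ?v y ^ (2 * q - j)) \<partial>(sph :: 'a measure))" for j
  have int: "integrable (sph :: 'a measure) (\<lambda>y. k (?u y) * (?u y ^ j * ?v y ^ l))" for j l
  proof (rule integrable_mult_bounded[where B=1])
    show "AE y in (sph :: 'a measure). \<bar>?u y ^ j * ?v y ^ l\<bar> \<le> 1"
      using AE_sph_inner_le_1[OF norm_pole] AE_sph_inner_le_1[OF norm_equat]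
      by eventually_elim (auto simp: abs_mult power_abs intro!: mult_le_one power_le_one)
  qed (use zonal_kernel_integrable[OF k] in auto)
  have odd: "M j = 0" if "odd j" "j \<le> 2 * q" for j
  proof -
    have "M j = (\<integral>y. k (?u y) * (?u y ^ j * ((- equat) \<bullet> y) ^ (2 * q - j)) \<partial>(sph :: 'a measure))"
      unfolding M_def
      by (rule integral_sph_pair[where F="\<lambda>a b. k a * (a ^ j * b ^ (2 * q - j))"]) (auto simp: inner_minus_right)
    also have "\<dots> = - M j" unfolding M_def using that by simp
    finally show ?thesis by simp
  qed
  define r where "r = (\<Sum>i\<le>q. smult (real ((2 * q) choose (2 * i)) * M (2 * i)) ([:0, 1:] ^ i * [:1, -1:] ^ (q - i)))"
  have "degree r \<le> q"
    unfolding r_def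
  proof (intro degree_sum_le)
    fix i assume "i \<in> {..q}"
    then have "degree ([:0, 1:] ^ i * [:1, -1:] ^ (q - i) :: real poly) \<le> i + (q - i)"
      by (intro degree_mult_le[THEN order_trans] add_mono degree_power_le[THEN order_trans]) auto
    then show "degree (smult (real ((2 * q) choose (2 * i)) * M (2 * i)) ([:0, 1:] ^ i * [:1, -1:] ^ (q - i))) \<le> q"
      using \<open>i \<in> {..q}\<close> by (intro degree_smult_le[THEN order_trans]) auto
  qed simp
  moreover have "(\<integral>y. k (x \<bullet> y) * (e \<bullet> y) ^ (2 * q) \<partial>(sph :: 'a measure)) = poly r ((x \<bullet> e)\<^sup>2)"
    if x: "norm x = 1" and e: "norm e = 1" for x e :: 'a
  proof -
    define t where "t = x \<bullet> e"
    have t: "t\<^sup>2 \<le> 1" using abs_inner_unit_le[OF x e] by (simp add: t_def abs_square_le_1)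
    define s where "s = sqrt (1 - t\<^sup>2)"
    have s: "s\<^sup>2 = 1 - t\<^sup>2" using t by (simp add: s_def)
    define e' where "e' = t *\<^sub>R pole + s *\<^sub>R equat"
    have "e' \<bullet> e' = t\<^sup>2 + s\<^sup>2" by (simp add: e'_def inner_add_left inner_add_right power2_eq_square)
    then have e': "norm e' = 1" by (simp add: norm_eq_1 s)
    have "(\<integral>y. k (x \<bullet> y) * (e \<bullet> y) ^ (2 * q) \<partial>(sph :: 'a measure))
        = (\<integral>y. k (?u y) * (e' \<bullet> y) ^ (2 * q) \<partial>(sph :: 'a measure))"
      by (rule integral_sph_pair[where F="\<lambda>a b. k a * b ^ (2 * q)"])
         (use x e e' in \<open>auto simp: e'_def t_def inner_add_right\<close>)
    also have "\<dots> = (\<integral>y. (\<Sum>j\<le>2*q. (real ((2*q) choose j) * t ^ j * s ^ (2*q - j)) *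
                     (k (?u y) * (?u y ^ j * ?v y ^ (2*q - j)))) \<partial>(sph :: 'a measure))"
    proof (rule Bochner_Integration.integral_cong[OF refl])
      fix y :: 'a
      have "e' \<bullet> y = t * ?u y + s * ?v y" by (simp add: e'_def inner_add_left)
      then show "k (?u y) * (e' \<bullet> y) ^ (2 * q) = (\<Sum>j\<le>2*q. (real ((2*q) choose j) * t ^ j * s ^ (2*q - j)) *
                     (k (?u y) * (?u y ^ j * ?v y ^ (2*q - j))))"
        by (simp add: binomial_ring sum_distrib_left power_mult_distrib mult_ac)
    qed
    also have "\<dots> = (\<Sum>j\<le>2*q. (real ((2*q) choose j) * t ^ j * s ^ (2*q - j)) * M j)"
      unfolding M_def by (subst Bochner_Integration.integral_sum) (use int in auto)
    also have "\<dots> = (\<Sum>j\<in>(*) 2 ` {..q}. (real ((2*q) choose j) * t ^ j * s ^ (2*q - j)) * M j)"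
    proof (rule sum.mono_neutral_right)
      show "\<forall>j\<in>{..2*q} - (*) 2 ` {..q}. (real ((2*q) choose j) * t ^ j * s ^ (2*q - j)) * M j = 0"
      proof
        fix j assume j: "j \<in> {..2*q} - (*) 2 ` {..q}"
        then have "odd j" by (auto elim!: evenE)
        then show "(real ((2*q) choose j) * t ^ j * s ^ (2*q - j)) * M j = 0" using odd j by auto
      qed
    qed auto
    also have "\<dots> = (\<Sum>i\<le>q. (real ((2*q) choose (2*i)) * t ^ (2*i) * s ^ (2*q - 2*i)) * M (2*i))"
      by (subst sum.reindex) (auto intro: inj_onI)
    also have "\<dots> = poly r (t\<^sup>2)"
      unfolding r_def poly_sum
    proof (intro sum.cong refl)
      fix i assume "i \<in> {..q}"
      then have "2 * q - 2 * i = 2 * (q - i)" by auto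
      then have "s ^ (2*q - 2*i) = (1 - t\<^sup>2) ^ (q - i)" by (simp only: power_mult s)
      then show "real ((2*q) choose (2*i)) * t ^ (2*i) * s ^ (2*q - 2*i) * M (2*i) =
        poly (smult (real (2 * q choose (2 * i)) * M (2 * i)) ([:0, 1:] ^ i * [:1, - 1:] ^ (q - i))) (t\<^sup>2)"
        unfolding even_pow by (simp add: poly_power mult_ac)
    qed
    finally show ?thesis by (simp add: t_def)
  qed
  ultimately show ?thesis by (intro exI[of _ r]) auto
qed

lemma funk_hecke_poly:
  assumes k: "zonal_kernel k"
  shows "\<exists>r. degree r \<le> degree p \<and> (\<forall>x e. norm x = 1 \<longrightarrow> norm e = 1 \<longrightarrow>
    (\<integral>y. k (x \<bullet> y) * poly p ((e \<bullet> y)\<^sup>2) \<partial>(sph :: 'a measure)) = poly r ((x \<bullet> e)\<^sup>2))"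
proof -
  from funk_hecke_monomial[OF k] obtain r where r: "\<And>q. degree (r q) \<le> q"
    "\<And>q x e. norm x = 1 \<Longrightarrow> norm e = 1 \<Longrightarrow>
     (\<integral>y. k (x \<bullet> y) * (e \<bullet> y) ^ (2 * q) \<partial>(sph :: 'a measure)) = poly (r q) ((x \<bullet> e)\<^sup>2)"
    by metis
  define R where "R = (\<Sum>q\<le>degree p. smult (coeff p q) (r q))"
  have "degree R \<le> degree p"
    unfolding R_def by (intro degree_sum_le degree_smult_le[THEN order_trans] r(1)[THEN order_trans]) auto
  moreover have "(\<integral>y. k (x \<bullet> y) * poly p ((e \<bullet> y)\<^sup>2) \<partial>(sph :: 'a measure)) = poly R ((x \<bullet> e)\<^sup>2)"
    if x: "norm x = 1" and e: "norm e = 1" for x e :: 'a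
  proof -
    have int: "integrable (sph :: 'a measure) (\<lambda>y. k (x \<bullet> y) * (e \<bullet> y) ^ (2 * q))" for q
      using zonal_kernel_mult_poly[OF k x e, of "monom 1 q"] by (simp add: poly_monom power_mult)
    have "(\<integral>y. k (x \<bullet> y) * poly p ((e \<bullet> y)\<^sup>2) \<partial>(sph :: 'a measure))
      = (\<integral>y. (\<Sum>q\<le>degree p. coeff p q * (k (x \<bullet> y) * (e \<bullet> y) ^ (2 * q))) \<partial>(sph :: 'a measure))"
      unfolding even_pow by (intro Bochner_Integration.integral_cong refl)
         (simp add: poly_altdef sum_distrib_left mult_ac)
    also have "\<dots> = (\<Sum>q\<le>degree p. coeff p q * poly (r q) ((x \<bullet> e)\<^sup>2))"
      by (subst Bochner_Integration.integral_sum) (simp_all add: int r(2)[OF x e])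
    also have "\<dots> = poly R ((x \<bullet> e)\<^sup>2)" by (simp add: R_def poly_sum)
    finally show ?thesis .
  qed
  ultimately show ?thesis by (intro exI[of _ R] conjI allI impI)
qed

end

section \<open>Zonal polynomials diagonalise every zonal kernel\<close>

context sphere_dim begin

text \<open>A polynomial \<open>p\<close> stands for the even zonal function \<open>poly p ((e \<bullet> y)\<^sup>2)\<close> of \<open>y\<close>. The bilinear form
  \<open>zonal_mean (p * q)\<close> is the inner product of two such functions in \<open>L\<^sup>2\<close> of the sphere.\<close>

definition zonal_mean :: "real poly \<Rightarrow> real" where
  "zonal_mean p = (\<integral>y. poly p ((pole \<bullet> y)\<^sup>2) \<partial>(sph :: 'a measure))"

lemma poly_sq_integrable: "norm x = 1 \<Longrightarrow> integrable (sph :: 'a measure) (\<lambda>y. poly p ((x \<bullet> y)\<^sup>2))"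
  using zonal_kernel_integrable[OF zonal_kernel_poly] by simp

lemma zonal_mean_eq: "norm x = 1 \<Longrightarrow> (\<integral>y. poly p ((x \<bullet> y)\<^sup>2) \<partial>(sph :: 'a measure)) = zonal_mean p"
  unfolding zonal_mean_def by (rule zonal_integral_eq[OF zonal_kernel_poly])

lemma zonal_mean_add: "zonal_mean (p + q) = zonal_mean p + zonal_mean q"
  unfolding zonal_mean_def by (simp add: poly_sq_integrable)

lemma zonal_mean_smult: "zonal_mean (smult c p) = c * zonal_mean p"
  unfolding zonal_mean_def by simp

lemma zonal_mean_diff: "zonal_mean (p - q) = zonal_mean p - zonal_mean q"
  unfolding zonal_mean_def by (simp add: poly_sq_integrable)

lemma zonal_mean_0[simp]: "zonal_mean 0 = 0" unfolding zonal_mean_def by simp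

lemma zonal_mean_sum: "finite A \<Longrightarrow> zonal_mean (\<Sum>i\<in>A. f i) = (\<Sum>i\<in>A. zonal_mean (f i))"
  by (induction A rule: finite_induct) (auto simp: zonal_mean_add)

lemma zonal_mean_1[simp]: "zonal_mean 1 = 1" unfolding zonal_mean_def by (simp add: sph.prob_space[unfolded space_sph])

text \<open>If the square had mean 0, \<open>p\<close> would vanish on almost all of a cap around the pole; but a cap
  small enough avoids the finitely many parallels on which \<open>p\<close> is zero.\<close>

lemma zonal_mean_square_pos:
  assumes "p \<noteq> 0" shows "0 < zonal_mean (p * p)"
proof -
  have nn: "0 \<le> zonal_mean (p * p)" unfolding zonal_mean_def by (intro integral_nonneg_AE) simp
  moreover have "zonal_mean (p * p) \<noteq> 0"
  proof
    assume "zonal_mean (p * p) = 0"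
    then have "AE y in (sph :: 'a measure). poly (p * p) ((pole \<bullet> y)\<^sup>2) = 0"
      unfolding zonal_mean_def using poly_sq_integrable[OF norm_pole, of "p * p"]
      by (subst (asm) integral_nonneg_eq_0_iff_AE) auto
    then have ae: "AE y in (sph :: 'a measure). poly p ((pole \<bullet> y)\<^sup>2) = 0 \<and> \<bar>pole \<bullet> y\<bar> < 1"
      using AE_sph_abs_inner_less_1[OF norm_pole dim] by eventually_elim simp
    obtain c where c: "c > 0" "\<forall>(e::'a) s. norm e = 1 \<longrightarrow> 0 < s \<longrightarrow> s \<le> sqrt 2 \<longrightarrow>
       ennreal (c * s ^ (DIM('a) - 1)) \<le> emeasure sph (cap e s)"
      using cap_lower[where 'a='a] by (elim exE conjE)
    define R where "R = {z. poly p z = 0}"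
    have "finite R" unfolding R_def by (rule poly_roots_finite) fact
    define m where "m = Max (insert 0 {z\<in>R. z < 1})"
    have fin: "finite (insert 0 {z\<in>R. z < 1})" using \<open>finite R\<close> by simp
    have "m \<in> insert 0 {z\<in>R. z < 1}" unfolding m_def by (rule Max_in) (use fin in auto)
    then have m1: "m < 1" by auto
    have m0: "0 \<le> m" unfolding m_def using fin by (rule Max_ge) simp
    have sm: "sqrt m < 1" using m1 by simp
    define s where "s = 1 - sqrt m"
    have s: "0 < s" "s \<le> 1" using m0 m1 by (auto simp: s_def)
    have "AE y in (sph :: 'a measure). y \<notin> cap pole s"
      using ae
    proof eventually_elim
      case (elim y)
      show ?case
      proof
        assume "y \<in> cap pole s"
        then have "sqrt (2 - 2 * \<bar>pole \<bullet> y\<bar>) < sqrt (s\<^sup>2)" using s by (simp add: cap_def chord_def)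
        then have "2 - 2 * \<bar>pole \<bullet> y\<bar> < s\<^sup>2" by (simp only: real_sqrt_less_iff)
        also have "s\<^sup>2 \<le> s" using s by (simp add: power2_eq_square mult_left_le)
        finally have "sqrt m < \<bar>pole \<bullet> y\<bar>" using sm unfolding s_def by linarith
        then have "(sqrt m)\<^sup>2 < \<bar>pole \<bullet> y\<bar>\<^sup>2" using m0 by (intro power_strict_mono) auto
        then have "m < (pole \<bullet> y)\<^sup>2" using m0 by simp
        moreover have "(pole \<bullet> y)\<^sup>2 \<in> {z\<in>R. z < 1}"
          using elim by (simp add: R_def abs_square_less_1)
        then have "(pole \<bullet> y)\<^sup>2 \<le> m" unfolding m_def by (intro Max_ge fin) simp
        ultimately show False by simp
      qed
    qed
    then have "emeasure sph (cap (pole::'a) s) = 0"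
      by (subst (asm) AE_iff_measurable[OF _ refl]) auto
    moreover have "s \<le> sqrt 2" using s by (simp add: real_le_rsqrt power2_eq_square mult_le_one order_trans[OF mult_le_one])
    then have "ennreal (c * s ^ (DIM('a) - 1)) \<le> emeasure sph (cap (pole::'a) s)"
      using c s by simp
    ultimately show False using c s by (simp add: not_le)
  qed
  ultimately show ?thesis by simp
qed

text \<open>A symmetric kernel induces a symmetric operator: this is Fubini for
  \<open>k (x \<bullet> y) * p ((pole \<bullet> y)\<^sup>2) * q ((pole \<bullet> x)\<^sup>2)\<close>.\<close>

lemma zonal_mean_commuting:
  assumes k: "zonal_kernel k"
    and p: "\<And>x e::'a. norm x = 1 \<Longrightarrow> norm e = 1 \<Longrightarrow> (\<integral>y. k (x \<bullet> y) * poly p ((e \<bullet> y)\<^sup>2) \<partial>sph) = poly p' ((x \<bullet> e)\<^sup>2)"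
    and q: "\<And>x e::'a. norm x = 1 \<Longrightarrow> norm e = 1 \<Longrightarrow> (\<integral>y. k (x \<bullet> y) * poly q ((e \<bullet> y)\<^sup>2) \<partial>sph) = poly q' ((x \<bullet> e)\<^sup>2)"
  shows "zonal_mean (p' * q) = zonal_mean (p * q')"
proof -
  note [measurable] = zonal_kernel_measurable[OF k]
  let ?f = "\<lambda>x y::'a. k (x \<bullet> y) * (poly p ((pole \<bullet> y)\<^sup>2) * poly q ((pole \<bullet> x)\<^sup>2))"
  obtain B where B: "\<forall>t. \<bar>t\<bar> \<le> 1 \<longrightarrow> \<bar>poly p (t\<^sup>2)\<bar> \<le> B" using poly_sq_bound[of p] by auto
  obtain B' where B': "\<forall>t. \<bar>t\<bar> \<le> 1 \<longrightarrow> \<bar>poly q (t\<^sup>2)\<bar> \<le> B'" using poly_sq_bound[of q] by auto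
  have "integrable (sph \<Otimes>\<^sub>M sph) (\<lambda>z. k (fst z \<bullet> snd z) * (poly p ((pole \<bullet> snd z)\<^sup>2) * poly q ((pole \<bullet> fst (z::'a \<times> 'a))\<^sup>2)))"
  proof (rule zonal_kernel_integrable2[OF k, where B="B * B'"])
    fix x y :: 'a assume "norm x = 1" "norm y = 1"
    then have "\<bar>pole \<bullet> y\<bar> \<le> 1" "\<bar>pole \<bullet> x\<bar> \<le> 1" by (auto intro: abs_inner_unit_le)
    then show "\<bar>poly p ((pole \<bullet> snd (x, y))\<^sup>2) * poly q ((pole \<bullet> fst (x, y))\<^sup>2)\<bar> \<le> B * B'"
      using B B' by (auto simp: abs_mult intro!: mult_mono' intro: order_trans[OF abs_ge_zero])
  qed measurable
  then have int: "integrable (sph \<Otimes>\<^sub>M sph) (case_prod ?f)" by (simp add: case_prod_beta')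
  have "(\<integral>x. (\<integral>y. ?f x y \<partial>sph) \<partial>sph) = (\<integral>x. poly (p' * q) ((pole \<bullet> x)\<^sup>2) \<partial>sph)"
  proof (rule integral_cong_AE)
    show "AE x in sph. (\<integral>y. ?f x y \<partial>sph) = poly (p' * q) ((pole \<bullet> x)\<^sup>2)"
      using AE_sph_norm
    proof eventually_elim
      case (elim x)
      have "(\<integral>y. ?f x y \<partial>sph) = (\<integral>y. k (x \<bullet> y) * poly p ((pole \<bullet> y)\<^sup>2) * poly q ((pole \<bullet> x)\<^sup>2) \<partial>sph)"
        by (simp only: mult.assoc)
      also have "\<dots> = poly p' ((x \<bullet> pole)\<^sup>2) * poly q ((pole \<bullet> x)\<^sup>2)"
        using p[OF elim norm_pole] by simp
      finally show ?case by (simp add: inner_commute)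
    qed
  qed measurable
  moreover have "(\<integral>y. (\<integral>x. ?f x y \<partial>sph) \<partial>sph) = (\<integral>y. poly (p * q') ((pole \<bullet> y)\<^sup>2) \<partial>sph)"
  proof (rule integral_cong_AE)
    show "AE y in sph. (\<integral>x. ?f x y \<partial>sph) = poly (p * q') ((pole \<bullet> y)\<^sup>2)"
      using AE_sph_norm
    proof eventually_elim
      case (elim y)
      have "(\<integral>x. ?f x y \<partial>sph) = (\<integral>x. poly p ((pole \<bullet> y)\<^sup>2) * (k (y \<bullet> x) * poly q ((pole \<bullet> x)\<^sup>2)) \<partial>sph)"
        by (intro Bochner_Integration.integral_cong refl) (simp add: inner_commute)
      also have "\<dots> = poly p ((pole \<bullet> y)\<^sup>2) * poly q' ((y \<bullet> pole)\<^sup>2)"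
        using q[OF elim norm_pole] by simp
      finally show ?case by (simp add: inner_commute)
    qed
  qed measurable
  ultimately show ?thesis
    using sph2.Fubini_integral[OF int] by (simp add: zonal_mean_def)
qed

text \<open>In the variable \<open>t\<^sup>2\<close> these are the Gegenbauer polynomials of even degree, up to a factor.\<close>

definition orth :: "nat \<Rightarrow> real poly \<Rightarrow> bool" where
  "orth n p \<longleftrightarrow> degree p \<le> n \<and> coeff p n \<noteq> 0 \<and> (\<forall>q. (\<forall>i\<ge>n. coeff q i = 0) \<longrightarrow> zonal_mean (p * q) = 0)"

lemma orth_nonzero: "orth n p \<Longrightarrow> p \<noteq> 0" by (auto simp: orth_def)

lemma orth_span:
  assumes "\<And>i. i < n \<Longrightarrow> orth i (P i)" "\<forall>i\<ge>n. coeff q i = 0"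
  shows "\<exists>c. q = (\<Sum>i<n. smult (c i) (P i))"
  using assms
proof (induction n arbitrary: q)
  case 0
  then show ?case by (simp add: poly_eq_iff)
next
  case (Suc n)
  let ?a = "coeff q n / coeff (P n) n"
  have o: "orth n (P n)" using Suc.prems(1) by simp
  let ?q = "q - smult ?a (P n)"
  have cq: "\<forall>i\<ge>n. coeff ?q i = 0"
  proof (intro allI impI)
    fix i assume "n \<le> i"
    show "coeff ?q i = 0"
    proof (cases "i = n")
      case True then show ?thesis using o by (simp add: orth_def)
    next
      case False
      then have "coeff (P n) i = 0" using o \<open>n \<le> i\<close> by (intro coeff_eq_0) (auto simp: orth_def)
      then show ?thesis using Suc.prems(2) False \<open>n \<le> i\<close> by simp
    qed
  qed
  have "\<exists>c. ?q = (\<Sum>i<n. smult (c i) (P i))"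
  proof (rule Suc.IH)
    show "orth i (P i)" if "i < n" for i using Suc.prems(1)[of i] that by simp
  qed (rule cq)
  then obtain c where c: "?q = (\<Sum>i<n. smult (c i) (P i))" by (elim exE)
  have "q = ?q + smult ?a (P n)" by simp
  also have "\<dots> = (\<Sum>i<Suc n. smult ((c(n := ?a)) i) (P i))" unfolding c by simp
  finally show ?case by (intro exI[of _ "c(n := ?a)"])
qed

lemma orth_zonal_mean_eq_0:
  assumes "orth n p" "orth m q" "n \<noteq> m" shows "zonal_mean (p * q) = 0"
proof (cases "m < n")
  case True
  then have "\<forall>i\<ge>n. coeff q i = 0" using assms(2) by (auto simp: orth_def intro!: coeff_eq_0)
  then show ?thesis using assms(1) by (simp add: orth_def)
next
  case False
  then have "\<forall>i\<ge>m. coeff p i = 0" using assms(1,3) by (auto simp: orth_def intro!: coeff_eq_0)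
  then show ?thesis using assms(2) by (simp add: orth_def mult.commute)
qed

lemma orth_exists: "\<exists>p. orth n p"
proof (induction n rule: less_induct)
  case (less n)
  then obtain P where P: "\<And>i. i < n \<Longrightarrow> orth i (P i)" by metis
  define r where "r = (\<Sum>i<n. smult (zonal_mean (monom 1 n * P i) / zonal_mean (P i * P i)) (P i))"
  define p where "p = monom 1 n - r"
  have r: "coeff r i = 0" if "n \<le> i" for i
    unfolding r_def coeff_sum
  proof (intro sum.neutral ballI)
    fix j assume "j \<in> {..<n}"
    then have "degree (P j) < i" using P[of j] that by (simp add: orth_def)
    then show "coeff (smult (zonal_mean (monom 1 n * P j) / zonal_mean (P j * P j)) (P j)) i = 0"
      by (simp add: coeff_eq_0)
  qed
  have orthP: "zonal_mean (p * P j) = 0" if j: "j < n" for j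
  proof -
    have "zonal_mean (r * P j) = (\<Sum>i<n. zonal_mean (monom 1 n * P i) / zonal_mean (P i * P i) * zonal_mean (P i * P j))"
      by (simp add: r_def sum_distrib_right zonal_mean_sum zonal_mean_smult)
    also have "\<dots> = (\<Sum>i\<in>{j}. zonal_mean (monom 1 n * P i) / zonal_mean (P i * P i) * zonal_mean (P i * P j))"
      using j by (intro sum.mono_neutral_right) (auto simp: orth_zonal_mean_eq_0[OF P P])
    also have "\<dots> = zonal_mean (monom 1 n * P j)"
      using zonal_mean_square_pos[OF orth_nonzero[OF P[OF j]]] by simp
    finally show ?thesis by (simp add: p_def left_diff_distrib zonal_mean_diff)
  qed
  have "orth n p"
    unfolding orth_def
  proof (intro conjI allI impI)
    show "degree p \<le> n" by (rule degree_le) (simp add: p_def r)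
    show "coeff p n \<noteq> 0" by (simp add: p_def r)
    fix q :: "real poly" assume cq: "\<forall>i\<ge>n. coeff q i = 0"
    obtain c where "q = (\<Sum>i<n. smult (c i) (P i))" using orth_span[of n P q, OF P cq, simplified] by (elim exE)
    then show "zonal_mean (p * q) = 0" by (simp add: sum_distrib_left zonal_mean_sum zonal_mean_smult orthP)
  qed
  then show ?case ..
qed

text \<open>The operator of \<open>k\<close> maps polynomials of degree at most \<open>i\<close> to such polynomials and is symmetric.
  Hence the image of \<open>p\<close> is orthogonal to all lower degrees, which leaves only multiples of \<open>p\<close>.\<close>

lemma orth_eigen:
  assumes k: "zonal_kernel k" and p: "orth n p"
  shows "\<exists>a. \<forall>x e. norm x = 1 \<longrightarrow> norm e = 1 \<longrightarrow>
     (\<integral>y. k (x \<bullet> y) * poly p ((e \<bullet> y)\<^sup>2) \<partial>(sph :: 'a measure)) = a * poly p ((x \<bullet> e)\<^sup>2)"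
proof -
  obtain P0 where P0: "\<And>i. orth i (P0 i)" using orth_exists by metis
  define P where "P = P0(n := p)"
  have P: "orth i (P i)" for i using P0 p by (simp add: P_def)
  from funk_hecke_poly[OF k] obtain A where A: "\<And>p. degree (A p) \<le> degree p"
    "\<And>p x e. norm x = 1 \<Longrightarrow> norm e = 1 \<Longrightarrow>
    (\<integral>y. k (x \<bullet> y) * poly p ((e \<bullet> y)\<^sup>2) \<partial>(sph :: 'a measure)) = poly (A p) ((x \<bullet> e)\<^sup>2)" by metis
  have "degree (A p) \<le> n" using A(1)[of p] p by (simp add: orth_def)
  then have cq: "\<forall>i\<ge>Suc n. coeff (A p) i = 0" by (auto intro!: coeff_eq_0)
  obtain c where c: "A p = (\<Sum>i<Suc n. smult (c i) (P i))"
    using orth_span[of "Suc n" P "A p", OF P cq] by (elim exE)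
  have "c j = 0" if j: "j < n" for j
  proof -
    have "zonal_mean (A p * P j) = zonal_mean (p * A (P j))"
      by (rule zonal_mean_commuting[OF k]) (use A in auto)
    also have "\<dots> = 0"
    proof -
      have "degree (A (P j)) \<le> j" using A(1)[of "P j"] P[of j] by (simp add: orth_def)
      then have "\<forall>i\<ge>n. coeff (A (P j)) i = 0" using j by (auto intro!: coeff_eq_0)
      then show ?thesis using p by (simp add: orth_def)
    qed
    finally have "0 = (\<Sum>i<Suc n. c i * zonal_mean (P i * P j))"
      by (simp only: c sum_distrib_right mult_smult_left zonal_mean_sum[OF finite_lessThan] zonal_mean_smult)
    also have "\<dots> = (\<Sum>i\<in>{j}. c i * zonal_mean (P i * P j))"
      using j by (intro sum.mono_neutral_right) (auto simp: orth_zonal_mean_eq_0[OF P P])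
    finally show ?thesis using zonal_mean_square_pos[OF orth_nonzero[OF P[of j]]] by simp
  qed
  then have "A p = smult (c n) p" unfolding c by (simp add: P_def)
  then show ?thesis using A(2)[of _ _ p] by (intro exI[of _ "c n"]) simp
qed

text \<open>Normalised such that the kernel \<open>poly (zonal_poly n) ((x \<bullet> y)\<^sup>2)\<close> is idempotent under convolution,
  that is, the reproducing kernel of the spherical harmonics of degree \<open>2 * n\<close>.\<close>

definition zonal_poly :: "nat \<Rightarrow> real poly" where
  "zonal_poly n = (SOME p. orth n p \<and> (\<forall>x e. norm x = 1 \<longrightarrow> norm e = 1 \<longrightarrow>
     (\<integral>y. poly p ((x \<bullet> y)\<^sup>2) * poly p ((e \<bullet> y)\<^sup>2) \<partial>(sph :: 'a measure)) = poly p ((x \<bullet> e)\<^sup>2)))"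

lemma zonal_poly: "orth n (zonal_poly n)"
  "norm x = 1 \<Longrightarrow> norm e = 1 \<Longrightarrow>
    (\<integral>y. poly (zonal_poly n) ((x \<bullet> y)\<^sup>2) * poly (zonal_poly n) ((e \<bullet> y)\<^sup>2) \<partial>(sph :: 'a measure)) = poly (zonal_poly n) ((x \<bullet> e)\<^sup>2)"
proof -
  obtain p where p: "orth n p" using orth_exists by auto
  obtain a where a: "\<And>x e. norm x = 1 \<Longrightarrow> norm e = 1 \<Longrightarrow>
    (\<integral>y. poly p ((x \<bullet> y)\<^sup>2) * poly p ((e \<bullet> y)\<^sup>2) \<partial>(sph :: 'a measure)) = a * poly p ((x \<bullet> e)\<^sup>2)"
    using orth_eigen[OF zonal_kernel_poly p, of p] by auto
  have "zonal_mean (p * p) = a * poly p 1" using a[OF norm_pole norm_pole] by (simp add: zonal_mean_def)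
  then have a0: "a \<noteq> 0" using zonal_mean_square_pos[OF orth_nonzero[OF p]] by auto
  have "orth n (smult (1 / a) p)" using p a0 by (simp add: orth_def zonal_mean_smult)
  moreover have "(\<integral>y. poly (smult (1/a) p) ((x \<bullet> y)\<^sup>2) * poly (smult (1/a) p) ((e \<bullet> y)\<^sup>2) \<partial>(sph :: 'a measure))
     = poly (smult (1/a) p) ((x \<bullet> e)\<^sup>2)" if "norm x = 1" "norm e = 1" for x e :: 'a
  proof -
    have "(\<integral>y. poly (smult (1/a) p) ((x \<bullet> y)\<^sup>2) * poly (smult (1/a) p) ((e \<bullet> y)\<^sup>2) \<partial>(sph :: 'a measure))
     = (\<integral>y. (1/a * (1/a)) * (poly p ((x \<bullet> y)\<^sup>2) * poly p ((e \<bullet> y)\<^sup>2)) \<partial>(sph :: 'a measure))"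
      by (intro Bochner_Integration.integral_cong refl) simp
    also have "\<dots> = (1/a * (1/a)) * (a * poly p ((x \<bullet> e)\<^sup>2))"
      using a[OF that] by simp
    finally show ?thesis using a0 by simp
  qed
  ultimately have "\<exists>p. orth n p \<and> (\<forall>x e. norm x = 1 \<longrightarrow> norm e = 1 \<longrightarrow>
     (\<integral>y. poly p ((x \<bullet> y)\<^sup>2) * poly p ((e \<bullet> y)\<^sup>2) \<partial>(sph :: 'a measure)) = poly p ((x \<bullet> e)\<^sup>2))"
    by (intro exI[of _ "smult (1 / a) p"]) simp
  from someI_ex[OF this, folded zonal_poly_def] show "orth n (zonal_poly n)"
  "norm x = 1 \<Longrightarrow> norm e = 1 \<Longrightarrow>
    (\<integral>y. poly (zonal_poly n) ((x \<bullet> y)\<^sup>2) * poly (zonal_poly n) ((e \<bullet> y)\<^sup>2) \<partial>(sph :: 'a measure)) = poly (zonal_poly n) ((x \<bullet> e)\<^sup>2)"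
    by auto
qed

lemma zonal_poly_1: "poly (zonal_poly n) 1 = zonal_mean (zonal_poly n * zonal_poly n)" "0 < poly (zonal_poly n) 1"
proof -
  show "poly (zonal_poly n) 1 = zonal_mean (zonal_poly n * zonal_poly n)"
    using zonal_poly(2)[OF norm_pole norm_pole, of n] by (simp add: zonal_mean_def)
  then show "0 < poly (zonal_poly n) 1" using zonal_mean_square_pos[OF orth_nonzero[OF zonal_poly(1)]] by simp
qed

lemma zonal_mean_zonal_poly: "n \<ge> 1 \<Longrightarrow> zonal_mean (zonal_poly n) = 0"
proof -
  assume "n \<ge> 1"
  then have "\<forall>i\<ge>n. coeff (1 :: real poly) i = 0" by (simp add: coeff_eq_0)
  then have "zonal_mean (zonal_poly n * 1) = 0" using zonal_poly(1)[of n] by (simp only: orth_def)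
  then show ?thesis by simp
qed

lemma zonal_poly_0: "zonal_poly 0 = 1"
proof -
  have "degree (zonal_poly 0) \<le> 0" using zonal_poly(1)[of 0] by (simp add: orth_def)
  then obtain c where c: "zonal_poly 0 = [:c:]" by (metis degree_eq_zeroE le_zero_eq)
  have "c = c * c" using zonal_poly_1(1)[of 0] c zonal_mean_smult[of "c * c" 1] by simp
  moreover have "c \<noteq> 0" using zonal_poly_1(2)[of 0] c by simp
  ultimately show ?thesis using c by (simp add: one_pCons)
qed

text \<open>The Cauchy-Schwarz inequality for the reproducing kernel. In particular, a zonal polynomial takes its
  maximum on the sphere at its pole.\<close>

lemma zonal_poly_abs_le:
  assumes "\<bar>t\<bar> \<le> 1" shows "\<bar>poly (zonal_poly n) (t\<^sup>2)\<bar> \<le> poly (zonal_poly n) 1"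
proof -
  define e :: 'a where "e = t *\<^sub>R pole + sqrt (1 - t\<^sup>2) *\<^sub>R equat"
  have "e \<bullet> e = t\<^sup>2 + (sqrt (1 - t\<^sup>2))\<^sup>2"
    by (simp add: e_def inner_add_left inner_add_right power2_eq_square)
  then have e: "norm e = 1" using assms by (simp add: norm_eq_1 abs_square_le_1)
  have pe: "pole \<bullet> e = t" by (simp add: e_def inner_add_right)
  let ?f = "\<lambda>x y::'a. poly (zonal_poly n) ((x \<bullet> y)\<^sup>2)"
  have int: "integrable (sph :: 'a measure) (\<lambda>y. ?f x y * ?f e' y)" if "norm x = 1" "norm e' = 1" for x e'
    using zonal_kernel_mult_poly[OF zonal_kernel_poly that] by simp
  have "\<bar>poly (zonal_poly n) (t\<^sup>2)\<bar> = \<bar>\<integral>y. ?f pole y * ?f e y \<partial>sph\<bar>" using zonal_poly(2)[OF norm_pole e] pe by simp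
  also have "\<dots> \<le> (\<integral>y. \<bar>?f pole y * ?f e y\<bar> \<partial>sph)" by (rule integral_abs_bound)
  also have "\<dots> \<le> (\<integral>y. (?f pole y * ?f pole y + ?f e y * ?f e y) / 2 \<partial>sph)"
  proof (rule integral_mono)
    fix y
    have "0 \<le> (\<bar>?f pole y\<bar> - \<bar>?f e y\<bar>)\<^sup>2" by simp
    then show "\<bar>?f pole y * ?f e y\<bar> \<le> (?f pole y * ?f pole y + ?f e y * ?f e y) / 2"
      by (simp only: power2_diff abs_mult power2_abs) (simp add: power2_eq_square)
  qed (use int norm_pole e in auto)
  also have "\<dots> = (poly (zonal_poly n) 1 + poly (zonal_poly n) 1) / 2"
    using zonal_poly(2)[OF norm_pole norm_pole, of n] zonal_poly(2)[OF e e, of n] int[OF norm_pole norm_pole] int[OF e e] e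
    by (simp add: norm_eq_1)
  finally show ?thesis by simp
qed

definition eigenvalue :: "(real \<Rightarrow> real) \<Rightarrow> nat \<Rightarrow> real" where
  "eigenvalue k n = (\<integral>y. k (pole \<bullet> y) * poly (zonal_poly n) ((pole \<bullet> y)\<^sup>2) \<partial>(sph :: 'a measure)) / poly (zonal_poly n) 1"

lemma eigenvalue_eigen:
  assumes k: "zonal_kernel k" and "norm x = 1" "norm e = 1"
  shows "(\<integral>y. k (x \<bullet> y) * poly (zonal_poly n) ((e \<bullet> y)\<^sup>2) \<partial>(sph :: 'a measure)) = eigenvalue k n * poly (zonal_poly n) ((x \<bullet> e)\<^sup>2)"
proof -
  obtain a where a: "\<forall>x e. norm x = 1 \<longrightarrow> norm e = 1 \<longrightarrow>
    (\<integral>y. k (x \<bullet> y) * poly (zonal_poly n) ((e \<bullet> y)\<^sup>2) \<partial>(sph :: 'a measure)) = a * poly (zonal_poly n) ((x \<bullet> e)\<^sup>2)"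
    using orth_eigen[OF k zonal_poly(1)[of n]] by (elim exE)
  have "eigenvalue k n = a" using a[rule_format, OF norm_pole norm_pole] zonal_poly_1(2)[of n] by (simp add: eigenvalue_def)
  then show ?thesis using a assms by simp
qed

lemma eigenvalue_0: "eigenvalue k 0 = (\<integral>y. k (pole \<bullet> y) \<partial>(sph :: 'a measure))"
  by (simp add: eigenvalue_def zonal_poly_0)

lemma zonal_poly_expansion:
  assumes "degree q \<le> m"
  shows "q = (\<Sum>n\<le>m. smult (eigenvalue (\<lambda>t. poly q (t\<^sup>2)) n) (zonal_poly n))"
proof -
  have cq: "\<forall>i\<ge>Suc m. coeff q i = 0" using assms by (auto intro!: coeff_eq_0)
  obtain c where c: "q = (\<Sum>n<Suc m. smult (c n) (zonal_poly n))" using orth_span[of "Suc m" zonal_poly q, OF zonal_poly(1) cq] by (elim exE)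
  have "eigenvalue (\<lambda>t. poly q (t\<^sup>2)) j = c j" if j: "j \<le> m" for j
  proof -
    have "eigenvalue (\<lambda>t. poly q (t\<^sup>2)) j * poly (zonal_poly j) 1 = zonal_mean (q * zonal_poly j)"
      using zonal_poly_1(2)[of j] by (simp add: eigenvalue_def zonal_mean_def)
    also have "\<dots> = (\<Sum>i<Suc m. c i * zonal_mean (zonal_poly i * zonal_poly j))"
      by (simp only: c sum_distrib_right mult_smult_left zonal_mean_sum[OF finite_lessThan] zonal_mean_smult)
    also have "\<dots> = (\<Sum>i\<in>{j}. c i * zonal_mean (zonal_poly i * zonal_poly j))"
      using j by (intro sum.mono_neutral_right) (auto simp: orth_zonal_mean_eq_0[OF zonal_poly(1) zonal_poly(1)])
    also have "\<dots> = c j * poly (zonal_poly j) 1" by (simp add: zonal_poly_1(1))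
    finally show ?thesis using zonal_poly_1(2)[of j] by simp
  qed
  then have "(\<Sum>n<Suc m. smult (c n) (zonal_poly n)) = (\<Sum>n\<le>m. smult (eigenvalue (\<lambda>t. poly q (t\<^sup>2)) n) (zonal_poly n))"
    unfolding lessThan_Suc_atMost by (intro sum.cong refl) simp
  with c show ?thesis by (rule trans)
qed

end

section \<open>Positivity of the eigenvalues of a subharmonic kernel\<close>

lemma taylor2_lower:
  fixes h h' :: "real \<Rightarrow> real"
  assumes d1: "\<And>x. a < x \<Longrightarrow> x < b \<Longrightarrow> (h has_real_derivative h' x) (at x)"
    and t: "a < t" "t < b" and d2: "(h' has_real_derivative D) (at t)" and "\<kappa> < D"
  shows "\<exists>\<delta>>0. \<forall>x. \<bar>x - t\<bar> < \<delta> \<longrightarrow> h t + h' t * (x - t) + \<kappa> / 2 * (x - t)\<^sup>2 \<le> h x"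
proof -
  have "((\<lambda>x. (h' x - h' t) / (x - t)) \<longlongrightarrow> D) (at t)"
    using d2 by (simp add: has_field_derivative_iff)
  then have "\<forall>\<^sub>F x in at t. \<kappa> < (h' x - h' t) / (x - t)"
    by (rule order_tendstoD) fact
  then obtain e where e: "e > 0" "\<And>x. x \<noteq> t \<Longrightarrow> dist x t < e \<Longrightarrow> \<kappa> < (h' x - h' t) / (x - t)"
    by (auto simp: eventually_at)
  define \<delta> where "\<delta> = min e (min (t - a) (b - t))"
  define g where "g x = h x - h' t * (x - t) - \<kappa> / 2 * (x - t)\<^sup>2" for x
  have g: "(g has_real_derivative (h' x - h' t - \<kappa> * (x - t))) (at x)" if "a < x" "x < b" for x
    unfolding g_def by (rule derivative_eq_intros d1 that refl | simp add: that)+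
  have "h t + h' t * (x - t) + \<kappa> / 2 * (x - t)\<^sup>2 \<le> h x" if x: "\<bar>x - t\<bar> < \<delta>" for x
  proof -
    have "g t \<le> g x"
    proof (cases "t \<le> x")
      case True
      show ?thesis
      proof (rule DERIV_nonneg_imp_nondecreasing[OF True])
        fix y assume y: "t \<le> y" "y \<le> x"
        have "\<kappa> * (y - t) \<le> h' y - h' t"
        proof (cases "y = t")
          case False
          then have "\<kappa> < (h' y - h' t) / (y - t)" using e(2)[of y] y x by (simp add: dist_real_def \<delta>_def)
          then show ?thesis using y False by (simp add: field_simps)
        qed simp
        moreover have "a < y" "y < b" using y x t by (auto simp: \<delta>_def)
        ultimately show "\<exists>z. (g has_real_derivative z) (at y) \<and> 0 \<le> z" using g[of y] by (intro exI conjI) auto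
      qed
    next
      case False
      then have "x \<le> t" by simp
      then show ?thesis
      proof (rule DERIV_nonpos_imp_nonincreasing)
        fix y assume y: "x \<le> y" "y \<le> t"
        have "h' y - h' t \<le> \<kappa> * (y - t)"
        proof (cases "y = t")
          case False
          then have "\<kappa> < (h' y - h' t) / (y - t)" using e(2)[of y] y x by (simp add: dist_real_def \<delta>_def)
          then show ?thesis using y False by (simp add: field_simps)
        qed simp
        moreover have "a < y" "y < b" using y x t by (auto simp: \<delta>_def)
        ultimately show "\<exists>z. (g has_real_derivative z) (at y) \<and> z \<le> 0" using g[of y] by (intro exI conjI) auto
      qed
    qed
    then show ?thesis by (simp add: g_def)
  qed
  moreover have "\<delta> > 0" using e t by (simp add: \<delta>_def)
  ultimately show ?thesis by (intro exI[of _ \<delta>]) simp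
qed

text \<open>Up to a factor, the sum is the mean of \<open>h\<close> over points at distance \<open>\<epsilon>\<close> minus its value at the centre: the \<open>i\<close>-th
  summand is the second difference along the geodesic in direction \<open>i\<close>, and the quantity assumed
  positive is the Laplace-Beltrami operator applied to a function that depends on the height \<open>t\<close>
  only, with the dimension of the sphere as the number of directions.\<close>

lemma second_difference_lower:
  fixes h h' :: "real \<Rightarrow> real" and v :: "'i \<Rightarrow> real"
  assumes d1: "\<And>x. 0 < x \<Longrightarrow> x < 1 \<Longrightarrow> (h has_real_derivative h' x) (at x)"
    and t: "0 < t" "t < 1" and d2: "(h' has_real_derivative D) (at t)"
    and B: "finite B" "(\<Sum>i\<in>B. (v i)\<^sup>2) = 1 - t\<^sup>2"
    and pos: "0 < (1 - t\<^sup>2) * D - real (card B) * t * h' t"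
  shows "\<exists>r>0. \<forall>\<^sub>F \<epsilon> in at_right 0.
     r * \<epsilon>\<^sup>2 \<le> (\<Sum>i\<in>B. h \<bar>cos \<epsilon> * t + sin \<epsilon> * v i\<bar> + h \<bar>cos \<epsilon> * t - sin \<epsilon> * v i\<bar> - 2 * h t)"
proof -
  define \<Delta> where "\<Delta> = (1 - t\<^sup>2) * D - real (card B) * t * h' t"
  have t2: "0 < 1 - t\<^sup>2" using t by (simp add: power_less_one_iff abs_square_less_1)
  define \<kappa> where "\<kappa> = D - \<Delta> / (2 * (1 - t\<^sup>2))"
  have \<Delta>: "\<Delta> > 0" using pos by (simp add: \<Delta>_def)
  have "\<kappa> < D" using \<Delta> t2 by (simp add: \<kappa>_def)
  have "\<exists>\<delta>>0. \<forall>x. \<bar>x - t\<bar> < \<delta> \<longrightarrow> h t + h' t * (x - t) + \<kappa> / 2 * (x - t)\<^sup>2 \<le> h x"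
    by (rule taylor2_lower[where a=0 and b=1, OF _ t d2 \<open>\<kappa> < D\<close>]) (rule d1; assumption)
  then obtain \<delta> where \<delta>: "\<delta> > 0" "\<forall>x. \<bar>x - t\<bar> < \<delta> \<longrightarrow> h t + h' t * (x - t) + \<kappa> / 2 * (x - t)\<^sup>2 \<le> h x"
    by (elim exE conjE)
  define Q where "Q \<epsilon> = - 2 * real (card B) * t * h' t * (1 - cos \<epsilon>) + \<kappa> * real (card B) * t\<^sup>2 * (1 - cos \<epsilon>)\<^sup>2
     + \<kappa> * (1 - t\<^sup>2) * (sin \<epsilon>)\<^sup>2" for \<epsilon> :: real
  have l1: "((\<lambda>\<epsilon>. (1 - cos \<epsilon>) / \<epsilon>\<^sup>2) \<longlongrightarrow> (1/2 :: real)) (at_right 0)" by real_asymp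
  have l2: "((\<lambda>\<epsilon>. (1 - cos \<epsilon>)\<^sup>2 / \<epsilon>\<^sup>2) \<longlongrightarrow> (0 :: real)) (at_right 0)" by real_asymp
  have l3: "((\<lambda>\<epsilon>. (sin \<epsilon>)\<^sup>2 / \<epsilon>\<^sup>2) \<longlongrightarrow> (1 :: real)) (at_right 0)" by real_asymp
  have "((\<lambda>\<epsilon>. - 2 * real (card B) * t * h' t * ((1 - cos \<epsilon>) / \<epsilon>\<^sup>2) + \<kappa> * real (card B) * t\<^sup>2 * ((1 - cos \<epsilon>)\<^sup>2 / \<epsilon>\<^sup>2)
     + \<kappa> * (1 - t\<^sup>2) * ((sin \<epsilon>)\<^sup>2 / \<epsilon>\<^sup>2)) \<longlongrightarrow>
      - 2 * real (card B) * t * h' t * (1/2) + \<kappa> * real (card B) * t\<^sup>2 * 0 + \<kappa> * (1 - t\<^sup>2) * 1) (at_right 0)"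
    by (intro tendsto_add tendsto_mult tendsto_const l1 l2 l3)
  moreover have "- 2 * real (card B) * t * h' t * (1/2) + \<kappa> * real (card B) * t\<^sup>2 * 0 + \<kappa> * (1 - t\<^sup>2) * 1 = \<Delta> / 2"
    using t2 by (simp add: \<kappa>_def \<Delta>_def left_diff_distrib) (simp add: field_simps)
  moreover have "(\<lambda>\<epsilon>. - 2 * real (card B) * t * h' t * ((1 - cos \<epsilon>) / \<epsilon>\<^sup>2) + \<kappa> * real (card B) * t\<^sup>2 * ((1 - cos \<epsilon>)\<^sup>2 / \<epsilon>\<^sup>2)
     + \<kappa> * (1 - t\<^sup>2) * ((sin \<epsilon>)\<^sup>2 / \<epsilon>\<^sup>2)) = (\<lambda>\<epsilon>. Q \<epsilon> / \<epsilon>\<^sup>2)"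
    by (rule ext) (simp only: Q_def add_divide_distrib times_divide_eq_right)
  ultimately have lim: "((\<lambda>\<epsilon>. Q \<epsilon> / \<epsilon>\<^sup>2) \<longlongrightarrow> \<Delta> / 2) (at_right 0)" by (simp only:)
  have ev1: "\<forall>\<^sub>F \<epsilon> in at_right 0. \<Delta> / 4 < Q \<epsilon> / \<epsilon>\<^sup>2"
    by (rule order_tendstoD[OF lim]) (use \<Delta> in simp)
  have lim2: "((\<lambda>\<epsilon>. cos \<epsilon> * t + c * sin \<epsilon> * v i) \<longlongrightarrow> cos 0 * t + c * sin 0 * v i) (at_right 0)" for i c
    by (intro tendsto_intros)
  have ev2: "\<forall>\<^sub>F \<epsilon> in at_right 0. \<forall>i\<in>B. \<bar>(cos \<epsilon> * t + c * sin \<epsilon> * v i) - t\<bar> < min \<delta> t" for c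
  proof (rule eventually_ball_finite[OF B(1)], rule ballI)
    fix i
    from tendstoD[OF lim2[of c i], of "min \<delta> t"] \<delta> t
    show "\<forall>\<^sub>F \<epsilon> in at_right 0. \<bar>(cos \<epsilon> * t + c * sin \<epsilon> * v i) - t\<bar> < min \<delta> t"
      by (simp add: dist_real_def)
  qed
  have "\<forall>\<^sub>F \<epsilon> in at_right 0. \<Delta> / 4 * \<epsilon>\<^sup>2 \<le>
     (\<Sum>i\<in>B. h \<bar>cos \<epsilon> * t + sin \<epsilon> * v i\<bar> + h \<bar>cos \<epsilon> * t - sin \<epsilon> * v i\<bar> - 2 * h t)"
    using ev1 ev2[of 1] ev2[of "-1"] eventually_at_right_less[of 0]
  proof eventually_elim
    case (elim \<epsilon>)
    let ?c = "cos \<epsilon>" and ?s = "sin \<epsilon>"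
    have "\<Delta> / 4 * \<epsilon>\<^sup>2 \<le> Q \<epsilon>" using elim(1,4) by (simp add: pos_less_divide_eq)
    also have "Q \<epsilon> = (\<Sum>i\<in>B. - 2 * t * h' t * (1 - ?c) + \<kappa> * t\<^sup>2 * (1 - ?c)\<^sup>2 + \<kappa> * ?s\<^sup>2 * (v i)\<^sup>2)"
      by (simp add: sum.distrib sum_distrib_left[symmetric] B(2) Q_def mult_ac) (simp add: algebra_simps)
    also have "\<dots> \<le> (\<Sum>i\<in>B. h \<bar>?c * t + ?s * v i\<bar> + h \<bar>?c * t - ?s * v i\<bar> - 2 * h t)"
    proof (rule sum_mono)
      fix i assume i: "i \<in> B"
      have b: "\<bar>(?c * t + ?s * v i) - t\<bar> < min \<delta> t" "\<bar>(?c * t - ?s * v i) - t\<bar> < min \<delta> t"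
        using elim(2,3) i by auto
      then have a: "\<bar>?c * t + ?s * v i\<bar> = ?c * t + ?s * v i" "\<bar>?c * t - ?s * v i\<bar> = ?c * t - ?s * v i"
        by linarith+
      have "h t + h' t * ((?c * t + ?s * v i) - t) + \<kappa> / 2 * ((?c * t + ?s * v i) - t)\<^sup>2 \<le> h (?c * t + ?s * v i)"
        "h t + h' t * ((?c * t - ?s * v i) - t) + \<kappa> / 2 * ((?c * t - ?s * v i) - t)\<^sup>2 \<le> h (?c * t - ?s * v i)"
        using \<delta>(2) b by simp_all
      then show "- 2 * t * h' t * (1 - ?c) + \<kappa> * t\<^sup>2 * (1 - ?c)\<^sup>2 + \<kappa> * ?s\<^sup>2 * (v i)\<^sup>2
        \<le> h \<bar>?c * t + ?s * v i\<bar> + h \<bar>?c * t - ?s * v i\<bar> - 2 * h t"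
        unfolding a by (simp add: power2_eq_square algebra_simps)
    qed
    finally show ?case .
  qed
  then show ?thesis using \<Delta> by (intro exI[of _ "\<Delta> / 4"]) simp
qed

lemma cos_ge_quadratic: "1 - x\<^sup>2 / 2 \<le> cos (x :: real)"
proof -
  have "(sin (x/2))\<^sup>2 \<le> (x/2)\<^sup>2"
    using abs_sin_x_le_abs_x[of "x/2"] by (simp only: abs_le_square_iff)
  moreover have "cos x = 1 - 2 * (sin (x/2))\<^sup>2" using cos_double_sin[of "x/2"] by simp
  ultimately show ?thesis by (simp add: power_divide)
qed

lemma poly_lipschitz_at_1:
  fixes p :: "real poly"
  shows "\<exists>L\<ge>0. \<forall>t. \<bar>t\<bar> \<le> 1 \<longrightarrow> \<bar>poly p 1 - poly p (t\<^sup>2)\<bar> \<le> L * (1 - \<bar>t\<bar>)"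
proof -
  have "poly (p - [:poly p 1:]) 1 = 0" by simp
  then have "[:-1, 1:] dvd p - [:poly p 1:]" by (simp only: poly_eq_0_iff_dvd)
  then obtain q where q: "p - [:poly p 1:] = [:-1, 1:] * q" by (elim dvdE)
  obtain B where B: "\<forall>t. \<bar>t\<bar> \<le> 1 \<longrightarrow> \<bar>poly q (t\<^sup>2)\<bar> \<le> B" using poly_sq_bound[of q] by auto
  have B0: "0 \<le> B" using B[rule_format, of 0] by (smt (verit) abs_ge_zero abs_zero)
  have "\<bar>poly p 1 - poly p (t\<^sup>2)\<bar> \<le> (2 * B) * (1 - \<bar>t\<bar>)" if t: "\<bar>t\<bar> \<le> 1" for t
  proof -
    have "poly p (t\<^sup>2) - poly p 1 = (t\<^sup>2 - 1) * poly q (t\<^sup>2)"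
      using arg_cong[OF q, of "\<lambda>p. poly p (t\<^sup>2)"] by (simp add: algebra_simps)
    moreover have "\<bar>t\<^sup>2 - 1\<bar> = (1 + \<bar>t\<bar>) * (1 - \<bar>t\<bar>)"
    proof -
      have "t\<^sup>2 \<le> 1" using t by (simp add: abs_square_le_1)
      then have "\<bar>t\<^sup>2 - 1\<bar> = 1 - \<bar>t\<bar>\<^sup>2" by simp
      then show ?thesis by (simp add: power2_eq_square algebra_simps)
    qed
    ultimately have "\<bar>poly p 1 - poly p (t\<^sup>2)\<bar> = ((1 + \<bar>t\<bar>) * (1 - \<bar>t\<bar>)) * \<bar>poly q (t\<^sup>2)\<bar>"
      by (simp add: abs_minus_commute[of "poly p 1"] abs_mult)
    also have "\<dots> \<le> (2 * (1 - \<bar>t\<bar>)) * B"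
      using t B B0 by (intro mult_mono mult_right_mono) auto
    finally show ?thesis by (simp add: mult_ac)
  qed
  then show ?thesis using B0 by (intro exI[of _ "2 * B"]) simp
qed

context sphere_dim begin

lemma AE_sph_pole_nonzero: "AE y in (sph :: 'a measure). pole \<bullet> y \<noteq> 0"
proof -
  have "negligible {x::'a. x \<bullet> pole = 0}" by (rule negligible_standard_hyperplane) simp
  then have n: "emeasure lebesgue {x::'a. x \<bullet> pole = 0} = 0" by (auto simp: negligible_iff_null_sets)
  have m: "{x::'a. x \<bullet> pole = 0} \<in> sets borel" by measurable
  have "emeasure sph {x::'a. x \<bullet> pole = 0} = emeasure lborel {x \<in> ball 0 1. sgn x \<in> {x::'a. x \<bullet> pole = 0}} / emeasure lborel (ball (0::'a) 1)"
    by (rule emeasure_sph[OF m])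
  also have "\<dots> \<le> emeasure lborel {x::'a. x \<bullet> pole = 0} / emeasure lborel (ball (0::'a) 1)"
    by (intro divide_right_mono_ennreal emeasure_mono) (auto simp: sgn_div_norm)
  also have "\<dots> = 0" using n m by (simp add: emeasure_completion)
  finally have "emeasure sph {x::'a. x \<bullet> pole = 0} = 0" by simp
  then have "{x::'a. x \<bullet> pole = 0} \<in> null_sets sph" using m by (auto simp: null_sets_def)
  then show ?thesis by (rule AE_I') (auto simp: inner_commute)
qed

text \<open>The heart of the proof. Let \<open>k t = h \<bar>t\<bar>\<close> be subharmonic away from the diagonal, let \<open>n \<ge> 1\<close>, and
  let \<open>\<phi>\<close> be the zonal polynomial \<open>n\<close> with pole \<open>e\<close>. If its eigenvalue \<open>a\<close> were not positive, the function
  \<open>K\<phi> = a \<phi>\<close> would have a minimum at \<open>e\<close>, so its mean over the points at distance \<open>\<epsilon>\<close> from \<open>e\<close>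
  would be at least its value at \<open>e\<close>. On the other hand this difference of means is the integral of the
  difference of means of \<open>k\<close>, which is positive to second order in \<open>\<epsilon>\<close>, against
  \<open>\<phi> y - \<phi> e\<close>, which is nonpositive since \<open>\<phi>\<close> is maximal at \<open>e\<close>. Divide by \<open>\<epsilon>\<^sup>2\<close>
  and let \<open>\<epsilon>\<close> tend to 0: by Fatou's lemma \<open>\<phi>\<close> would be constant, but it has mean 0.

  Fatou's lemma needs a lower bound that is uniform in \<open>\<epsilon>\<close>. It comes from the convexity of \<open>k\<close>
  (\<open>tangent\<close>, \<open>mono\<close>): the mean of \<open>k\<close> decreases by at most a multiple of \<open>\<epsilon>\<^sup>2 * h' \<bar>t\<bar>\<close>, and the
  weight \<open>\<phi> e - \<phi> y = O(1 - \<bar>t\<bar>)\<close> makes this integrable near the diagonal. Convexity also absorbs the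
  kink of \<open>k\<close> at \<open>t = 0\<close>, which has the favourable sign.\<close>

lemma eigenvalue_pos:
  fixes h h' h'' :: "real \<Rightarrow> real"
  assumes k: "zonal_kernel (\<lambda>t. h \<bar>t\<bar>)" and k': "zonal_kernel (\<lambda>t. h' \<bar>t\<bar> * (1 - \<bar>t\<bar>))"
    and d1: "\<And>t. 0 < t \<Longrightarrow> t < 1 \<Longrightarrow> (h has_real_derivative h' t) (at t)"
    and d2: "\<And>t. 0 < t \<Longrightarrow> t < 1 \<Longrightarrow> (h' has_real_derivative h'' t) (at t)"
    and tangent: "\<And>t s. 0 < t \<Longrightarrow> t < 1 \<Longrightarrow> 0 \<le> s \<Longrightarrow> s < 1 \<Longrightarrow> h t + h' t * (s - t) \<le> h s"
    and mono: "\<And>t. 0 < t \<Longrightarrow> t < 1 \<Longrightarrow> 0 \<le> h' t"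
    and sub: "\<And>t. 0 < t \<Longrightarrow> t < 1 \<Longrightarrow> 0 < (1 - t\<^sup>2) * h'' t - real (DIM('a) - 1) * t * h' t"
    and n: "n \<ge> 1"
  shows "0 < eigenvalue (\<lambda>t. h \<bar>t\<bar>) n"
proof (rule ccontr)
  assume "\<not> 0 < eigenvalue (\<lambda>t. h \<bar>t\<bar>) n"
  then have a: "eigenvalue (\<lambda>t. h \<bar>t\<bar>) n \<le> 0" by simp
  let ?S = "sph :: 'a measure" and ?Z1 = "poly (zonal_poly n) 1"
  define k where "k t = h \<bar>t\<bar>" for t
  have kk: "zonal_kernel k" using assms(1) by (simp add: k_def[abs_def])
  note [measurable] = zonal_kernel_measurable[OF kk] zonal_kernel_measurable[OF k']
  define d where "d = DIM('a) - 1"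
  define I where "I = (Basis :: 'a set) - {pole}"
  have I: "finite I" "card I = d" by (simp_all add: I_def d_def)
  define \<psi> where "\<psi> y = ?Z1 - poly (zonal_poly n) ((pole \<bullet> y)\<^sup>2)" for y :: 'a
  have [measurable]: "\<psi> \<in> borel_measurable borel" unfolding \<psi>_def by measurable
  obtain L where L: "L \<ge> 0" "\<forall>t. \<bar>t\<bar> \<le> 1 \<longrightarrow> \<bar>?Z1 - poly (zonal_poly n) (t\<^sup>2)\<bar> \<le> L * (1 - \<bar>t\<bar>)"
    using poly_lipschitz_at_1[of "zonal_poly n"] by (elim exE conjE)
  have \<psi>: "0 \<le> \<psi> y" "\<psi> y \<le> L * (1 - \<bar>pole \<bullet> y\<bar>)" if "\<bar>pole \<bullet> y\<bar> \<le> 1" for y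
    using zonal_poly_abs_le[OF that, of n] L(2) that by (auto simp: \<psi>_def abs_le_iff)
  \<comment> \<open>The points at distance \<open>\<epsilon>\<close> from the pole, along the coordinate directions.\<close>
  define pt where "pt \<sigma> \<epsilon> i = cos \<epsilon> *\<^sub>R pole + (\<sigma> * sin \<epsilon>) *\<^sub>R i" for \<sigma> \<epsilon> :: real and i :: 'a
  have pt: "norm (pt \<sigma> \<epsilon> i) = 1" "pt \<sigma> \<epsilon> i \<bullet> pole = cos \<epsilon>"
    if "i \<in> I" "\<bar>\<sigma>\<bar> = 1" for \<sigma> \<epsilon> i
  proof -
    have i: "i \<bullet> i = 1" "pole \<bullet> i = 0" "i \<bullet> pole = 0" using that by (auto simp: I_def inner_Basis)
    have "\<sigma> * \<sigma> = 1" using that(2) by (metis abs_mult_self_eq mult_1)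
    then have ss: "\<sigma> * (\<sigma> * z) = z" for z by (simp add: mult.assoc[symmetric])
    then have "pt \<sigma> \<epsilon> i \<bullet> pt \<sigma> \<epsilon> i = cos \<epsilon> * cos \<epsilon> + sin \<epsilon> * sin \<epsilon>"
      by (simp add: pt_def inner_add_left inner_add_right i ss mult_ac)
    then show "norm (pt \<sigma> \<epsilon> i) = 1" by (simp add: norm_eq_1 power2_eq_square[symmetric])
    show "pt \<sigma> \<epsilon> i \<bullet> pole = cos \<epsilon>" by (simp add: pt_def inner_add_left i)
  qed
  define G where "G \<epsilon> y = (\<Sum>i\<in>I. k (pt 1 \<epsilon> i \<bullet> y) + k (pt (-1) \<epsilon> i \<bullet> y) - 2 * k (pole \<bullet> y)) * \<psi> y" for \<epsilon> y
  have [measurable]: "G \<epsilon> \<in> borel_measurable borel" for \<epsilon> unfolding G_def by measurable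
  have int0: "integrable ?S (\<lambda>y. k (x \<bullet> y) * \<psi> y)" 
    and int0': "(\<integral>y. k (x \<bullet> y) * \<psi> y \<partial>?S) = ?Z1 * eigenvalue k 0 - eigenvalue k n * poly (zonal_poly n) ((x \<bullet> pole)\<^sup>2)" if x: "norm x = 1" for x
  proof -
    have 1: "integrable ?S (\<lambda>y. k (x \<bullet> y))" "integrable ?S (\<lambda>y. k (x \<bullet> y) * poly (zonal_poly n) ((pole \<bullet> y)\<^sup>2))"
      using zonal_kernel_integrable[OF kk x] zonal_kernel_mult_poly[OF kk x norm_pole] by auto
    have eq: "k (x \<bullet> y) * \<psi> y = ?Z1 * k (x \<bullet> y) - k (x \<bullet> y) * poly (zonal_poly n) ((pole \<bullet> y)\<^sup>2)" for y
      by (simp add: \<psi>_def algebra_simps)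
    show "integrable ?S (\<lambda>y. k (x \<bullet> y) * \<psi> y)" unfolding eq using 1 by simp
    show "(\<integral>y. k (x \<bullet> y) * \<psi> y \<partial>?S) = ?Z1 * eigenvalue k 0 - eigenvalue k n * poly (zonal_poly n) ((x \<bullet> pole)\<^sup>2)"
      unfolding eq using 1 eigenvalue_eigen[OF kk x norm_pole, of n] zonal_integral_eq[OF kk x] by (simp add: eigenvalue_0)
  qed
  have Geq: "G \<epsilon> y = (\<Sum>i\<in>I. k (pt 1 \<epsilon> i \<bullet> y) * \<psi> y + k (pt (-1) \<epsilon> i \<bullet> y) * \<psi> y - 2 * (k (pole \<bullet> y) * \<psi> y))" for \<epsilon> y
    unfolding G_def sum_distrib_right by (intro sum.cong refl) (simp add: algebra_simps)
  have intG: "integrable ?S (G \<epsilon>)" for \<epsilon>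
  proof -
    have "G \<epsilon> = (\<lambda>y. \<Sum>i\<in>I. k (pt 1 \<epsilon> i \<bullet> y) * \<psi> y + k (pt (-1) \<epsilon> i \<bullet> y) * \<psi> y - 2 * (k (pole \<bullet> y) * \<psi> y))"
      by (simp add: Geq fun_eq_iff)
    then show ?thesis using int0 pt norm_pole
      by (auto intro!: Bochner_Integration.integrable_sum Bochner_Integration.integrable_diff Bochner_Integration.integrable_add)
  qed
  have G_le: "(\<integral>y. G \<epsilon> y \<partial>?S) \<le> 0" for \<epsilon>
  proof -
    have "(\<integral>y. G \<epsilon> y \<partial>?S) = (\<integral>y. (\<Sum>i\<in>I. k (pt 1 \<epsilon> i \<bullet> y) * \<psi> y + k (pt (-1) \<epsilon> i \<bullet> y) * \<psi> y - 2 * (k (pole \<bullet> y) * \<psi> y)) \<partial>?S)"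
      by (intro Bochner_Integration.integral_cong refl) (rule Geq)
    also have "\<dots> = (\<Sum>i\<in>I. (\<integral>y. k (pt 1 \<epsilon> i \<bullet> y) * \<psi> y \<partial>?S) + (\<integral>y. k (pt (-1) \<epsilon> i \<bullet> y) * \<psi> y \<partial>?S) - 2 * (\<integral>y. k (pole \<bullet> y) * \<psi> y \<partial>?S))"
      using int0 pt norm_pole by (subst Bochner_Integration.integral_sum) auto
    also have "\<dots> = (\<Sum>i\<in>I. 2 * (eigenvalue k n * (?Z1 - poly (zonal_poly n) ((cos \<epsilon>)\<^sup>2))))"
    proof (intro sum.cong refl)
      fix i assume i: "i \<in> I"
      have "(\<integral>y. k (pt \<sigma> \<epsilon> i \<bullet> y) * \<psi> y \<partial>?S) = ?Z1 * eigenvalue k 0 - eigenvalue k n * poly (zonal_poly n) ((cos \<epsilon>)\<^sup>2)"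
        if "\<bar>\<sigma>\<bar> = 1" for \<sigma>
        using int0'[OF pt(1)[OF i that, of \<epsilon>]] pt(2)[OF i that, of \<epsilon>] by simp
      from this[of 1] this[of "-1"]
      show "(\<integral>y. k (pt 1 \<epsilon> i \<bullet> y) * \<psi> y \<partial>?S) + (\<integral>y. k (pt (-1) \<epsilon> i \<bullet> y) * \<psi> y \<partial>?S) - 2 * (\<integral>y. k (pole \<bullet> y) * \<psi> y \<partial>?S)
        = 2 * (eigenvalue k n * (?Z1 - poly (zonal_poly n) ((cos \<epsilon>)\<^sup>2)))"
        using int0'[OF norm_pole] by (simp add: right_diff_distrib)
    qed
    also have "\<dots> \<le> 0"
    proof (rule sum_nonpos)
      have "poly (zonal_poly n) ((cos \<epsilon>)\<^sup>2) \<le> ?Z1" using zonal_poly_abs_le[of "cos \<epsilon>" n] by simp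
      then have "eigenvalue k n * (?Z1 - poly (zonal_poly n) ((cos \<epsilon>)\<^sup>2)) \<le> 0"
        using a by (intro mult_nonpos_nonneg) (auto simp: k_def[abs_def])
      then show "2 * (eigenvalue k n * (?Z1 - poly (zonal_poly n) ((cos \<epsilon>)\<^sup>2))) \<le> 0" by simp
    qed
    finally show ?thesis .
  qed
  define B where "B y = real d * L * (h' \<bar>pole \<bullet> y\<bar> * (1 - \<bar>pole \<bullet> y\<bar>))" for y
  have [measurable]: "B \<in> borel_measurable borel"
    unfolding B_def using zonal_kernel_measurable[OF k'] by measurable
  have intB: "integrable ?S B" unfolding B_def using zonal_kernel_integrable[OF k' norm_pole] by simp
  define good where "good y \<longleftrightarrow> norm y = 1 \<and> 0 < \<bar>pole \<bullet> y\<bar> \<and> \<bar>pole \<bullet> y\<bar> < 1" for y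
  have AE_good: "AE y in ?S. good y"
    using AE_sph_norm AE_sph_pole_nonzero AE_sph_abs_inner_less_1[OF norm_pole dim]
    by eventually_elim (simp add: good_def)
  have B0: "0 \<le> B y" if "good y" for y
    using that mono[of "\<bar>pole \<bullet> y\<bar>"] L by (simp add: B_def good_def)
  \<comment> \<open>The bound that makes Fatou applicable; \<open>B\<close> is the integrable lower bound.\<close>
  have lower: "0 \<le> G \<epsilon> y / \<epsilon>\<^sup>2 + B y"
    if y: "good y" and e: "\<epsilon> \<noteq> 0" and l: "\<forall>i\<in>I. \<bar>pt 1 \<epsilon> i \<bullet> y\<bar> < 1 \<and> \<bar>pt (-1) \<epsilon> i \<bullet> y\<bar> < 1" for y \<epsilon>
  proof -
    define t where "t = \<bar>pole \<bullet> y\<bar>"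
    have t: "0 < t" "t < 1" using y by (auto simp: good_def t_def)
    have h't: "0 \<le> h' t" using mono t by simp
    have "- (\<epsilon>\<^sup>2 * h' t) \<le> k (pt 1 \<epsilon> i \<bullet> y) + k (pt (-1) \<epsilon> i \<bullet> y) - 2 * k (pole \<bullet> y)" if i: "i \<in> I" for i
    proof -
      let ?p = "\<bar>pt 1 \<epsilon> i \<bullet> y\<bar>" and ?m = "\<bar>pt (-1) \<epsilon> i \<bullet> y\<bar>"
      have "h t + h' t * (?p - t) \<le> h ?p" "h t + h' t * (?m - t) \<le> h ?m"
        using tangent[OF t, of ?p] tangent[OF t, of ?m] l i by auto
      then have 1: "h' t * (?p + ?m - 2 * t) \<le> h ?p + h ?m - 2 * h t" by (simp add: algebra_simps)
      have "pt 1 \<epsilon> i \<bullet> y + pt (-1) \<epsilon> i \<bullet> y = 2 * cos \<epsilon> * (pole \<bullet> y)" by (simp add: pt_def inner_add_left inner_diff_left)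
      then have "?p + ?m \<ge> \<bar>2 * cos \<epsilon> * (pole \<bullet> y)\<bar>" by linarith
      also have "\<bar>2 * cos \<epsilon> * (pole \<bullet> y)\<bar> = 2 * \<bar>cos \<epsilon>\<bar> * t" by (simp add: abs_mult t_def)
      finally have "2 * \<bar>cos \<epsilon>\<bar> * t \<le> ?p + ?m" .
      moreover have "1 - \<epsilon>\<^sup>2 / 2 \<le> \<bar>cos \<epsilon>\<bar>" using cos_ge_quadratic[of \<epsilon>] by linarith
      then have "(1 - \<epsilon>\<^sup>2 / 2) * (2 * t) \<le> \<bar>cos \<epsilon>\<bar> * (2 * t)" using t by (intro mult_right_mono) auto
      moreover have "\<epsilon>\<^sup>2 * t \<le> \<epsilon>\<^sup>2 * 1" using t by (intro mult_left_mono) auto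
      ultimately have "- \<epsilon>\<^sup>2 \<le> ?p + ?m - 2 * t" by (simp add: algebra_simps)
      then have "h' t * (- \<epsilon>\<^sup>2) \<le> h' t * (?p + ?m - 2 * t)" using h't by (intro mult_left_mono)
      with 1 show ?thesis by (simp add: k_def t_def[symmetric] mult.commute)
    qed
    then have "(\<Sum>i\<in>I. - (\<epsilon>\<^sup>2 * h' t)) \<le> (\<Sum>i\<in>I. k (pt 1 \<epsilon> i \<bullet> y) + k (pt (-1) \<epsilon> i \<bullet> y) - 2 * k (pole \<bullet> y))"
      by (rule sum_mono)
    then have "(- (real d * \<epsilon>\<^sup>2 * h' t)) * \<psi> y \<le> G \<epsilon> y"
      unfolding G_def using \<psi>[of y] t by (intro mult_right_mono) (auto simp: I t_def mult_ac)
    moreover have "(real d * \<epsilon>\<^sup>2 * h' t) * \<psi> y \<le> (real d * \<epsilon>\<^sup>2 * h' t) * (L * (1 - t))"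
      using \<psi>[of y] t h't by (intro mult_left_mono) (auto simp: t_def)
    moreover have "(real d * \<epsilon>\<^sup>2 * h' t) * (L * (1 - t)) = \<epsilon>\<^sup>2 * B y" by (simp add: B_def t_def)
    ultimately have "0 \<le> G \<epsilon> y + \<epsilon>\<^sup>2 * B y" unfolding mult_minus_left by linarith
    then have "0 \<le> (G \<epsilon> y + \<epsilon>\<^sup>2 * B y) / \<epsilon>\<^sup>2" by simp
    then show ?thesis using e by (simp add: add_divide_distrib)
  qed
  define E where "E m = 1 / real (Suc m)" for m
  have E0: "E m \<noteq> 0" for m by (simp add: E_def)
  have E_lim: "filterlim E (at_right 0) sequentially"
    unfolding E_def by real_asymp
  have AE_pts: "AE y in ?S. \<forall>m. \<forall>i\<in>I. \<bar>pt 1 (E m) i \<bullet> y\<bar> < 1 \<and> \<bar>pt (-1) (E m) i \<bullet> y\<bar> < 1"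
    unfolding AE_all_countable
  proof
    fix m
    show "AE y in ?S. \<forall>i\<in>I. \<bar>pt 1 (E m) i \<bullet> y\<bar> < 1 \<and> \<bar>pt (-1) (E m) i \<bullet> y\<bar> < 1"
      using I(1) AE_sph_abs_inner_less_1[OF _ dim] pt(1) by (intro AE_finite_allI) (auto intro!: AE_conjI)
  qed
  define g where "g y = liminf (\<lambda>m. ennreal (G (E m) y / (E m)\<^sup>2 + B y))" for y
  have gm[measurable]: "g \<in> borel_measurable borel" unfolding g_def by measurable
  have "(\<integral>\<^sup>+y. g y \<partial>?S) \<le> liminf (\<lambda>m. \<integral>\<^sup>+y. ennreal (G (E m) y / (E m)\<^sup>2 + B y) \<partial>?S)"
    unfolding g_def by (rule nn_integral_liminf) measurable
  also have "\<dots> \<le> liminf (\<lambda>m. ennreal (\<integral>y. B y \<partial>?S))"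
  proof (intro Liminf_mono always_eventually allI)
    fix m
    have "(\<integral>\<^sup>+y. ennreal (G (E m) y / (E m)\<^sup>2 + B y) \<partial>?S) = ennreal (\<integral>y. G (E m) y / (E m)\<^sup>2 + B y \<partial>?S)"
    proof (rule nn_integral_eq_integral)
      show "integrable ?S (\<lambda>y. G (E m) y / (E m)\<^sup>2 + B y)" using intG intB by simp
      show "AE y in ?S. 0 \<le> G (E m) y / (E m)\<^sup>2 + B y"
        using AE_good AE_pts by eventually_elim (rule lower, auto simp: E0)
    qed
    also have "\<dots> \<le> ennreal (\<integral>y. B y \<partial>?S)"
      using intG intB G_le[of "E m"] by (intro ennreal_leI) (simp add: divide_le_0_iff)
    finally show "(\<integral>\<^sup>+y. ennreal (G (E m) y / (E m)\<^sup>2 + B y) \<partial>?S) \<le> ennreal (\<integral>y. B y \<partial>?S)" .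
  qed
  also have "\<dots> = ennreal (\<integral>y. B y \<partial>?S)" by (simp add: Liminf_const)
  also have "\<dots> = (\<integral>\<^sup>+y. ennreal (B y) \<partial>?S)"
    using AE_good by (intro nn_integral_eq_integral[symmetric] intB) (auto elim!: eventually_mono intro: B0)
  finally have gB: "(\<integral>\<^sup>+y. g y \<partial>?S) \<le> (\<integral>\<^sup>+y. ennreal (B y) \<partial>?S)" .
  \<comment> \<open>Where \<open>\<psi>\<close> is positive, the limit exceeds \<open>B\<close> strictly by subharmonicity.\<close>
  have strict: "ennreal (B y) \<le> g y \<and> (0 < \<psi> y \<longrightarrow> ennreal (B y) < g y)" if y: "good y" for y
  proof -
    define t where "t = \<bar>pole \<bullet> y\<bar>"
    have t: "0 < t" "t < 1" using y by (auto simp: good_def t_def)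
    \<comment> \<open>Since \<open>k\<close> is even, \<open>y\<close> may be replaced by the point of its line with positive height \<open>t\<close>.\<close>
    define v where "v i = sgn (pole \<bullet> y) * (i \<bullet> y)" for i
    have "(\<Sum>i\<in>I. (v i)\<^sup>2) = (\<Sum>i\<in>I. (y \<bullet> i)\<^sup>2)"
      using t by (intro sum.cong refl) (auto simp: v_def power_mult_distrib t_def sgn_if inner_commute)
    also have "\<dots> = 1 - t\<^sup>2"
      using sum_Basis_square[of y] y unfolding I_def
      by (subst (asm) sum.remove[of _ pole]) (auto simp: good_def t_def inner_commute)
    finally have v: "(\<Sum>i\<in>I. (v i)\<^sup>2) = 1 - t\<^sup>2" .
    have kv: "k (pt \<sigma> \<epsilon> i \<bullet> y) = h \<bar>cos \<epsilon> * t + \<sigma> * sin \<epsilon> * v i\<bar>" for \<sigma> \<epsilon> i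
    proof -
      have "cos \<epsilon> * t + \<sigma> * sin \<epsilon> * v i = sgn (pole \<bullet> y) * (pt \<sigma> \<epsilon> i \<bullet> y)"
        by (simp add: pt_def v_def t_def inner_add_left inner_diff_left abs_sgn algebra_simps)
      then have "\<bar>cos \<epsilon> * t + \<sigma> * sin \<epsilon> * v i\<bar> = \<bar>pt \<sigma> \<epsilon> i \<bullet> y\<bar>"
        using t by (simp add: abs_mult t_def)
      then show ?thesis by (simp add: k_def)
    qed
    have "0 < (1 - t\<^sup>2) * h'' t - real (card I) * t * h' t" using sub[OF t] I by (simp add: d_def)
    from second_difference_lower[of h h' t "h'' t" I v, OF d1 t d2[OF t] I(1) v this]
    obtain r where r: "r > 0" "\<forall>\<^sub>F \<epsilon> in at_right 0.
     r * \<epsilon>\<^sup>2 \<le> (\<Sum>i\<in>I. h \<bar>cos \<epsilon> * t + sin \<epsilon> * v i\<bar> + h \<bar>cos \<epsilon> * t - sin \<epsilon> * v i\<bar> - 2 * h t)"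
      by auto
    have "\<forall>\<^sub>F m in sequentially. r * (E m)\<^sup>2 \<le>
      (\<Sum>i\<in>I. h \<bar>cos (E m) * t + sin (E m) * v i\<bar> + h \<bar>cos (E m) * t - sin (E m) * v i\<bar> - 2 * h t)"
      using r(2) E_lim by (rule eventually_compose_filterlim)
    then have "\<forall>\<^sub>F m in sequentially. ennreal (r * \<psi> y + B y) \<le> ennreal (G (E m) y / (E m)\<^sup>2 + B y)"
    proof eventually_elim
      case (elim m)
      have "r * (E m)\<^sup>2 * \<psi> y \<le> G (E m) y"
        unfolding G_def kv using elim \<psi>[of y] t by (intro mult_right_mono) (auto simp: k_def t_def)
      then have "r * \<psi> y \<le> G (E m) y / (E m)\<^sup>2" using E0[of m] by (simp add: field_simps)
      then show ?case by (intro ennreal_leI) simp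
    qed
    then have ge: "ennreal (r * \<psi> y + B y) \<le> g y" unfolding g_def by (rule Liminf_bounded)
    have "0 \<le> \<psi> y" using \<psi>[of y] t by (simp add: t_def)
    then have "ennreal (B y) \<le> ennreal (r * \<psi> y + B y)" using r by (intro ennreal_leI) simp
    moreover have "ennreal (B y) < ennreal (r * \<psi> y + B y)" if "0 < \<psi> y"
      using that r B0[OF y] by (intro ennreal_lessI) (auto intro: add_pos_nonneg)
    ultimately show ?thesis using ge by (meson order_trans less_le_trans)
  qed
  have finB: "(\<integral>\<^sup>+y. ennreal (B y) \<partial>?S) < top" using AE_good
    by (subst nn_integral_eq_integral[OF intB]) (auto elim!: eventually_mono intro: B0)
  have "(\<integral>\<^sup>+y. (g y - ennreal (B y)) \<partial>?S) = (\<integral>\<^sup>+y. g y \<partial>?S) - (\<integral>\<^sup>+y. ennreal (B y) \<partial>?S)"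
  proof (rule nn_integral_diff)
    show "(\<integral>\<^sup>+y. ennreal (B y) \<partial>?S) \<noteq> \<infinity>" using finB by simp
    show "AE y in ?S. ennreal (B y) \<le> g y" using AE_good by eventually_elim (simp add: strict)
  qed measurable
  also have "\<dots> = 0" using gB finB by (auto simp: diff_eq_0_iff_ennreal intro: le_less_trans)
  finally have "AE y in ?S. g y - ennreal (B y) = 0" by (subst (asm) nn_integral_0_iff_AE) auto
  then have "AE y in ?S. poly (zonal_poly n) ((pole \<bullet> y)\<^sup>2) = ?Z1"
    using AE_good
  proof eventually_elim
    case (elim y)
    then have "g y \<le> ennreal (B y)" by (simp add: diff_eq_0_iff_ennreal)
    then have "\<not> 0 < \<psi> y" using strict[OF elim(2)] by (auto simp: not_less)
    moreover have "0 \<le> \<psi> y" using \<psi>[of y] elim(2) by (simp add: good_def)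
    ultimately show ?case by (simp add: \<psi>_def)
  qed
  then have "zonal_mean (zonal_poly n) = (\<integral>y. ?Z1 \<partial>?S)" unfolding zonal_mean_def by (intro integral_cong_AE) auto
  then show False using zonal_mean_zonal_poly[OF n] zonal_poly_1(2)[of n] sph.prob_space[where 'a='a] by simp
qed

end

section \<open>A polynomial approximate identity\<close>

text \<open>Induction on \<open>N\<close> with \<open>x \<bullet> y\<close> expanded in coordinates: each factor \<open>(x \<bullet> b) * (y \<bullet> b)\<close> is
  absorbed into \<open>f\<close>.\<close>

lemma inner_power_psd:
  fixes f :: "'a::euclidean_space \<Rightarrow> real"
  assumes "f \<in> borel_measurable borel" "\<And>z. norm z = 1 \<Longrightarrow> \<bar>f z\<bar> \<le> B"
  shows "integrable (sph \<Otimes>\<^sub>M sph) (\<lambda>p. (fst p \<bullet> snd p) ^ N * (f (fst p) * f (snd p)))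
       \<and> 0 \<le> (\<integral>p. (fst p \<bullet> snd p) ^ N * (f (fst p) * f (snd p)) \<partial>(sph \<Otimes>\<^sub>M sph))"
  using assms
proof (induction N arbitrary: f B)
  case (0 f B)
  note [measurable] = 0(1)
  have "AE p in (sph \<Otimes>\<^sub>M sph). norm (f (fst p) * f (snd p)) \<le> B * B"
    using AE_sph2_norm
  proof eventually_elim
    case (elim p)
    then have "\<bar>f (fst p)\<bar> \<le> B" "\<bar>f (snd p)\<bar> \<le> B" using 0(2) by auto
    then show ?case by (auto simp: abs_mult intro!: mult_mono')
  qed
  then have int: "integrable (sph \<Otimes>\<^sub>M sph) (\<lambda>p. f (fst p) * f (snd p))"
    by (intro sph2.integrable_const_bound[where B="B * B"]) auto
  have "(\<integral>p. f (fst p) * f (snd p) \<partial>(sph \<Otimes>\<^sub>M sph)) = (\<integral>x. \<integral>y. f x * f y \<partial>sph \<partial>sph)"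
    using sph2.integral_fst'[OF int] by simp
  also have "\<dots> = (\<integral>y. f y \<partial>sph) * (\<integral>y. f y \<partial>sph)" by simp
  finally show ?case using int by simp
next
  case (Suc N f B)
  note [measurable] = Suc.prems(1)
  define F where "F b = (\<lambda>p :: 'a \<times> 'a. (fst p \<bullet> snd p) ^ N * ((f (fst p) * (fst p \<bullet> b)) * (f (snd p) * (snd p \<bullet> b))))" for b
  have IH: "integrable (sph \<Otimes>\<^sub>M sph) (F b) \<and> 0 \<le> integral\<^sup>L (sph \<Otimes>\<^sub>M sph) (F b)" if b: "b \<in> Basis" for b
    unfolding F_def
  proof (rule Suc.IH[of _ B])
    fix z :: 'a assume z: "norm z = 1"
    have "\<bar>f z\<bar> * \<bar>z \<bullet> b\<bar> \<le> B * 1"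
      using Suc.prems(2)[OF z] abs_inner_unit_le[OF z, of b] b by (intro mult_mono') auto
    then show "\<bar>f z * (z \<bullet> b)\<bar> \<le> B" by (simp add: abs_mult)
  qed measurable
  have eq: "(\<lambda>p. (fst p \<bullet> snd p) ^ Suc N * (f (fst p) * f (snd p))) = (\<lambda>p. \<Sum>b\<in>Basis. F b p)"
  proof
    fix p :: "'a \<times> 'a"
    have "(fst p \<bullet> snd p) ^ Suc N * (f (fst p) * f (snd p))
       = (fst p \<bullet> snd p) ^ N * (f (fst p) * f (snd p)) * (\<Sum>b\<in>Basis. (fst p \<bullet> b) * (snd p \<bullet> b))"
      unfolding euclidean_inner[symmetric] by simp
    also have "\<dots> = (\<Sum>b\<in>Basis. F b p)"
      unfolding sum_distrib_left F_def by (intro sum.cong refl) (simp add: mult_ac)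
    finally show "(fst p \<bullet> snd p) ^ Suc N * (f (fst p) * f (snd p)) = (\<Sum>b\<in>Basis. F b p)" .
  qed
  show ?case unfolding eq
    using IH by (simp add: Bochner_Integration.integral_sum sum_nonneg)
qed

lemma integrable_sph_cap[simp]: "integrable sph (indicat_real (cap (e::'a::euclidean_space) s))"
  by (rule integrable_real_indicator) (auto simp: sph.emeasure_eq_measure)

context sphere_dim begin

text \<open>As a kernel this is a constant multiple of \<open>(x \<bullet> y) ^ (2 * m)\<close> with total mass 1. It is nonnegative, monotone
  in \<open>\<bar>x \<bullet> y\<bar>\<close> and positive definite, and it concentrates at \<open>y = x\<close> and \<open>y = - x\<close> as \<open>m\<close> grows.\<close>

definition peak_poly :: "nat \<Rightarrow> real poly" where
  "peak_poly m = monom (1 / zonal_mean (monom 1 m)) m"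

lemma cap_pos: "norm (e::'a) = 1 \<Longrightarrow> 0 < s \<Longrightarrow> 0 < measure sph (cap e s)"
proof -
  assume e: "norm e = 1" and s: "0 < s"
  obtain c where c: "c > 0" "\<forall>(e::'a) s. norm e = 1 \<longrightarrow> 0 < s \<longrightarrow> s \<le> sqrt 2 \<longrightarrow>
       ennreal (c * s ^ (DIM('a) - 1)) \<le> emeasure sph (cap e s)"
    using cap_lower[where 'a='a] by (elim exE conjE)
  define s' where "s' = min s 1"
  have s': "0 < s'" "s' \<le> sqrt 2" using s by (auto simp: s'_def min_le_iff_disj)
  have "cap e s' \<subseteq> cap e s" by (auto simp: cap_def s'_def)
  then have "measure sph (cap e s') \<le> measure sph (cap e s)" by (intro sph.finite_measure_mono) auto
  moreover have "c * s' ^ (DIM('a) - 1) \<le> measure sph (cap e s')"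
    using c e s' by (simp add: sph.emeasure_eq_measure)
  moreover have "0 < c * s' ^ (DIM('a) - 1)" using c s' by simp
  ultimately show ?thesis by linarith
qed

lemma zonal_mean_monom_ge:
  assumes "0 \<le> a" "a < 1"
  shows "a ^ (2 * m) * measure sph (cap (pole::'a) (sqrt (2 - 2 * a))) \<le> zonal_mean (monom 1 m)"
proof -
  let ?A = "cap (pole::'a) (sqrt (2 - 2 * a))"
  have "a ^ (2 * m) * measure sph ?A = (\<integral>y. a ^ (2 * m) * indicator ?A y \<partial>sph)" by simp
  also have "\<dots> \<le> (\<integral>y. poly (monom 1 m) ((pole \<bullet> y)\<^sup>2) \<partial>sph)"
  proof (rule integral_mono)
    show "integrable sph (\<lambda>y. a ^ (2 * m) * indicator ?A y)" by simp
    show "integrable sph (\<lambda>y. poly (monom 1 m) ((pole \<bullet> y)\<^sup>2))" by (simp only: poly_sq_integrable[OF norm_pole])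
    fix y :: 'a
    show "a ^ (2 * m) * indicator ?A y \<le> poly (monom 1 m) ((pole \<bullet> y)\<^sup>2)"
    proof (cases "y \<in> ?A")
      case True
      then have "a \<le> \<bar>pole \<bullet> y\<bar>" by (simp add: cap_def chord_def)
      then have "a ^ (2 * m) \<le> \<bar>pole \<bullet> y\<bar> ^ (2 * m)" using assms by (intro power_mono) auto
      then show ?thesis using True by (simp add: poly_monom even_pow)
    qed (simp add: poly_monom)
  qed
  finally show ?thesis by (simp add: zonal_mean_def)
qed

lemma zonal_mean_monom_pos: "0 < zonal_mean (monom 1 m)"
proof -
  have "0 < measure sph (cap (pole::'a) (sqrt (2 - 2 * (1/2))))" by (rule cap_pos) auto
  then have "0 < (1/2) ^ (2 * m) * measure sph (cap (pole::'a) (sqrt (2 - 2 * (1/2))))" by simp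
  also have "\<dots> \<le> zonal_mean (monom 1 m)" by (rule zonal_mean_monom_ge) auto
  finally show ?thesis .
qed

lemma peak_poly_eval: "poly (peak_poly m) (t\<^sup>2) = t ^ (2 * m) / zonal_mean (monom 1 m)"
  by (simp add: peak_poly_def poly_monom even_pow)

lemma peak_poly_nonneg: "0 \<le> poly (peak_poly m) (t\<^sup>2)"
  unfolding peak_poly_eval even_pow using zonal_mean_monom_pos[of m] by (intro divide_nonneg_pos) auto

lemma peak_poly_mono: "\<bar>s\<bar> \<le> \<bar>t\<bar> \<Longrightarrow> poly (peak_poly m) (s\<^sup>2) \<le> poly (peak_poly m) (t\<^sup>2)"
  unfolding peak_poly_eval even_pow using zonal_mean_monom_pos[of m]
  by (intro divide_right_mono power_mono[of "s\<^sup>2" "t\<^sup>2"]) (auto simp: abs_le_square_iff)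

lemma zonal_mean_peak_poly: "zonal_mean (peak_poly m) = 1"
proof -
  have "peak_poly m = smult (1 / zonal_mean (monom 1 m)) (monom 1 m)" by (simp add: peak_poly_def smult_monom)
  then show ?thesis using zonal_mean_monom_pos[of m] by (simp only: zonal_mean_smult) simp
qed

lemma peak_poly_tendsto_0:
  assumes a: "0 \<le> a" "a < 1"
  shows "(\<lambda>m. poly (peak_poly m) (a\<^sup>2)) \<longlonglongrightarrow> 0"
proof -
  define b where "b = (1 + a) / 2"
  have b: "0 < b" "a < b" "b < 1" using a by (auto simp: b_def)
  define w where "w = measure sph (cap (pole::'a) (sqrt (2 - 2 * b)))"
  have w: "w > 0" unfolding w_def using b by (intro cap_pos) auto
  have "(\<lambda>m. ((a / b)\<^sup>2) ^ m * (1 / w)) \<longlonglongrightarrow> 0 * (1 / w)"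
    using a b by (intro tendsto_mult tendsto_const LIMSEQ_power_zero) (auto simp: abs_square_less_1)
  then have lim: "(\<lambda>m. ((a / b)\<^sup>2) ^ m * (1 / w)) \<longlonglongrightarrow> 0" by simp
  show ?thesis
  proof (rule Lim_null_comparison[OF always_eventually lim], intro allI)
    fix m
    have "b ^ (2 * m) * w \<le> zonal_mean (monom 1 m)" unfolding w_def using b by (intro zonal_mean_monom_ge) auto
    moreover have "0 < b ^ (2 * m) * w" using b w by simp
    ultimately have "a ^ (2 * m) / zonal_mean (monom 1 m) \<le> a ^ (2 * m) / (b ^ (2 * m) * w)"
      using a b w zonal_mean_monom_pos[of m] by (intro divide_left_mono mult_pos_pos) auto
    then show "norm (poly (peak_poly m) (a\<^sup>2)) \<le> ((a / b)\<^sup>2) ^ m * (1 / w)"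
      using peak_poly_nonneg[of m a] unfolding peak_poly_eval by (simp add: even_pow power_divide)
  qed
qed

text \<open>A kernel that decreases with the distance and has mass 1 is at most the reciprocal of the measure of the
  cap on which it is larger.\<close>

lemma peak_poly_cap_bound:
  assumes "norm x = 1" "norm z = 1" "0 < s" "s \<le> chord x z"
  shows "poly (peak_poly m) ((x \<bullet> z)\<^sup>2) * measure sph (cap (x :: 'a) s) \<le> 1"
proof -
  have "poly (peak_poly m) ((x \<bullet> z)\<^sup>2) * measure sph (cap x s) = (\<integral>y. poly (peak_poly m) ((x \<bullet> z)\<^sup>2) * indicator (cap x s) y \<partial>sph)"
    by simp
  also have "\<dots> \<le> (\<integral>y. poly (peak_poly m) ((x \<bullet> y)\<^sup>2) \<partial>sph)"
  proof (rule integral_mono)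
    show "integrable sph (\<lambda>y. poly (peak_poly m) ((x \<bullet> z)\<^sup>2) * indicator (cap x s) y)" by simp
    show "integrable sph (\<lambda>y. poly (peak_poly m) ((x \<bullet> y)\<^sup>2))" by (rule poly_sq_integrable) fact
    fix y
    show "poly (peak_poly m) ((x \<bullet> z)\<^sup>2) * indicator (cap x s) y \<le> poly (peak_poly m) ((x \<bullet> y)\<^sup>2)"
    proof (cases "y \<in> cap x s")
      case True
      then have "chord x y < chord x z" using assms by (simp add: cap_def)
      then have "\<bar>x \<bullet> z\<bar> \<le> \<bar>x \<bullet> y\<bar>" by (simp add: chord_def)
      then show ?thesis using True peak_poly_mono by simp
    qed (simp add: peak_poly_nonneg)
  qed
  also have "\<dots> = 1" using zonal_mean_eq[OF assms(1)] zonal_mean_peak_poly by simp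
  finally show ?thesis .
qed

lemma eigenvalue_peak_poly_0: "eigenvalue (\<lambda>t. poly (peak_poly m) (t\<^sup>2)) 0 = 1"
  using zonal_mean_peak_poly[of m] by (simp add: eigenvalue_0 zonal_mean_def)

text \<open>The quadratic form of \<open>(x \<bullet> y) ^ (2 * m)\<close>, evaluated at the zonal polynomial, is a positive multiple of the
  eigenvalue.\<close>

lemma eigenvalue_peak_poly_nonneg: "0 \<le> eigenvalue (\<lambda>t. poly (peak_poly m) (t\<^sup>2)) n"
proof -
  let ?f = "\<lambda>x::'a. poly (zonal_poly n) ((pole \<bullet> x)\<^sup>2)"
  let ?c = "zonal_mean (monom 1 m)"
  have bd: "\<bar>?f z\<bar> \<le> poly (zonal_poly n) 1" if "norm z = 1" for z
    by (rule zonal_poly_abs_le, rule abs_inner_unit_le) (use that in auto)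
  have psd: "integrable (sph \<Otimes>\<^sub>M sph) (\<lambda>p. (fst p \<bullet> snd p) ^ (2 * m) * (?f (fst p) * ?f (snd p)))
       \<and> 0 \<le> (\<integral>p. (fst p \<bullet> snd p) ^ (2 * m) * (?f (fst p) * ?f (snd p)) \<partial>(sph \<Otimes>\<^sub>M sph))"
    by (rule inner_power_psd[OF _ bd]) measurable
  have "(\<integral>p. (fst p \<bullet> snd p) ^ (2 * m) * (?f (fst p) * ?f (snd p)) \<partial>(sph \<Otimes>\<^sub>M sph))
     = (\<integral>x. \<integral>y. (x \<bullet> y) ^ (2 * m) * (?f x * ?f y) \<partial>sph \<partial>sph)"
    using sph2.integral_fst'[OF conjunct1[OF psd]] by simp
  also have "\<dots> = (\<integral>x. ?c * eigenvalue (\<lambda>t. poly (peak_poly m) (t\<^sup>2)) n * poly (zonal_poly n * zonal_poly n) ((pole \<bullet> x)\<^sup>2) \<partial>sph)"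
  proof (rule integral_cong_AE)
    show "AE x in sph. (\<integral>y. (x \<bullet> y) ^ (2 * m) * (?f x * ?f y) \<partial>sph) = ?c * eigenvalue (\<lambda>t. poly (peak_poly m) (t\<^sup>2)) n * poly (zonal_poly n * zonal_poly n) ((pole \<bullet> x)\<^sup>2)"
      using AE_sph_norm
    proof eventually_elim
      case (elim x)
      have "(\<integral>y. (x \<bullet> y) ^ (2 * m) * (?f x * ?f y) \<partial>sph) = (\<integral>y. ?c * ?f x * (poly (peak_poly m) ((x \<bullet> y)\<^sup>2) * ?f y) \<partial>sph)"
        by (intro Bochner_Integration.integral_cong refl) (use zonal_mean_monom_pos[of m] in \<open>simp add: peak_poly_eval\<close>)
      also have "\<dots> = ?c * ?f x * (eigenvalue (\<lambda>t. poly (peak_poly m) (t\<^sup>2)) n * poly (zonal_poly n) ((x \<bullet> pole)\<^sup>2))"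
        using eigenvalue_eigen[OF zonal_kernel_poly elim norm_pole, of "peak_poly m" n] by simp
      finally show ?case by (simp add: inner_commute mult_ac)
    qed
  qed measurable
  also have "\<dots> = ?c * eigenvalue (\<lambda>t. poly (peak_poly m) (t\<^sup>2)) n * poly (zonal_poly n) 1" by (simp add: zonal_poly_1(1) zonal_mean_def)
  finally have "0 \<le> ?c * eigenvalue (\<lambda>t. poly (peak_poly m) (t\<^sup>2)) n * poly (zonal_poly n) 1" using psd by simp
  then show ?thesis using zonal_mean_monom_pos[of m] zonal_poly_1(2)[of n] by (simp add: zero_le_mult_iff)
qed

lemma peak_poly_approx_identity:
  fixes F :: "'a \<Rightarrow> real"
  assumes [measurable]: "F \<in> borel_measurable borel" and int: "integrable sph F"
    and even: "\<And>z. F (- z) = F z" and cont: "isCont F x" and x: "norm x = 1"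
  shows "(\<lambda>m. \<integral>z. poly (peak_poly m) ((x \<bullet> z)\<^sup>2) * F z \<partial>sph) \<longlonglongrightarrow> F x"
proof (rule LIMSEQ_I)
  fix \<epsilon> :: real assume \<epsilon>: "0 < \<epsilon>"
  from cont obtain \<delta>0 where \<delta>0: "\<delta>0 > 0" "\<And>z. dist z x < \<delta>0 \<Longrightarrow> dist (F z) (F x) < \<epsilon> / 2"
    unfolding continuous_at_eps_delta using \<epsilon> by (metis half_gt_zero)
  define \<delta> where "\<delta> = min \<delta>0 1"
  have \<delta>: "0 < \<delta>" "\<delta> \<le> 1" "\<delta> \<le> \<delta>0" using \<delta>0 by (auto simp: \<delta>_def)
  have near: "\<bar>F z - F x\<bar> \<le> \<epsilon> / 2" if z: "norm z = 1" "chord x z < \<delta>" for z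
  proof (cases "0 \<le> x \<bullet> z")
    case True
    then have "norm (x - z) < \<delta>0" using chord_eq_norm(1)[OF x z(1)] z(2) \<delta> by simp
    then show ?thesis using \<delta>0(2)[of z] by (simp add: dist_norm norm_minus_commute)
  next
    case False
    then have "norm (x - (- z)) < \<delta>0" using chord_eq_norm(1)[OF x, of "- z"] z \<delta> by simp
    then have "\<bar>F (- z) - F x\<bar> < \<epsilon> / 2" using \<delta>0(2)[of "- z"] by (simp add: dist_norm norm_minus_commute)
    then show ?thesis using even by simp
  qed
  define a where "a = 1 - \<delta>\<^sup>2 / 2"
  have "0 < \<delta>\<^sup>2" "\<delta>\<^sup>2 \<le> 1" using \<delta> by (auto simp: power_le_one)
  then have a: "0 \<le> a" "a < 1" unfolding a_def by linarith+
  have far: "poly (peak_poly m) ((x \<bullet> z)\<^sup>2) \<le> poly (peak_poly m) (a\<^sup>2)" if z: "norm z = 1" "\<not> chord x z < \<delta>" for z m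
  proof (rule peak_poly_mono)
    have "sqrt (\<delta>\<^sup>2) \<le> sqrt (2 - 2 * \<bar>x \<bullet> z\<bar>)" using z \<delta> by (simp add: chord_def)
    then have "\<delta>\<^sup>2 \<le> 2 - 2 * \<bar>x \<bullet> z\<bar>" by (simp only: real_sqrt_le_iff)
    then show "\<bar>x \<bullet> z\<bar> \<le> \<bar>a\<bar>" unfolding a_def by linarith
  qed
  define M where "M = (\<integral>z. \<bar>F z - F x\<bar> \<partial>sph)"
  have M: "0 \<le> M" by (simp add: M_def)
  have intq: "integrable sph (\<lambda>z. poly (peak_poly m) ((x \<bullet> z)\<^sup>2))" for m by (rule poly_sq_integrable) fact
  have mult: "integrable sph (\<lambda>z. f z * poly (peak_poly m) ((x \<bullet> z)\<^sup>2))" if f: "integrable sph f" for f :: "'a \<Rightarrow> real" and m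
  proof -
    obtain B where B: "\<forall>t. \<bar>t\<bar> \<le> 1 \<longrightarrow> \<bar>poly (peak_poly m) (t\<^sup>2)\<bar> \<le> B" using poly_sq_bound[of "peak_poly m"] by auto
    show ?thesis
      by (rule integrable_mult_bounded[OF f, where B=B])
         (use AE_sph_inner_le_1[OF x] B in \<open>auto elim!: eventually_mono\<close>)
  qed
  have bound: "\<bar>(\<integral>z. poly (peak_poly m) ((x \<bullet> z)\<^sup>2) * F z \<partial>sph) - F x\<bar> \<le> \<epsilon> / 2 + poly (peak_poly m) (a\<^sup>2) * M" for m
  proof -
    let ?q = "\<lambda>z. poly (peak_poly m) ((x \<bullet> z)\<^sup>2)"
    have "(\<integral>z. ?q z * F z \<partial>sph) - F x = (\<integral>z. F z * ?q z \<partial>sph) - (\<integral>z. F x * ?q z \<partial>sph)"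
      using zonal_mean_eq[OF x, of "peak_poly m"] zonal_mean_peak_poly[of m] by (simp add: mult.commute)
    also have "\<dots> = (\<integral>z. (F z - F x) * ?q z \<partial>sph)"
      using mult[OF int, of m] intq[of m] by (simp add: left_diff_distrib)
    finally have "(\<integral>z. ?q z * F z \<partial>sph) - F x = (\<integral>z. (F z - F x) * ?q z \<partial>sph)" .
    then have "\<bar>(\<integral>z. ?q z * F z \<partial>sph) - F x\<bar> \<le> (\<integral>z. \<bar>(F z - F x) * ?q z\<bar> \<partial>sph)"
      by (simp only: integral_abs_bound)
    also have "\<dots> \<le> (\<integral>z. \<epsilon> / 2 * ?q z + poly (peak_poly m) (a\<^sup>2) * \<bar>F z - F x\<bar> \<partial>sph)"
    proof (rule integral_mono_AE)
      show "integrable sph (\<lambda>z. \<bar>(F z - F x) * ?q z\<bar>)" using mult[of "\<lambda>z. F z - F x" m] int by simp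
      show "integrable sph (\<lambda>z. \<epsilon> / 2 * ?q z + poly (peak_poly m) (a\<^sup>2) * \<bar>F z - F x\<bar>)" using intq int by simp
      show "AE z in sph. \<bar>(F z - F x) * ?q z\<bar> \<le> \<epsilon> / 2 * ?q z + poly (peak_poly m) (a\<^sup>2) * \<bar>F z - F x\<bar>"
        using AE_sph_norm
      proof eventually_elim
        case (elim z)
        have e: "\<bar>(F z - F x) * ?q z\<bar> = \<bar>F z - F x\<bar> * ?q z" by (simp add: abs_mult peak_poly_nonneg)
        show ?case
        proof (cases "chord x z < \<delta>")
          case True
          have "\<bar>F z - F x\<bar> * ?q z \<le> \<epsilon> / 2 * ?q z" using near[OF elim True] by (intro mult_right_mono peak_poly_nonneg)
          moreover have "0 \<le> poly (peak_poly m) (a\<^sup>2) * \<bar>F z - F x\<bar>" by (intro mult_nonneg_nonneg peak_poly_nonneg) simp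
          ultimately show ?thesis unfolding e by linarith
        next
          case False
          have "\<bar>F z - F x\<bar> * ?q z \<le> \<bar>F z - F x\<bar> * poly (peak_poly m) (a\<^sup>2)" using far[OF elim False] by (intro mult_left_mono) auto
          moreover have "0 \<le> \<epsilon> / 2 * ?q z" using \<epsilon> by (intro mult_nonneg_nonneg peak_poly_nonneg) simp
          ultimately show ?thesis unfolding e by (simp add: mult.commute)
        qed
      qed
    qed
    also have "\<dots> = \<epsilon> / 2 + poly (peak_poly m) (a\<^sup>2) * M"
      using intq[of m] int zonal_mean_eq[OF x, of "peak_poly m"] zonal_mean_peak_poly[of m] by (simp add: M_def)
    finally show ?thesis .
  qed
  have "(\<lambda>m. poly (peak_poly m) (a\<^sup>2) * M) \<longlonglongrightarrow> 0 * M" by (intro tendsto_mult peak_poly_tendsto_0 a tendsto_const)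
  then have "\<forall>\<^sub>F m in sequentially. poly (peak_poly m) (a\<^sup>2) * M < \<epsilon> / 2" using \<epsilon> by (auto dest: order_tendstoD(2)[of _ _ _ "\<epsilon>/2"])
  then obtain m0 where "\<forall>m\<ge>m0. poly (peak_poly m) (a\<^sup>2) * M < \<epsilon> / 2" by (auto simp: eventually_sequentially)
  then have "\<forall>m\<ge>m0. norm ((\<integral>z. poly (peak_poly m) ((x \<bullet> z)\<^sup>2) * F z \<partial>sph) - F x) < \<epsilon>"
    using bound by (smt (verit) field_sum_of_halves real_norm_def)
  then show "\<exists>m0. \<forall>m\<ge>m0. norm ((\<integral>z. poly (peak_poly m) ((x \<bullet> z)\<^sup>2) * F z \<partial>sph) - F x) < \<epsilon>" by (intro exI[of _ m0])
qed

lemma eigenvalue_peak_poly_tendsto_1: "(\<lambda>m. eigenvalue (\<lambda>t. poly (peak_poly m) (t\<^sup>2)) n) \<longlonglongrightarrow> 1"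
proof -
  have "(\<lambda>m. \<integral>z. poly (peak_poly m) ((pole \<bullet> z)\<^sup>2) * poly (zonal_poly n) ((pole \<bullet> z)\<^sup>2) \<partial>(sph :: 'a measure)) \<longlonglongrightarrow> poly (zonal_poly n) ((pole \<bullet> pole)\<^sup>2)"
    by (rule peak_poly_approx_identity) (auto intro!: poly_sq_integrable continuous_intros)
  then have "(\<lambda>m. (\<integral>z. poly (peak_poly m) ((pole \<bullet> z)\<^sup>2) * poly (zonal_poly n) ((pole \<bullet> z)\<^sup>2) \<partial>(sph :: 'a measure)) / poly (zonal_poly n) 1) \<longlonglongrightarrow> poly (zonal_poly n) 1 / poly (zonal_poly n) 1"
    using zonal_poly_1(2)[of n] by (intro tendsto_divide tendsto_const) auto
  then show ?thesis unfolding eigenvalue_def using zonal_poly_1(2)[of n] by simp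
qed

end

section \<open>The approximate identity preserves doubling singularities\<close>

text \<open>A point at distance \<open>r < s\<close> lies in exactly one dyadic shell; the least \<open>j\<close> with \<open>s / 2 ^ Suc j \<le> r\<close>
  finds it.\<close>

lemma dyadic_shell:
  fixes r s :: real
  assumes "0 < r" "r < s"
  obtains j where "s / 2 ^ Suc j \<le> r" "r < s / 2 ^ j"
proof -
  have "\<exists>j. s / 2 ^ Suc j \<le> r"
  proof -
    obtain j where "s / r < 2 ^ j" using real_arch_pow[of 2 "s / r"] by auto
    then have "s < r * 2 ^ j" using assms by (simp add: field_simps)
    also have "\<dots> \<le> r * 2 ^ Suc j" using assms by simp
    finally show ?thesis by (intro exI[of _ j]) (simp add: field_simps)
  qed
  then have le: "s / 2 ^ Suc (LEAST j. s / 2 ^ Suc j \<le> r) \<le> r" by (rule LeastI_ex)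
  have "r < s / 2 ^ (LEAST j. s / 2 ^ Suc j \<le> r)"
  proof (cases "LEAST j. s / 2 ^ Suc j \<le> r")
    case 0 then show ?thesis using assms by simp
  next
    case (Suc i)
    then have "\<not> s / 2 ^ Suc i \<le> r" using not_less_Least[of i "\<lambda>j. s / 2 ^ Suc j \<le> r"] by simp
    then show ?thesis using Suc by simp
  qed
  then show ?thesis using le that by blast
qed

text \<open>The condition on \<open>D\<close> makes the singularity integrable: halving the radius divides the measure of a cap
  by about \<open>2 ^ (DIM('a) - 1)\<close> and multiplies \<open>\<kappa>\<close> by at most \<open>D\<close>.\<close>

locale doubling_profile = sphere_dim dummy for dummy :: "'a::euclidean_space itself" +
  fixes \<kappa> :: "real \<Rightarrow> real" and D :: real
  assumes kappa_measurable[measurable]: "\<kappa> \<in> borel_measurable borel"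
    and kappa_nonneg: "\<And>r. 0 < r \<Longrightarrow> r \<le> 2 \<Longrightarrow> 0 \<le> \<kappa> r"
    and kappa_antimono: "\<And>r s. 0 < r \<Longrightarrow> r \<le> s \<Longrightarrow> s \<le> 2 \<Longrightarrow> \<kappa> s \<le> \<kappa> r"
    and kappa_doubling: "\<And>r. 0 < r \<Longrightarrow> r \<le> 2 \<Longrightarrow> \<kappa> (r / 2) \<le> D * \<kappa> r"
    and D: "0 \<le> D" "D < 2 ^ (DIM('a) - 1)"
begin

lemma kappa_dyadic: "0 < s \<Longrightarrow> s \<le> 2 \<Longrightarrow> \<kappa> (s / 2 ^ j) \<le> D ^ j * \<kappa> s"
proof (induction j)
  case (Suc j)
  have "s / 2 ^ j \<le> 2" using Suc.prems by (simp add: divide_le_eq) (smt (verit) mult_le_cancel_left1 one_le_power)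
  then have "\<kappa> (s / 2 ^ j / 2) \<le> D * \<kappa> (s / 2 ^ j)" using Suc.prems by (intro kappa_doubling) auto
  also have "\<dots> \<le> D * (D ^ j * \<kappa> s)" using Suc D by (intro mult_left_mono) auto
  finally show ?case by (simp add: mult_ac)
qed simp

text \<open>Summation over dyadic shells, which is dominated by a geometric series with ratio
  \<open>D / 2 ^ (DIM('a) - 1)\<close>.\<close>

lemma kappa_cap_integral:
  "\<exists>C\<ge>0. \<forall>(e::'a) s. norm e = 1 \<longrightarrow> 0 < s \<longrightarrow> s \<le> 2 \<longrightarrow>
     (\<integral>\<^sup>+y. ennreal (\<kappa> (chord e y)) * indicator (cap e s) y \<partial>sph) \<le> ennreal (C * s ^ (DIM('a) - 1) * \<kappa> s)"
proof -
  define d where "d = DIM('a) - 1"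
  obtain C0 where C0: "C0 > 0" "\<forall>(e::'a) s. norm e = 1 \<longrightarrow> 0 < s \<longrightarrow>
       emeasure sph (cap e s) \<le> ennreal (C0 * s ^ d)"
    using cap_upper[where 'a='a] unfolding d_def by (elim exE conjE)
  define \<rho> where "\<rho> = D / 2 ^ d"
  have \<rho>: "0 \<le> \<rho>" "\<rho> < 1" using D by (auto simp: \<rho>_def d_def)
  define C where "C = C0 * D / (1 - \<rho>)"
  have C: "0 \<le> C" using C0 D \<rho> by (simp add: C_def)
  have "(\<integral>\<^sup>+y. ennreal (\<kappa> (chord e y)) * indicator (cap e s) y \<partial>sph) \<le> ennreal (C * s ^ d * \<kappa> s)"
    if e: "norm e = 1" and s: "0 < s" "s \<le> 2" for e :: 'a and s
  proof -
    have ks: "0 \<le> \<kappa> s" using kappa_nonneg s by simp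
    let ?f = "\<lambda>j y. ennreal (D ^ Suc j * \<kappa> s) * indicator (cap e (s / 2 ^ j)) y"
    have "(\<integral>\<^sup>+y. ennreal (\<kappa> (chord e y)) * indicator (cap e s) y \<partial>sph) \<le> (\<integral>\<^sup>+y. (\<Sum>j. ?f j y) \<partial>sph)"
    proof (rule nn_integral_mono_AE)
      show "AE y in sph. ennreal (\<kappa> (chord e y)) * indicator (cap e s) y \<le> (\<Sum>j. ?f j y)"
        using AE_sph_abs_inner_less_1[OF e dim]
      proof eventually_elim
        case (elim y)
        show ?case
        proof (cases "y \<in> cap e s")
          case True
          have r: "0 < chord e y" "chord e y < s" using elim True by (auto simp: chord_def cap_def)
          then obtain j where j: "s / 2 ^ Suc j \<le> chord e y" "chord e y < s / 2 ^ j" by (rule dyadic_shell)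
          have "\<kappa> (chord e y) \<le> \<kappa> (s / 2 ^ Suc j)" using j r s by (intro kappa_antimono) auto
          also have "\<dots> \<le> D ^ Suc j * \<kappa> s" by (rule kappa_dyadic) fact+
          finally have "ennreal (\<kappa> (chord e y)) * indicator (cap e s) y \<le> ?f j y"
            using j(2) True by (auto simp: cap_def intro: ennreal_leI)
          also have "\<dots> \<le> (\<Sum>j. ?f j y)" 
          proof -
            have "sum g {j} = g j" for g :: "nat \<Rightarrow> ennreal" by simp
            from this[of "\<lambda>j. ?f j y"] show ?thesis
              using sum_le_suminf[of "\<lambda>j. ?f j y" "{j}"] by (simp only: summableI) simp
          qed
          finally show ?thesis .
        qed simp
      qed
    qed
    also have "\<dots> = (\<Sum>j. ennreal (D ^ Suc j * \<kappa> s) * emeasure sph (cap e (s / 2 ^ j)))"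
      by (subst nn_integral_suminf) (auto simp: nn_integral_cmult)
    also have "\<dots> \<le> (\<Sum>j. ennreal ((C0 * D * s ^ d * \<kappa> s) * \<rho> ^ j))"
    proof (rule suminf_le)
      fix j
      have "ennreal (D ^ Suc j * \<kappa> s) * emeasure sph (cap e (s / 2 ^ j)) \<le> ennreal (D ^ Suc j * \<kappa> s) * ennreal (C0 * (s / 2 ^ j) ^ d)"
        using C0 e s by (intro mult_left_mono) auto
      also have "\<dots> = ennreal ((D ^ Suc j * \<kappa> s) * (C0 * (s / 2 ^ j) ^ d))"
        using D ks by (intro ennreal_mult'[symmetric]) auto
      also have "(D ^ Suc j * \<kappa> s) * (C0 * (s / 2 ^ j) ^ d) = (C0 * D * s ^ d * \<kappa> s) * \<rho> ^ j"
        by (simp add: \<rho>_def power_divide power_mult[symmetric] mult.commute[of j])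
      finally show "ennreal (D ^ Suc j * \<kappa> s) * emeasure sph (cap e (s / 2 ^ j)) \<le> ennreal ((C0 * D * s ^ d * \<kappa> s) * \<rho> ^ j)" .
    qed auto
    also have "\<dots> = ennreal (\<Sum>j. (C0 * D * s ^ d * \<kappa> s) * \<rho> ^ j)"
      using C0 D s ks \<rho> by (intro suminf_ennreal2) (auto intro!: summable_mult summable_geometric)
    also have "(\<Sum>j. (C0 * D * s ^ d * \<kappa> s) * \<rho> ^ j) = C * s ^ d * \<kappa> s"
      using \<rho> by (simp add: suminf_mult summable_geometric suminf_geometric C_def)
    finally show ?thesis .
  qed
  then show ?thesis using C unfolding d_def by (intro exI[of _ C]) auto
qed

lemma kappa_integrable: "norm (e::'a) = 1 \<Longrightarrow> integrable sph (\<lambda>y. \<kappa> (chord e y))"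
proof -
  assume e: "norm e = 1"
  obtain C where C: "C \<ge> 0" "\<forall>(e::'a) s. norm e = 1 \<longrightarrow> 0 < s \<longrightarrow> s \<le> 2 \<longrightarrow>
     (\<integral>\<^sup>+y. ennreal (\<kappa> (chord e y)) * indicator (cap e s) y \<partial>sph) \<le> ennreal (C * s ^ (DIM('a) - 1) * \<kappa> s)"
    using kappa_cap_integral by (elim exE conjE)
  have s2: "sqrt 2 < (2::real)" by (rule real_less_lsqrt) auto
  have AE: "AE y in sph. 0 < chord e y \<and> chord e y < 2"
    using AE_sph_norm AE_sph_abs_inner_less_1[OF e dim]
  proof eventually_elim
    case (elim y)
    then have "0 < chord e y" by (simp add: chord_def)
    then show ?case using chord_bounds[OF e, of y] s2 elim(1) by linarith
  qed
  have "(\<integral>\<^sup>+y. ennreal (norm (\<kappa> (chord e y))) \<partial>sph) = (\<integral>\<^sup>+y. ennreal (\<kappa> (chord e y)) * indicator (cap e 2) y \<partial>sph)"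
  proof (rule nn_integral_cong_AE)
    show "AE y in sph. ennreal (norm (\<kappa> (chord e y))) = ennreal (\<kappa> (chord e y)) * indicator (cap e 2) y"
      using AE by eventually_elim (simp add: cap_def kappa_nonneg)
  qed
  also have "\<dots> \<le> ennreal (C * 2 ^ (DIM('a) - 1) * \<kappa> 2)" using C(2) e by simp
  also have "\<dots> < \<infinity>" by simp
  finally show ?thesis by (intro integrableI_bounded) auto
qed

text \<open>This says that \<open>\<kappa>\<close> is a Muckenhoupt \<open>A\<^sub>1\<close> weight, with a constant uniform in \<open>m\<close>. Let \<open>s\<close> be the distance
  of \<open>x\<close> and \<open>y\<close>. Where \<open>z\<close> has distance at least \<open>s / 2\<close> from \<open>y\<close>, the singularity is at most \<open>D * \<kappa> s\<close>
  and the kernel has mass 1. The other \<open>z\<close> have distance at least \<open>s / 2\<close> from \<open>x\<close>, so there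
  the kernel is at most the reciprocal of a cap measure, which is of order \<open>s ^ (1 - DIM('a))\<close>, while \<open>\<kappa>\<close> integrates to
  \<open>O(s ^ (DIM('a) - 1) * \<kappa> s)\<close>.\<close>

lemma peak_poly_kappa_bound:
  "\<exists>C\<ge>0. \<forall>m (x::'a) y. norm x = 1 \<longrightarrow> norm y = 1 \<longrightarrow> 0 < chord x y \<longrightarrow>
     (\<integral>\<^sup>+z. ennreal (poly (peak_poly m) ((x \<bullet> z)\<^sup>2)) * ennreal (\<kappa> (chord y z)) \<partial>sph) \<le> ennreal (C * \<kappa> (chord x y))"
proof -
  define d where "d = DIM('a) - 1"
  obtain C1 where C1: "C1 \<ge> 0" "\<forall>(e::'a) s. norm e = 1 \<longrightarrow> 0 < s \<longrightarrow> s \<le> 2 \<longrightarrow>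
     (\<integral>\<^sup>+y. ennreal (\<kappa> (chord e y)) * indicator (cap e s) y \<partial>sph) \<le> ennreal (C1 * s ^ d * \<kappa> s)"
    using kappa_cap_integral unfolding d_def by (elim exE conjE)
  obtain c where c: "c > 0" "\<forall>(e::'a) s. norm e = 1 \<longrightarrow> 0 < s \<longrightarrow> s \<le> sqrt 2 \<longrightarrow>
       ennreal (c * s ^ d) \<le> emeasure sph (cap e s)"
    using cap_lower[where 'a='a] unfolding d_def by (elim exE conjE)
  define C where "C = D + C1 / c * D"
  have C: "C \<ge> 0" using D C1 c by (simp add: C_def)
  have s2: "sqrt 2 < (2::real)" by (rule real_less_lsqrt) auto
  have "(\<integral>\<^sup>+z. ennreal (poly (peak_poly m) ((x \<bullet> z)\<^sup>2)) * ennreal (\<kappa> (chord y z)) \<partial>sph) \<le> ennreal (C * \<kappa> (chord x y))"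
    if x: "norm x = 1" and y: "norm y = 1" and pos: "0 < chord x y" for m and x y :: 'a
  proof -
    define s where "s = chord x y"
    have s: "0 < s" "s \<le> sqrt 2" "s \<le> 2" using pos chord_bounds[OF x y] s2 by (auto simp: s_def)
    have ks: "0 \<le> \<kappa> s" using kappa_nonneg s by simp
    have kd: "\<kappa> (s / 2) \<le> D * \<kappa> s" by (rule kappa_doubling) (use s in auto)
    have ks2: "0 \<le> \<kappa> (s / 2)" using s by (intro kappa_nonneg) auto
    let ?q = "\<lambda>z. poly (peak_poly m) ((x \<bullet> z)\<^sup>2)"
    define b where "b = 1 / (c * (s / 2) ^ d)"
    have b: "0 \<le> b" using c s by (simp add: b_def)
    have far: "?q z \<le> b" if z: "norm z = 1" "s / 2 \<le> chord x z" for z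
    proof -
      have "c * (s / 2) ^ d \<le> measure sph (cap x (s / 2))"
        using c(2)[rule_format, OF x, of "s / 2"] s by (simp add: sph.emeasure_eq_measure)
      then have "?q z * (c * (s / 2) ^ d) \<le> ?q z * measure sph (cap x (s / 2))"
        by (intro mult_left_mono peak_poly_nonneg)
      also have "\<dots> \<le> 1" by (rule peak_poly_cap_bound) (use x z s in auto)
      finally show ?thesis using c s by (simp add: b_def field_simps)
    qed
    have "(\<integral>\<^sup>+z. ennreal (?q z) * ennreal (\<kappa> (chord y z)) \<partial>sph)
      \<le> (\<integral>\<^sup>+z. ennreal (D * \<kappa> s) * ennreal (?q z) + ennreal b * (ennreal (\<kappa> (chord y z)) * indicator (cap y (s / 2)) z) \<partial>sph)"
    proof (rule nn_integral_mono_AE)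
      show "AE z in sph. ennreal (?q z) * ennreal (\<kappa> (chord y z))
        \<le> ennreal (D * \<kappa> s) * ennreal (?q z) + ennreal b * (ennreal (\<kappa> (chord y z)) * indicator (cap y (s / 2)) z)"
        using AE_sph_norm
      proof eventually_elim
        case (elim z)
        show ?case
        proof (cases "chord y z < s / 2")
          case True
          have "s / 2 \<le> chord x z"
            using chord_triangle[OF x y elim] True chord_commute[of z y] by (simp add: s_def)
          then have "ennreal (?q z) * ennreal (\<kappa> (chord y z)) \<le> ennreal b * ennreal (\<kappa> (chord y z))"
            using far[OF elim] by (intro mult_right_mono ennreal_leI) auto
          then show ?thesis using True by (simp add: cap_def add_increasing)
        next
          case False
          have "\<kappa> (chord y z) \<le> \<kappa> (s / 2)"
            using False s chord_bounds[OF y elim] s2 by (intro kappa_antimono) auto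
          then have "\<kappa> (chord y z) \<le> D * \<kappa> s" using kd by simp
          then have "ennreal (?q z) * ennreal (\<kappa> (chord y z)) \<le> ennreal (?q z) * ennreal (D * \<kappa> s)"
            by (intro mult_left_mono ennreal_leI) auto
          then show ?thesis by (simp add: mult.commute add_increasing2)
        qed
      qed
    qed
    also have "\<dots> = ennreal (D * \<kappa> s) * (\<integral>\<^sup>+z. ennreal (?q z) \<partial>sph) + ennreal b * (\<integral>\<^sup>+z. ennreal (\<kappa> (chord y z)) * indicator (cap y (s / 2)) z \<partial>sph)"
      by (subst nn_integral_add) (auto simp: nn_integral_cmult)
    also have "(\<integral>\<^sup>+z. ennreal (?q z) \<partial>sph) = 1"
      using zonal_mean_eq[OF x, of "peak_poly m"] zonal_mean_peak_poly[of m] by (subst nn_integral_eq_integral) (auto simp: poly_sq_integrable[OF x] peak_poly_nonneg)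
    also have "ennreal (D * \<kappa> s) * 1 + ennreal b * (\<integral>\<^sup>+z. ennreal (\<kappa> (chord y z)) * indicator (cap y (s / 2)) z \<partial>sph)
      \<le> ennreal (D * \<kappa> s) * 1 + ennreal b * ennreal (C1 * (s / 2) ^ d * \<kappa> (s / 2))"
      using C1(2)[rule_format, OF y, of "s / 2"] s by (intro add_left_mono mult_left_mono) auto
    also have "\<dots> = ennreal (D * \<kappa> s) + ennreal (b * (C1 * (s / 2) ^ d * \<kappa> (s / 2)))"
      using b by (simp add: ennreal_mult')
    also have "\<dots> = ennreal (D * \<kappa> s + b * (C1 * (s / 2) ^ d * \<kappa> (s / 2)))"
      using b D ks ks2 C1 s by (intro ennreal_plus[symmetric]) auto
    also have "b * (C1 * (s / 2) ^ d * \<kappa> (s / 2)) = C1 / c * \<kappa> (s / 2)" using c s by (simp add: b_def)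
    also have "ennreal (D * \<kappa> s + C1 / c * \<kappa> (s / 2)) \<le> ennreal (D * \<kappa> s + C1 / c * (D * \<kappa> s))"
      using kd C1 c by (intro ennreal_leI add_left_mono mult_left_mono) auto
    also have "D * \<kappa> s + C1 / c * (D * \<kappa> s) = C * \<kappa> s" by (simp add: C_def algebra_simps)
    finally show ?thesis by (simp add: s_def)
  qed
  then show ?thesis using C by (intro exI[of _ C]) auto
qed

end

section \<open>Energies of probability measures on the sphere\<close>

locale sphere_prob = sphere_dim dummy + mu: prob_space \<mu>
  for dummy :: "'a::euclidean_space itself" and \<mu> :: "'a measure" +
  assumes sets_mu[simp, measurable_cong]: "sets \<mu> = sets borel"
    and AE_mu_norm: "AE x in \<mu>. norm x = 1"
begin

interpretation mm: pair_prob_space \<mu> \<mu> ..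
interpretation ms: pair_prob_space \<mu> "sph :: 'a measure" ..
interpretation mms: pair_prob_space "\<mu> \<Otimes>\<^sub>M \<mu>" "sph :: 'a measure" ..

lemma space_mu[simp]: "space \<mu> = UNIV"
  using sets_eq_imp_space_eq[OF sets_mu] by simp

lemma AE_mm_norm: "AE p in \<mu> \<Otimes>\<^sub>M \<mu>. norm (fst p) = 1 \<and> norm (snd p) = 1"
proof (rule mm.AE_pair_measure)
  show "{p \<in> space (\<mu> \<Otimes>\<^sub>M \<mu>). norm (fst p) = 1 \<and> norm (snd p) = 1} \<in> sets (\<mu> \<Otimes>\<^sub>M \<mu>)"
    by measurable
  show "AE x in \<mu>. AE y in \<mu>. norm (fst (x, y)) = 1 \<and> norm (snd (x, y)) = 1"
    using AE_mu_norm by eventually_elim (use AE_mu_norm in \<open>auto elim!: eventually_mono\<close>)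
qed

lemma AE_mms_norm: "AE p in (\<mu> \<Otimes>\<^sub>M \<mu>) \<Otimes>\<^sub>M (sph :: 'a measure). norm (fst (fst p)) = 1 \<and> norm (snd (fst p)) = 1 \<and> norm (snd p) = 1"
proof (rule mms.AE_pair_measure)
  show "{p \<in> space ((\<mu> \<Otimes>\<^sub>M \<mu>) \<Otimes>\<^sub>M (sph :: 'a measure)). norm (fst (fst p)) = 1 \<and> norm (snd (fst p)) = 1 \<and> norm (snd p) = 1} \<in> sets ((\<mu> \<Otimes>\<^sub>M \<mu>) \<Otimes>\<^sub>M (sph :: 'a measure))"
    by measurable
  show "AE p in \<mu> \<Otimes>\<^sub>M \<mu>. AE y in (sph :: 'a measure). norm (fst (fst (p, y))) = 1 \<and> norm (snd (fst (p, y))) = 1 \<and> norm (snd (p, y)) = 1"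
    using AE_mm_norm by eventually_elim (use AE_sph_norm in \<open>auto elim!: eventually_mono\<close>)
qed

lemma AE_ms_norm: "AE p in \<mu> \<Otimes>\<^sub>M (sph :: 'a measure). norm (fst p) = 1 \<and> norm (snd p) = 1"
proof (rule ms.AE_pair_measure)
  show "{p \<in> space (\<mu> \<Otimes>\<^sub>M (sph :: 'a measure)). norm (fst p) = 1 \<and> norm (snd p) = 1} \<in> sets (\<mu> \<Otimes>\<^sub>M (sph :: 'a measure))"
    by measurable
  show "AE x in \<mu>. AE y in (sph :: 'a measure). norm (fst (x, y)) = 1 \<and> norm (snd (x, y)) = 1"
    using AE_mu_norm by eventually_elim (use AE_sph_norm in \<open>auto elim!: eventually_mono\<close>)
qed

text \<open>The energy of \<open>\<mu>\<close> for the reproducing kernel of degree \<open>2 * n\<close>. As the kernel is idempotent, it equals the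
  squared \<open>L\<^sup>2\<close> norm of the potential (\<open>zonal_energy_eq\<close>).\<close>

definition zonal_energy :: "nat \<Rightarrow> real" where
  "zonal_energy n = (\<integral>p. poly (zonal_poly n) ((fst p \<bullet> snd p)\<^sup>2) \<partial>(\<mu> \<Otimes>\<^sub>M \<mu>))"

definition zonal_potential :: "nat \<Rightarrow> 'a \<Rightarrow> real" where
  "zonal_potential n w = (\<integral>x. poly (zonal_poly n) ((x \<bullet> w)\<^sup>2) \<partial>\<mu>)"

lemma zonal_poly_unit_abs_le: "norm (x::'a) = 1 \<Longrightarrow> norm y = 1 \<Longrightarrow> \<bar>poly (zonal_poly n) ((x \<bullet> y)\<^sup>2)\<bar> \<le> poly (zonal_poly n) 1"
  by (intro zonal_poly_abs_le abs_inner_unit_le)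

lemma integrable_zonal_poly_mm: "integrable (\<mu> \<Otimes>\<^sub>M \<mu>) (\<lambda>p. poly (zonal_poly n) ((fst p \<bullet> snd p)\<^sup>2))"
  by (rule mm.integrable_const_bound[where B="poly (zonal_poly n) 1"])
     (rule eventually_mono[OF AE_mm_norm], auto simp: zonal_poly_unit_abs_le)

lemma integrable_zonal_poly_mu: "norm w = 1 \<Longrightarrow> integrable \<mu> (\<lambda>x. poly (zonal_poly n) ((x \<bullet> w)\<^sup>2))"
  by (rule mu.integrable_const_bound[where B="poly (zonal_poly n) 1"])
     (rule eventually_mono[OF AE_mu_norm], auto simp: zonal_poly_unit_abs_le)

lemma zonal_potential_measurable[measurable]: "zonal_potential n \<in> borel_measurable borel"
  unfolding zonal_potential_def by measurable

lemma zonal_potential_abs_le: "norm w = 1 \<Longrightarrow> \<bar>zonal_potential n w\<bar> \<le> poly (zonal_poly n) 1"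
proof -
  assume w: "norm w = 1"
  have "\<bar>zonal_potential n w\<bar> \<le> (\<integral>x. \<bar>poly (zonal_poly n) ((x \<bullet> w)\<^sup>2)\<bar> \<partial>\<mu>)" unfolding zonal_potential_def by (rule integral_abs_bound)
  also have "\<dots> \<le> (\<integral>x. poly (zonal_poly n) 1 \<partial>\<mu>)"
    using integrable_zonal_poly_mu[OF w, of n] AE_mu_norm w zonal_poly_unit_abs_le
    by (intro integral_mono_AE) (auto elim!: eventually_mono)
  finally show ?thesis using mu.prob_space by simp
qed

lemma zonal_energy_eq: "zonal_energy n = (\<integral>w. (zonal_potential n w)\<^sup>2 \<partial>sph)"
proof -
  let ?F = "\<lambda>p w. poly (zonal_poly n) ((fst p \<bullet> w)\<^sup>2) * poly (zonal_poly n) ((snd p \<bullet> w)\<^sup>2)"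
  have int: "integrable ((\<mu> \<Otimes>\<^sub>M \<mu>) \<Otimes>\<^sub>M (sph :: 'a measure)) (case_prod ?F)"
  proof (rule mms.integrable_const_bound[where B="poly (zonal_poly n) 1 * poly (zonal_poly n) 1"])
    show "AE p in (\<mu> \<Otimes>\<^sub>M \<mu>) \<Otimes>\<^sub>M (sph :: 'a measure). norm (case_prod ?F p) \<le> poly (zonal_poly n) 1 * poly (zonal_poly n) 1"
      using AE_mms_norm by eventually_elim (auto simp: case_prod_beta' abs_mult intro!: mult_mono' zonal_poly_unit_abs_le)
  qed measurable
  have "zonal_energy n = (\<integral>p. (\<integral>w. ?F p w \<partial>sph) \<partial>(\<mu> \<Otimes>\<^sub>M \<mu>))"
    unfolding zonal_energy_def
  proof (rule integral_cong_AE)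
    show "AE p in \<mu> \<Otimes>\<^sub>M \<mu>. poly (zonal_poly n) ((fst p \<bullet> snd p)\<^sup>2) = (\<integral>w. ?F p w \<partial>sph)"
      using AE_mm_norm by eventually_elim (simp add: zonal_poly(2))
  qed measurable
  also have "\<dots> = (\<integral>w. (\<integral>p. ?F p w \<partial>(\<mu> \<Otimes>\<^sub>M \<mu>)) \<partial>sph)"
    using mms.Fubini_integral[OF int] by simp
  also have "\<dots> = (\<integral>w. (zonal_potential n w)\<^sup>2 \<partial>sph)"
  proof (rule integral_cong_AE)
    show "AE w in sph. (\<integral>p. ?F p w \<partial>(\<mu> \<Otimes>\<^sub>M \<mu>)) = (zonal_potential n w)\<^sup>2"
      using AE_sph_norm
    proof eventually_elim
      case (elim w)
      have "integrable (\<mu> \<Otimes>\<^sub>M \<mu>) (\<lambda>p. ?F p w)"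
      proof (rule mm.integrable_const_bound[where B="poly (zonal_poly n) 1 * poly (zonal_poly n) 1"])
        show "AE p in \<mu> \<Otimes>\<^sub>M \<mu>. norm (?F p w) \<le> poly (zonal_poly n) 1 * poly (zonal_poly n) 1"
          using AE_mm_norm by eventually_elim (auto simp: abs_mult elim intro!: mult_mono' zonal_poly_unit_abs_le)
      qed measurable
      from mm.integral_fst'[OF this] show ?case by (simp add: zonal_potential_def power2_eq_square)
    qed
  qed measurable
  finally show ?thesis .
qed

lemma zonal_energy_nonneg: "0 \<le> zonal_energy n"
  unfolding zonal_energy_eq by simp

lemma zonal_energy_0: "zonal_energy 0 = 1"
  using mm.prob_space by (simp add: zonal_energy_def zonal_poly_0)

lemma zonal_potential_eq_0: "zonal_energy n = 0 \<Longrightarrow> AE w in sph. zonal_potential n w = 0"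
proof -
  assume 0: "zonal_energy n = 0"
  have "integrable sph (\<lambda>w. (zonal_potential n w)\<^sup>2)"
  proof (rule sph.integrable_const_bound[where B="(poly (zonal_poly n) 1)\<^sup>2"])
    show "AE w in sph. norm ((zonal_potential n w)\<^sup>2) \<le> (poly (zonal_poly n) 1)\<^sup>2"
      using AE_sph_norm
    proof eventually_elim
      case (elim w)
      show ?case using zonal_potential_abs_le[OF elim, of n] by (simp add: abs_le_square_iff[symmetric])
    qed
  qed measurable
  then have "AE w in sph. (zonal_potential n w)\<^sup>2 = 0"
    using 0 unfolding zonal_energy_eq by (subst (asm) integral_nonneg_eq_0_iff_AE) auto
  then show ?thesis by simp
qed

lemma peak_poly_expansion: "poly (peak_poly m) (t\<^sup>2) = (\<Sum>n\<le>m. eigenvalue (\<lambda>t. poly (peak_poly m) (t\<^sup>2)) n * poly (zonal_poly n) (t\<^sup>2))"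
proof -
  have "degree (peak_poly m) \<le> m" unfolding peak_poly_def by (rule degree_monom_le)
  from arg_cong[OF zonal_poly_expansion[OF this], of "\<lambda>p. poly p (t\<^sup>2)"] show ?thesis
    by (simp add: poly_sum)
qed

lemma peak_poly_convolution:
  assumes k: "zonal_kernel k" and x: "norm x = 1" and y: "norm (y::'a) = 1"
  shows "(\<integral>z. poly (peak_poly m) ((x \<bullet> z)\<^sup>2) * k (y \<bullet> z) \<partial>sph)
     = (\<Sum>n\<le>m. eigenvalue (\<lambda>t. poly (peak_poly m) (t\<^sup>2)) n * eigenvalue k n * poly (zonal_poly n) ((x \<bullet> y)\<^sup>2))"
proof -
  have int: "integrable sph (\<lambda>z. k (y \<bullet> z) * poly (zonal_poly n) ((x \<bullet> z)\<^sup>2))" for n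
    by (rule zonal_kernel_mult_poly[OF k y x])
  have "(\<integral>z. poly (peak_poly m) ((x \<bullet> z)\<^sup>2) * k (y \<bullet> z) \<partial>sph)
    = (\<integral>z. (\<Sum>n\<le>m. eigenvalue (\<lambda>t. poly (peak_poly m) (t\<^sup>2)) n * (k (y \<bullet> z) * poly (zonal_poly n) ((x \<bullet> z)\<^sup>2))) \<partial>sph)"
    by (intro Bochner_Integration.integral_cong refl) (subst peak_poly_expansion, simp add: sum_distrib_left mult_ac)
  also have "\<dots> = (\<Sum>n\<le>m. eigenvalue (\<lambda>t. poly (peak_poly m) (t\<^sup>2)) n * (eigenvalue k n * poly (zonal_poly n) ((y \<bullet> x)\<^sup>2)))"
    using int by (subst Bochner_Integration.integral_sum) (simp_all add: eigenvalue_eigen[OF k y x])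
  finally show ?thesis by (simp add: inner_commute mult_ac)
qed

text \<open>Convolving \<open>k\<close> with the polynomial approximate identity gives a finite combination of zonal polynomials with
  coefficients \<open>\<beta>\<^sub>m\<^sub>n * eigenvalue k n\<close>, where \<open>0 \<le> \<beta>\<^sub>m\<^sub>n\<close> and \<open>\<beta>\<^sub>m\<^sub>n \<longlonglongrightarrow> 1\<close>. Its energy is at least the
  contribution of the degrees 0 and \<open>2 * n\<close>. As \<open>m\<close> tends to infinity, the convolutions converge to \<open>k\<close>
  off the diagonal and are dominated by \<open>C * k\<close> (\<open>A1\<close>), so their energies converge to that of \<open>k\<close>.\<close>

lemma energy_lower_bound:
  assumes k: "zonal_kernel k" and kcont: "\<And>t. \<bar>t\<bar> < 1 \<Longrightarrow> isCont k t"
    and A1: "\<And>m (x::'a) y. norm x = 1 \<Longrightarrow> norm y = 1 \<Longrightarrow> \<bar>x \<bullet> y\<bar> < 1 \<Longrightarrow>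
       \<bar>\<integral>z. poly (peak_poly m) ((x \<bullet> z)\<^sup>2) * k (y \<bullet> z) \<partial>sph\<bar> \<le> C * k (x \<bullet> y)"
    and eigenvalue: "\<And>n. n \<ge> 1 \<Longrightarrow> 0 \<le> eigenvalue k n"
    and diag: "AE p in \<mu> \<Otimes>\<^sub>M \<mu>. \<bar>fst p \<bullet> snd p\<bar> < 1"
    and int: "integrable (\<mu> \<Otimes>\<^sub>M \<mu>) (\<lambda>p. k (fst p \<bullet> snd p))" and n: "n \<ge> 1"
  shows "eigenvalue k 0 + eigenvalue k n * zonal_energy n \<le> (\<integral>p. k (fst p \<bullet> snd p) \<partial>(\<mu> \<Otimes>\<^sub>M \<mu>))"
proof -
  note [measurable] = zonal_kernel_measurable[OF k]
  let ?b = "\<lambda>m n. eigenvalue (\<lambda>t. poly (peak_poly m) (t\<^sup>2)) n"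
  let ?s = "\<lambda>m p. (\<Sum>n\<le>m. ?b m n * eigenvalue k n * poly (zonal_poly n) ((fst p \<bullet> snd p)\<^sup>2))"
  have keven: "k (- t) = k t" for t using k by (simp add: zonal_kernel_def)
  have "(\<lambda>m. \<integral>p. ?s m p \<partial>(\<mu> \<Otimes>\<^sub>M \<mu>)) \<longlonglongrightarrow> (\<integral>p. k (fst p \<bullet> snd p) \<partial>(\<mu> \<Otimes>\<^sub>M \<mu>))"
  proof (rule integral_dominated_convergence[where w="\<lambda>p. C * k (fst p \<bullet> snd p)"])
    show "integrable (\<mu> \<Otimes>\<^sub>M \<mu>) (\<lambda>p. C * k (fst p \<bullet> snd p))" using int by simp
    show "AE p in \<mu> \<Otimes>\<^sub>M \<mu>. (\<lambda>m. ?s m p) \<longlonglongrightarrow> k (fst p \<bullet> snd p)"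
      using AE_mm_norm diag
    proof eventually_elim
      case (elim p)
      have "(\<lambda>m. \<integral>z. poly (peak_poly m) ((fst p \<bullet> z)\<^sup>2) * k (snd p \<bullet> z) \<partial>sph) \<longlonglongrightarrow> k (snd p \<bullet> fst p)"
      proof (rule peak_poly_approx_identity)
        show "integrable sph (\<lambda>z. k (snd p \<bullet> z))" using elim by (intro zonal_kernel_integrable[OF k]) simp
        have c1: "isCont (\<lambda>z. snd p \<bullet> z) (fst p)" by (intro continuous_intros)
        have c2: "isCont k (snd p \<bullet> fst p)" using elim by (intro kcont) (simp add: inner_commute)
        show "isCont (\<lambda>z. k (snd p \<bullet> z)) (fst p)" by (rule isCont_o2[OF c1 c2])
      qed (use elim keven in auto)
      then show ?case
        using peak_poly_convolution[OF k, of "fst p" "snd p"] elim by (simp add: inner_commute[of "snd p" "fst p"])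
    qed
    show "AE p in \<mu> \<Otimes>\<^sub>M \<mu>. norm (?s m p) \<le> C * k (fst p \<bullet> snd p)" for m
      using AE_mm_norm diag
    proof eventually_elim
      case (elim p)
      then show ?case using A1[of "fst p" "snd p" m] by (simp add: peak_poly_convolution[OF k])
    qed
  qed measurable
  moreover have "(\<integral>p. ?s m p \<partial>(\<mu> \<Otimes>\<^sub>M \<mu>)) = (\<Sum>n\<le>m. ?b m n * eigenvalue k n * zonal_energy n)" for m
    unfolding zonal_energy_def using integrable_zonal_poly_mm by (subst Bochner_Integration.integral_sum) auto
  ultimately have lim: "(\<lambda>m. \<Sum>n\<le>m. ?b m n * eigenvalue k n * zonal_energy n) \<longlonglongrightarrow> (\<integral>p. k (fst p \<bullet> snd p) \<partial>(\<mu> \<Otimes>\<^sub>M \<mu>))"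
    by simp
  have lim': "(\<lambda>m. eigenvalue k 0 + ?b m n * eigenvalue k n * zonal_energy n) \<longlonglongrightarrow> eigenvalue k 0 + 1 * eigenvalue k n * zonal_energy n"
    by (intro tendsto_intros eigenvalue_peak_poly_tendsto_1)
  have "\<forall>\<^sub>F m in sequentially. eigenvalue k 0 + ?b m n * eigenvalue k n * zonal_energy n \<le> (\<Sum>n\<le>m. ?b m n * eigenvalue k n * zonal_energy n)"
    using eventually_ge_at_top[of n]
  proof eventually_elim
    case (elim m)
    have "(\<Sum>i\<in>{0, n}. ?b m i * eigenvalue k i * zonal_energy i) \<le> (\<Sum>n\<le>m. ?b m n * eigenvalue k n * zonal_energy n)"
    proof (rule sum_mono2)
      fix i assume "i \<in> {..m} - {0, n}"
      then show "0 \<le> ?b m i * eigenvalue k i * zonal_energy i"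
        using eigenvalue[of i] eigenvalue_peak_poly_nonneg[of m i] zonal_energy_nonneg[of i] by simp
    qed (use elim in auto)
    then show ?case using n by (simp add: eigenvalue_peak_poly_0 zonal_energy_0)
  qed
  from tendsto_le[OF _ lim lim' this] show ?thesis by simp
qed

text \<open>If all nonconstant zonal energies vanish, then so do the zonal potentials, and the convolution of \<open>\<mu>\<close> with each
  kernel of the approximate identity is the constant 1.\<close>

lemma integral_eq_uniform:
  fixes f :: "'a \<Rightarrow> real"
  assumes z: "\<And>n. n \<ge> 1 \<Longrightarrow> zonal_energy n = 0"
    and f: "continuous_on UNIV f" and even: "\<And>x::'a. f (- x) = f x" and B: "\<And>x. \<bar>f x\<bar> \<le> B"
  shows "(\<integral>x. f x \<partial>\<mu>) = (\<integral>x. f x \<partial>sph)"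
proof -
  have [measurable]: "f \<in> borel_measurable borel" using f by (rule borel_measurable_continuous_onI)
  have intf: "integrable sph f" by (rule sph.integrable_const_bound[where B=B]) (use B in auto)
  let ?q = "\<lambda>m x z. poly (peak_poly m) ((x \<bullet> z)\<^sup>2)"
  have lim: "(\<lambda>m. \<integral>x. (\<integral>z. ?q m x z * f z \<partial>sph) \<partial>\<mu>) \<longlonglongrightarrow> (\<integral>x. f x \<partial>\<mu>)"
  proof (rule integral_dominated_convergence[where w="\<lambda>x. B"])
    show "AE x in \<mu>. (\<lambda>m. \<integral>z. ?q m x z * f z \<partial>sph) \<longlonglongrightarrow> f x"
      using AE_mu_norm
    proof eventually_elim
      case (elim x)
      show ?case
        by (rule peak_poly_approx_identity) (use intf even f elim in \<open>auto simp: continuous_on_eq_continuous_at\<close>)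
    qed
    show "AE x in \<mu>. norm (\<integral>z. ?q m x z * f z \<partial>sph) \<le> B" for m
      using AE_mu_norm
    proof eventually_elim
      case (elim x)
      have "\<bar>\<integral>z. ?q m x z * f z \<partial>sph\<bar> \<le> (\<integral>z. \<bar>?q m x z * f z\<bar> \<partial>sph)" by (rule integral_abs_bound)
      also have "\<dots> \<le> (\<integral>z. B * ?q m x z \<partial>sph)"
      proof (rule integral_mono)
        have "integrable sph (\<lambda>z. ?q m x z * f z)"
          by (rule integrable_mult_bounded[where B=B]) (use B poly_sq_integrable[OF elim] in auto)
        then show "integrable sph (\<lambda>z. \<bar>?q m x z * f z\<bar>)" by simp
        show "integrable sph (\<lambda>z. B * ?q m x z)" using poly_sq_integrable[OF elim] by simp
        fix z
        have "?q m x z * \<bar>f z\<bar> \<le> ?q m x z * B" using B by (intro mult_left_mono peak_poly_nonneg)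
        then show "\<bar>?q m x z * f z\<bar> \<le> B * ?q m x z" by (simp add: abs_mult peak_poly_nonneg mult.commute)
      qed
      also have "\<dots> = B" using zonal_mean_eq[OF elim, of "peak_poly m"] zonal_mean_peak_poly[of m] by simp
      finally show ?case by simp
    qed
  qed measurable
  have "(\<integral>x. (\<integral>z. ?q m x z * f z \<partial>sph) \<partial>\<mu>) = (\<integral>x. f x \<partial>sph)" for m
  proof -
    obtain Bq where Bq: "\<forall>t. \<bar>t\<bar> \<le> 1 \<longrightarrow> \<bar>poly (peak_poly m) (t\<^sup>2)\<bar> \<le> Bq" using poly_sq_bound[of "peak_poly m"] by auto
    have int: "integrable (\<mu> \<Otimes>\<^sub>M (sph :: 'a measure)) (case_prod (\<lambda>x z. ?q m x z * f z))"
    proof (rule ms.integrable_const_bound[where B="Bq * B"])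
      show "AE p in \<mu> \<Otimes>\<^sub>M (sph :: 'a measure). norm (case_prod (\<lambda>x z. ?q m x z * f z) p) \<le> Bq * B"
        using AE_ms_norm
      proof eventually_elim
        case (elim p)
        then have "\<bar>?q m (fst p) (snd p)\<bar> \<le> Bq" using Bq abs_inner_unit_le by blast
        then show ?case using B[of "snd p"] by (auto simp: case_prod_beta' abs_mult intro!: mult_mono')
      qed
    qed measurable
    have "(\<integral>x. (\<integral>z. ?q m x z * f z \<partial>sph) \<partial>\<mu>) = (\<integral>z. (\<integral>x. ?q m x z * f z \<partial>\<mu>) \<partial>sph)"
      using ms.Fubini_integral[OF int] by simp
    also have "\<dots> = (\<integral>z. f z \<partial>sph)"
    proof (rule integral_cong_AE)
      have "AE z in sph. \<forall>n\<in>{1..m}. zonal_potential n z = 0"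
        using zonal_potential_eq_0 z by (intro AE_finite_allI) auto
      then show "AE z in sph. (\<integral>x. ?q m x z * f z \<partial>\<mu>) = f z"
        using AE_sph_norm
      proof eventually_elim
        case (elim w)
        have "(\<integral>x. ?q m x w \<partial>\<mu>) = (\<integral>x. (\<Sum>n\<le>m. eigenvalue (\<lambda>t. poly (peak_poly m) (t\<^sup>2)) n * poly (zonal_poly n) ((x \<bullet> w)\<^sup>2)) \<partial>\<mu>)"
          by (subst peak_poly_expansion) simp
        also have "\<dots> = (\<Sum>n\<le>m. eigenvalue (\<lambda>t. poly (peak_poly m) (t\<^sup>2)) n * zonal_potential n w)"
          unfolding zonal_potential_def using integrable_zonal_poly_mu[OF elim(2)] by (subst Bochner_Integration.integral_sum) auto
        also have "\<dots> = (\<Sum>n\<in>{0}. eigenvalue (\<lambda>t. poly (peak_poly m) (t\<^sup>2)) n * zonal_potential n w)"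
          using elim(1) by (intro sum.mono_neutral_right) auto
        also have "\<dots> = 1" using mu.prob_space by (simp add: eigenvalue_peak_poly_0 zonal_potential_def zonal_poly_0)
        finally show ?case by simp
      qed
    qed measurable
    finally show ?thesis .
  qed
  with lim have "(\<lambda>m. \<integral>x. f x \<partial>sph) \<longlonglongrightarrow> (\<integral>x. f x \<partial>\<mu>)" by simp
  then show ?thesis by (simp add: LIMSEQ_const_iff)
qed

end

section \<open>The profile of the angle kernel\<close>

lemma x_cos_less_sin: "0 < x \<Longrightarrow> x \<le> pi / 2 \<Longrightarrow> x * cos x < sin (x::real)"
proof -
  assume x: "0 < x" "x \<le> pi / 2"
  have "(\<lambda>x. sin x - x * cos x) 0 < (\<lambda>x. sin x - x * cos x) x"
  proof (rule DERIV_pos_imp_increasing_open[OF x(1)])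
    fix y assume y: "0 < y" "y < x"
    have "((\<lambda>x. sin x - x * cos x) has_real_derivative (y * sin y)) (at y)"
      by (auto intro!: derivative_eq_intros)
    moreover have "0 < y * sin y" using y x by (intro mult_pos_pos sin_gt_zero) auto
    ultimately show "\<exists>z. ((\<lambda>x. sin x - x * cos x) has_real_derivative z) (at y) \<and> 0 < z" by blast
  qed (auto intro!: continuous_intros)
  then show ?thesis by simp
qed

text \<open>With \<open>\<theta> = arccos t\<close> the chord is \<open>2 * sin (\<theta> / 2)\<close>; the last bound is \<open>x * cos x < sin x\<close> together with
  \<open>cos (\<theta> / 2) \<ge> 1/2\<close>.\<close>

lemma arccos_chord_bounds:
  assumes "0 \<le> t" "t < 1"
  shows "0 < arccos t" "arccos t \<le> pi / 2" "sqrt (2 - 2 * t) \<le> arccos t" "arccos t \<le> 2 * sqrt (2 - 2 * t)"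
proof -
  define \<theta> where "\<theta> = arccos t"
  have th: "0 < \<theta>" "\<theta> \<le> pi / 2" and ct: "cos \<theta> = t"
    using assms arccos_lt_bounded[of t] arccos_le_pi2[of t] by (auto simp: \<theta>_def)
  have s0: "0 \<le> sin (\<theta> / 2)" using th by (intro sin_ge_zero) auto
  have "2 - 2 * t = (2 * sin (\<theta> / 2))\<^sup>2"
    using cos_double_sin[of "\<theta> / 2"] by (simp add: ct[symmetric] power_mult_distrib)
  then have "sqrt (2 - 2 * t) = \<bar>2 * sin (\<theta> / 2)\<bar>" by (simp only: real_sqrt_abs)
  then have r: "sqrt (2 - 2 * t) = 2 * sin (\<theta> / 2)" using s0 by simp
  have "sin (\<theta> / 2) \<le> \<theta> / 2" using th by (intro sin_x_le_x) auto
  then show "sqrt (2 - 2 * t) \<le> arccos t" unfolding r \<theta>_def[symmetric] by simp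
  have "cos (pi / 3) \<le> cos (\<theta> / 2)" using th by (subst cos_mono_le_eq) auto
  then have "\<theta> / 2 * (1 / 2) \<le> \<theta> / 2 * cos (\<theta> / 2)" using th by (intro mult_left_mono) (auto simp: cos_60)
  also have "\<dots> \<le> sin (\<theta> / 2)" using x_cos_less_sin[of "\<theta> / 2"] th by simp
  finally show "arccos t \<le> 2 * sqrt (2 - 2 * t)" unfolding r \<theta>_def[symmetric] by simp
  show "0 < arccos t" "arccos t \<le> pi / 2" using th by (auto simp: \<theta>_def)
qed

text \<open>Since the dimension of the sphere is \<open>DIM('a) - 1 \<ge> 2\<close>, the exponent is never positive, and it is 0 only on the
  two-dimensional sphere.\<close>

locale angle_profile = sphere_dim dummy for dummy :: "'a::euclidean_space itself" +
  fixes l :: real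
  assumes DIM3: "DIM('a) \<ge> 3" and l: "- real (DIM('a) - 1) < l" "l \<le> - real (DIM('a) - 1) + 2"
begin

lemma l_nonpos: "l \<le> 0" using l DIM3 by simp

text \<open>Adding \<open>ln 4\<close> to the logarithmic kernel makes it positive and does not affect the minimisers. The value of \<open>h\<close> at 1 is
  arbitrary: the diagonal is a null set whenever an energy is finite. The constant \<open>L\<close> is
  chosen such that \<open>- L * \<theta> powr (l - 1)\<close> is the derivative of \<open>f\<close> in both cases.\<close>

definition L :: real where "L = (if l = 0 then 1 else - l)"
definition f :: "real \<Rightarrow> real" where "f \<theta> = (if l = 0 then ln (4 / \<theta>) else \<theta> powr l)"
definition h :: "real \<Rightarrow> real" where "h t = (if t < 1 then f (arccos t) else 0)"
definition h' :: "real \<Rightarrow> real" where "h' t = (if t < 1 then L * arccos t powr (l - 1) / sqrt (1 - t\<^sup>2) else 0)"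
definition h'' :: "real \<Rightarrow> real" where
  "h'' t = L * ((1 - l) * arccos t powr (l - 2) / (1 - t\<^sup>2) + arccos t powr (l - 1) * t / (sqrt (1 - t\<^sup>2)) ^ 3)"
definition majorant :: "real \<Rightarrow> real" where "majorant r = (if l = 0 then ln (4 / r) else r powr l)"

lemma L: "0 < L" using l_nonpos by (auto simp: L_def)

lemma one_minus_sq: "- 1 < t \<Longrightarrow> t < 1 \<Longrightarrow> 0 < 1 - (t::real)\<^sup>2"
  by (simp add: abs_square_less_1 abs_less_iff)

lemma arccos_pos: "- 1 < t \<Longrightarrow> t < 1 \<Longrightarrow> 0 < arccos t"
  using arccos_lt_bounded[of t] by simp

lemma h_deriv: assumes t: "- 1 < t" "t < 1" shows "(h has_real_derivative h' t) (at t)"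
proof -
  have w: "0 < sqrt (1 - t\<^sup>2)" using one_minus_sq[OF t] by simp
  have th: "0 < arccos t" by (rule arccos_pos[OF t])
  have "((\<lambda>t. f (arccos t)) has_real_derivative h' t) (at t)"
  proof (cases "l = 0")
    case True
    have "((\<lambda>t. ln 4 - ln (arccos t)) has_real_derivative - (1 / arccos t * inverse (- sqrt (1 - t\<^sup>2)))) (at t)"
      using t th by (auto intro!: derivative_eq_intros DERIV_arccos simp: divide_inverse)
    moreover have "h' t = - (1 / arccos t * inverse (- sqrt (1 - t\<^sup>2)))"
      unfolding h'_def L_def using True t th by (simp add: powr_minus divide_inverse)
    ultimately have d: "((\<lambda>t. ln 4 - ln (arccos t)) has_real_derivative h' t) (at t)" by (simp only:)
    show ?thesis
    proof (rule DERIV_cong_ev[THEN iffD1, OF refl _ refl d])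
      have "\<forall>\<^sub>F x in nhds t. x \<in> {-1<..<1}" using t by (intro eventually_nhds_in_open) auto
      then show "\<forall>\<^sub>F x in nhds t. ln 4 - ln (arccos x) = f (arccos x)"
      proof eventually_elim
        case (elim x)
        then have "0 < arccos x" by (intro arccos_pos) auto
        then show ?case unfolding f_def using True by (simp add: ln_div)
      qed
    qed
  next
    case False
    have "((\<lambda>t. arccos t powr l) has_real_derivative (l * arccos t powr (l - 1) * inverse (- sqrt (1 - t\<^sup>2)))) (at t)"
      by (rule DERIV_chain2[OF has_real_derivative_powr[OF th] DERIV_arccos[OF t]])
    then show ?thesis
      using w t False by (simp add: f_def h'_def L_def divide_inverse)
  qed
  moreover have "\<forall>\<^sub>F x in nhds t. f (arccos x) = h x"
  proof -
    have "\<forall>\<^sub>F x in nhds t. x \<in> {..<1}" using t by (intro eventually_nhds_in_open) auto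
    then show ?thesis by eventually_elim (simp add: h_def)
  qed
  ultimately show ?thesis by (rule DERIV_cong_ev[THEN iffD1, OF refl _ refl, rotated])
qed

lemma h'_deriv: assumes t: "0 < t" "t < 1" shows "(h' has_real_derivative h'' t) (at t)"
proof -
  have t': "-1 < t" using t by simp
  define w where "w = sqrt (1 - t\<^sup>2)"
  have w: "0 < w" "w\<^sup>2 = 1 - t\<^sup>2" using one_minus_sq[OF t' t(2)] by (simp_all add: w_def)
  have th: "0 < arccos t" by (rule arccos_pos[OF t' t(2)])
  have 1: "((\<lambda>t. arccos t powr (l - 1)) has_real_derivative ((l - 1) * arccos t powr (l - 1 - 1) * inverse (- sqrt (1 - t\<^sup>2)))) (at t)"
    by (rule DERIV_chain2[OF has_real_derivative_powr[OF th] DERIV_arccos[OF t' t(2)]])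
  have 2: "((\<lambda>t. sqrt (1 - t\<^sup>2)) has_real_derivative (- t / w)) (at t)"
  proof -
    have "((\<lambda>t. 1 - t\<^sup>2) has_real_derivative (- 2 * t)) (at t)" by (auto intro!: derivative_eq_intros)
    from DERIV_chain2[OF DERIV_real_sqrt[OF one_minus_sq[OF t' t(2)]] this]
    have "((\<lambda>t. sqrt (1 - t\<^sup>2)) has_real_derivative (inverse w / 2 * (- 2 * t))) (at t)" by (simp only: w_def)
    moreover have "inverse w / 2 * (- 2 * t) = - t / w" using w(1) by (simp add: field_simps)
    ultimately show ?thesis by (simp only:)
  qed
  have 3: "((\<lambda>t. L * (arccos t powr (l - 1) / sqrt (1 - t\<^sup>2))) has_real_derivative
     L * (((l - 1) * arccos t powr (l - 1 - 1) * inverse (- w) * w - arccos t powr (l - 1) * (- t / w)) / (w * w))) (at t)"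
    using DERIV_cmult[OF DERIV_divide[OF 1 2], of L] w by (simp add: w_def)
  have "L * (((l - 1) * arccos t powr (l - 1 - 1) * inverse (- w) * w - arccos t powr (l - 1) * (- t / w)) / (w * w))
     = h'' t"
    unfolding h''_def w(2)[symmetric] w_def[symmetric] using w(1)
    by (simp add: power2_eq_square power3_eq_cube field_simps)
  with 3 have "((\<lambda>t. L * (arccos t powr (l - 1) / sqrt (1 - t\<^sup>2))) has_real_derivative h'' t) (at t)" by simp
  moreover have "\<forall>\<^sub>F x in nhds t. L * (arccos x powr (l - 1) / sqrt (1 - x\<^sup>2)) = h' x"
  proof -
    have "\<forall>\<^sub>F x in nhds t. x \<in> {..<1}" using t by (intro eventually_nhds_in_open) auto
    then show ?thesis by eventually_elim (simp add: h'_def)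
  qed
  ultimately show ?thesis by (rule DERIV_cong_ev[THEN iffD1, OF refl _ refl, rotated])
qed

lemma h'_nonneg: "0 \<le> t \<Longrightarrow> t < 1 \<Longrightarrow> 0 \<le> h' t"
  using L one_minus_sq[of t] by (simp add: h'_def)

lemma h'_mono: assumes "0 \<le> a" "a \<le> b" "b < 1" shows "h' a \<le> h' b"
proof -
  have th: "0 < arccos b" "arccos b \<le> arccos a" using assms arccos_le_mono[of b a] by (auto intro: arccos_pos)
  have p: "arccos a powr (l - 1) \<le> arccos b powr (l - 1)"
    using th l_nonpos by (intro powr_mono2') auto
  have "a\<^sup>2 \<le> b\<^sup>2" using assms by (intro power_mono) auto
  then have w: "sqrt (1 - b\<^sup>2) \<le> sqrt (1 - a\<^sup>2)" by simp
  have "0 < sqrt (1 - b\<^sup>2)" using one_minus_sq[of b] assms by simp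
  then have "L * arccos a powr (l - 1) / sqrt (1 - a\<^sup>2) \<le> L * arccos b powr (l - 1) / sqrt (1 - b\<^sup>2)"
    using p w L by (intro frac_le mult_left_mono) auto
  then show ?thesis using assms by (simp add: h'_def)
qed

lemma h_tangent: assumes "0 < t" "t < 1" "0 \<le> s" "s < 1" shows "h t + h' t * (s - t) \<le> h s"
proof -
  consider "s < t" | "s = t" | "t < s" by linarith
  then show ?thesis
  proof cases
    case 1
    then obtain z where z: "s < z" "z < t" "h t - h s = (t - s) * h' z"
      using MVT2[of s t h h'] h_deriv assms by auto
    have "h' z \<le> h' t" using z assms by (intro h'_mono) auto
    then have "(t - s) * h' z \<le> (t - s) * h' t" using 1 by (intro mult_left_mono) auto
    then show ?thesis using z(3) by (simp add: algebra_simps)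
  next
    case 3
    then obtain z where z: "t < z" "z < s" "h s - h t = (s - t) * h' z"
      using MVT2[of t s h h'] h_deriv assms by auto
    have "h' t \<le> h' z" using z assms by (intro h'_mono) auto
    then have "(s - t) * h' t \<le> (s - t) * h' z" using 3 by (intro mult_left_mono) auto
    then show ?thesis using z(3) by (simp add: algebra_simps)
  qed simp
qed

text \<open>With \<open>\<theta> = arccos t\<close> and \<open>d = DIM('a) - 1\<close> the expression equals
  \<open>L * \<theta> powr (l - 2) * ((1 - l) - (d - 1) * \<theta> * cot \<theta>)\<close>. It is positive because \<open>\<theta> * cot \<theta> < 1\<close> and
  \<open>l \<le> 2 - d\<close>; this is where the upper bound on the exponent enters.\<close>

lemma h_subharmonic:
  assumes t: "0 < t" "t < 1"
  shows "0 < (1 - t\<^sup>2) * h'' t - real (DIM('a) - 1) * t * h' t"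
proof -
  define d where "d = real (DIM('a) - 1)"
  have d: "d \<ge> 2" using DIM3 by (simp add: d_def)
  define w where "w = sqrt (1 - t\<^sup>2)"
  define \<theta> where "\<theta> = arccos t"
  have w: "0 < w" "w\<^sup>2 = 1 - t\<^sup>2" using one_minus_sq[of t] t by (simp_all add: w_def)
  have th: "0 < \<theta>" "\<theta> \<le> pi / 2" using arccos_chord_bounds(1,2)[of t] t by (auto simp: \<theta>_def)
  have "\<theta> * cos \<theta> < sin \<theta>" by (rule x_cos_less_sin[OF th])
  then have tw: "\<theta> * t < w" using t by (simp add: \<theta>_def w_def sin_arccos)
  have p: "\<theta> powr (l - 1) = \<theta> powr (l - 2) * \<theta>"
    using th powr_add[of \<theta> "l - 2" 1] by (simp add: add.commute)
  have "(1 - t\<^sup>2) * h'' t - d * t * h' t = L * \<theta> powr (l - 2) * ((1 - l) - (d - 1) * (\<theta> * t / w))"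
    unfolding h''_def h'_def w(2)[symmetric] w_def[symmetric] \<theta>_def[symmetric] p using w(1) t
    by (simp add: power2_eq_square power3_eq_cube field_simps)
  moreover have "(d - 1) * (\<theta> * t / w) < (d - 1) * 1" using tw w d by (intro mult_strict_left_mono) (auto simp: field_simps)
  then have "0 < (1 - l) - (d - 1) * (\<theta> * t / w)" using l(2) by (simp add: d_def)
  then have "0 < L * \<theta> powr (l - 2) * ((1 - l) - (d - 1) * (\<theta> * t / w))" using L th by simp
  ultimately show ?thesis by (simp add: d_def)
qed

text \<open>For a power kernel, the lower bound \<open>- d < l\<close> on the exponent is exactly what makes this smaller than \<open>2 ^ d\<close>, where \<open>d = DIM('a) - 1\<close>.\<close>

definition D :: real where "D = (if l = 0 then 2 else 2 powr (- l))"

lemma majorant_doubling_profile: "doubling_profile TYPE('a) majorant D"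
proof
  show "majorant \<in> borel_measurable borel" unfolding majorant_def by measurable
  show "0 \<le> majorant r" if "0 < r" "r \<le> 2" for r using that by (auto simp: majorant_def intro!: ln_ge_zero)
  show "majorant s \<le> majorant r" if "0 < r" "r \<le> s" "s \<le> 2" for r s
    using that l_nonpos by (auto simp: majorant_def frac_le intro!: powr_mono2')
  show "majorant (r / 2) \<le> D * majorant r" if r: "0 < r" "r \<le> 2" for r
  proof (cases "l = 0")
    case True
    have "ln (4 / (r / 2)) = ln (2 * (4 / r))" by simp
    also have "\<dots> = ln 2 + ln (4 / r)" using r by (intro ln_mult_pos) auto
    finally have "ln (4 / (r / 2)) = ln 2 + ln (4 / r)" .
    moreover have "ln 2 \<le> ln (4 / r)" using r by (simp add: field_simps)
    ultimately show ?thesis unfolding majorant_def D_def using True by simp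
  next
    case False
    have "(r / 2) powr l = r powr l / 2 powr l" by (rule powr_divide)
    moreover have "2 powr (- l) = 1 / 2 powr l" by (rule powr_minus_divide)
    ultimately show ?thesis unfolding majorant_def D_def using False by simp
  qed
  show "0 \<le> D" by (simp add: D_def)
  have "2 powr (- l) < 2 powr real (DIM('a) - 1)" using l by (intro powr_less_mono) auto
  also have "\<dots> = 2 ^ (DIM('a) - 1)" by (rule powr_realpow) simp
  finally have "2 powr (- l) < 2 ^ (DIM('a) - 1)" .
  moreover have "(2::real) ^ 1 < 2 ^ (DIM('a) - 1)" using DIM3 by (intro power_strict_increasing) auto
  ultimately show "D < 2 ^ (DIM('a) - 1)" unfolding D_def by (cases "l = 0") simp_all
qed

sublocale doubling_profile dummy majorant D
  using majorant_doubling_profile by (simp add: doubling_profile_def doubling_profile_axioms_def sphere_dim_def)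

text \<open>The profile is comparable to \<open>majorant\<close> of the chord, for which the convolution bound is known. The last estimate is the
  integrability required of \<open>h'\<close> in \<open>eigenvalue_pos\<close>.\<close>

lemma majorant_compare:
  assumes "0 \<le> t" "t < 1"
  shows "0 \<le> h t" "h t \<le> majorant (sqrt (2 - 2 * t))" "majorant (sqrt (2 - 2 * t)) \<le> D * h t"
    "h' t * (1 - t) \<le> L * (h t + 1)"
proof -
  define \<theta> where "\<theta> = arccos t"
  define r where "r = sqrt (2 - 2 * t)"
  have th: "0 < \<theta>" "\<theta> \<le> pi / 2" "r \<le> \<theta>" "\<theta> \<le> 2 * r"
    using arccos_chord_bounds[OF assms] by (auto simp: \<theta>_def r_def)
  have r: "0 < r" using assms by (simp add: r_def)
  have th2: "\<theta> < 2" using th(2) pi_less_4 by simp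
  have h: "h t = f \<theta>" using assms by (simp add: h_def \<theta>_def)
  have ln2: "ln 2 \<le> ln (4 / \<theta>)" using th(1) th2 by (simp add: field_simps)
  have ln20: "0 < ln (2::real)" by simp
  have "0 \<le> ln (4 / \<theta>)" using ln2 ln20 by linarith
  then show h0: "0 \<le> h t" unfolding h f_def by simp
  show "h t \<le> majorant r" unfolding h f_def majorant_def using th r l_nonpos by (auto simp: frac_le intro!: powr_mono2')
  show "majorant r \<le> D * h t"
  proof (cases "l = 0")
    case True
    have "ln (4 / r) \<le> ln (2 * (4 / \<theta>))" using th r by (intro ln_mono) (auto simp: field_simps)
    also have "\<dots> = ln 2 + ln (4 / \<theta>)" using th by (intro ln_mult_pos) auto
    finally show ?thesis unfolding h majorant_def D_def f_def using True ln2 by simp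
  next
    case False
    have "r powr l \<le> (\<theta> / 2) powr l" using th l_nonpos by (intro powr_mono2') auto
    moreover have "(\<theta> / 2) powr l = \<theta> powr l / 2 powr l" by (rule powr_divide)
    moreover have "2 powr (- l) = 1 / 2 powr l" by (rule powr_minus_divide)
    ultimately show ?thesis unfolding h majorant_def D_def f_def using False by simp
  qed
  have w: "0 < sqrt (1 - t\<^sup>2)" using one_minus_sq[of t] assms by simp
  have "(1 - t)\<^sup>2 \<le> \<theta>\<^sup>2 * (1 - t\<^sup>2)"
  proof -
    have "r\<^sup>2 \<le> \<theta>\<^sup>2" using th r by (intro power_mono) auto
    then have "1 - t \<le> \<theta>\<^sup>2" using assms by (simp add: r_def)
    moreover have "1 - t \<le> 1 - t\<^sup>2" using assms by (simp add: power2_eq_square mult_left_le)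
    ultimately have "(1 - t) * (1 - t) \<le> \<theta>\<^sup>2 * (1 - t\<^sup>2)" using assms by (intro mult_mono) auto
    then show ?thesis by (simp add: power2_eq_square)
  qed
  then have "(1 - t)\<^sup>2 \<le> (\<theta> * sqrt (1 - t\<^sup>2))\<^sup>2" using w by (simp add: power_mult_distrib)
  then have "1 - t \<le> \<theta> * sqrt (1 - t\<^sup>2)" by (rule power2_le_imp_le) (use th w in simp)
  then have "(1 - t) / sqrt (1 - t\<^sup>2) \<le> \<theta>" using w by (simp add: field_simps)
  then have "L * \<theta> powr (l - 1) * ((1 - t) / sqrt (1 - t\<^sup>2)) \<le> L * \<theta> powr (l - 1) * \<theta>"
    using L by (intro mult_left_mono) auto
  also have "\<dots> = L * \<theta> powr l" using th powr_add[of \<theta> "l - 1" 1] by simp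
  also have "\<dots> \<le> L * (h t + 1)" using L h0 th by (intro mult_left_mono) (auto simp: h f_def)
  finally show "h' t * (1 - t) \<le> L * (h t + 1)" using assms by (simp add: h'_def \<theta>_def)
qed

text \<open>Outside of \<open>{-1..1}\<close> the values of \<open>arccos\<close> are unspecified; clamping its argument gives a continuous function that
  agrees with it where \<open>h\<close> and \<open>h'\<close> use it.\<close>

lemma h_abs_measurable: "(\<lambda>t. h \<bar>t\<bar>) \<in> borel_measurable borel" "(\<lambda>t. h' \<bar>t\<bar>) \<in> borel_measurable borel"
proof -
  define ac where "ac t = arccos (max (-1) (min 1 \<bar>t\<bar>))" for t :: real
  have [measurable]: "ac \<in> borel_measurable borel"
    unfolding ac_def by (intro borel_measurable_continuous_onI continuous_on_arccos continuous_intros) auto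
  have "(\<lambda>t. h \<bar>t\<bar>) = (\<lambda>t. if \<bar>t\<bar> < 1 then f (ac t) else 0)"
    by (auto simp: h_def fun_eq_iff max_def ac_def)
  moreover have "\<dots> \<in> borel_measurable borel" unfolding f_def by measurable
  ultimately show "(\<lambda>t. h \<bar>t\<bar>) \<in> borel_measurable borel" by simp
  have "(\<lambda>t. h' \<bar>t\<bar>) = (\<lambda>t. if \<bar>t\<bar> < 1 then L * ac t powr (l - 1) / sqrt (1 - \<bar>t\<bar>\<^sup>2) else 0)"
    by (auto simp: h'_def fun_eq_iff max_def ac_def)
  moreover have "\<dots> \<in> borel_measurable borel" by measurable
  ultimately show "(\<lambda>t. h' \<bar>t\<bar>) \<in> borel_measurable borel" by simp
qed

lemma zonal_h: "zonal_kernel (\<lambda>t. h \<bar>t\<bar>)"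
  unfolding zonal_kernel_def
proof (intro conjI allI)
  show "integrable (sph :: 'a measure) (\<lambda>y. h \<bar>pole \<bullet> y\<bar>)"
  proof (rule Bochner_Integration.integrable_bound[OF kappa_integrable[OF norm_pole]])
    show "(\<lambda>y. h \<bar>pole \<bullet> y\<bar>) \<in> borel_measurable sph"
      using measurable_compose[OF _ h_abs_measurable(1), of "\<lambda>y. pole \<bullet> y" borel] by simp
    show "AE y in sph. norm (h \<bar>pole \<bullet> y\<bar>) \<le> norm (majorant (chord pole y))"
      using AE_sph_abs_inner_less_1[OF norm_pole dim]
    proof eventually_elim
      case (elim y)
      then show ?case using majorant_compare(1,2)[of "\<bar>pole \<bullet> y\<bar>"] by (simp add: chord_def)
    qed
  qed
qed (use h_abs_measurable in auto)

lemma zonal_h': "zonal_kernel (\<lambda>t. h' \<bar>t\<bar> * (1 - \<bar>t\<bar>))"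
  unfolding zonal_kernel_def
proof (intro conjI allI)
  note [measurable] = h_abs_measurable
  show "(\<lambda>t. h' \<bar>t\<bar> * (1 - \<bar>t\<bar>)) \<in> borel_measurable borel" by measurable
  have "integrable (sph :: 'a measure) (\<lambda>y. L * (h \<bar>pole \<bullet> y\<bar> + 1))"
    using zonal_kernel_integrable[OF zonal_h norm_pole] by simp
  then show "integrable (sph :: 'a measure) (\<lambda>y. h' \<bar>pole \<bullet> y\<bar> * (1 - \<bar>pole \<bullet> y\<bar>))"
  proof (rule Bochner_Integration.integrable_bound)
    show "(\<lambda>y. h' \<bar>pole \<bullet> y\<bar> * (1 - \<bar>pole \<bullet> y\<bar>)) \<in> borel_measurable sph"
      using measurable_compose[OF _ h_abs_measurable(2), of "\<lambda>y. pole \<bullet> y" borel] by simp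
    show "AE y in sph. norm (h' \<bar>pole \<bullet> y\<bar> * (1 - \<bar>pole \<bullet> y\<bar>)) \<le> norm (L * (h \<bar>pole \<bullet> y\<bar> + 1))"
      using AE_sph_abs_inner_less_1[OF norm_pole dim]
    proof eventually_elim
      case (elim y)
      then show ?case using majorant_compare(1,4)[of "\<bar>pole \<bullet> y\<bar>"] h'_nonneg[of "\<bar>pole \<bullet> y\<bar>"] L by simp
    qed
  qed
qed simp

lemma eigenvalue_h_pos: assumes "n \<ge> 1" shows "0 < eigenvalue (\<lambda>t. h \<bar>t\<bar>) n"
  by (rule eigenvalue_pos[where h=h and h'=h' and h''=h'',
        OF zonal_h zonal_h' h_deriv h'_deriv h_tangent h'_nonneg h_subharmonic assms]) auto

lemma h_cont: "\<bar>t\<bar> < 1 \<Longrightarrow> isCont (\<lambda>t. h \<bar>t\<bar>) t"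
proof -
  assume t: "\<bar>t\<bar> < 1"
  have "isCont h \<bar>t\<bar>" by (rule DERIV_isCont[OF h_deriv]) (use t in auto)
  moreover have "isCont (\<lambda>t::real. \<bar>t\<bar>) t" by (intro continuous_intros)
  ultimately show ?thesis by (rule isCont_o2[rotated])
qed

lemma peak_poly_convolution_bound:
  "\<exists>C. \<forall>m (x::'a) y. norm x = 1 \<longrightarrow> norm y = 1 \<longrightarrow> \<bar>x \<bullet> y\<bar> < 1 \<longrightarrow>
       \<bar>\<integral>z. poly (peak_poly m) ((x \<bullet> z)\<^sup>2) * h \<bar>y \<bullet> z\<bar> \<partial>sph\<bar> \<le> C * h \<bar>x \<bullet> y\<bar>"
proof -
  obtain C where C: "C \<ge> 0" "\<forall>m (x::'a) y. norm x = 1 \<longrightarrow> norm y = 1 \<longrightarrow> 0 < chord x y \<longrightarrow>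
     (\<integral>\<^sup>+z. ennreal (poly (peak_poly m) ((x \<bullet> z)\<^sup>2)) * ennreal (majorant (chord y z)) \<partial>sph) \<le> ennreal (C * majorant (chord x y))"
    using peak_poly_kappa_bound by (elim exE conjE)
  have "\<bar>\<integral>z. poly (peak_poly m) ((x \<bullet> z)\<^sup>2) * h \<bar>y \<bullet> z\<bar> \<partial>sph\<bar> \<le> (C * D) * h \<bar>x \<bullet> y\<bar>"
    if x: "norm x = 1" and y: "norm y = 1" and t: "\<bar>x \<bullet> y\<bar> < 1" for m and x y :: 'a
  proof -
    let ?g = "\<lambda>z. poly (peak_poly m) ((x \<bullet> z)\<^sup>2) * h \<bar>y \<bullet> z\<bar>"
    have int: "integrable sph ?g"
      using zonal_kernel_mult_poly[OF zonal_h y x, of "peak_poly m"] by (simp add: mult.commute)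
    have AEy: "AE z in sph. \<bar>y \<bullet> z\<bar> < 1" by (rule AE_sph_abs_inner_less_1[OF y dim])
    have nn: "AE z in sph. 0 \<le> ?g z"
      using AEy
    proof eventually_elim
      case (elim z)
      show ?case using majorant_compare(1)[of "\<bar>y \<bullet> z\<bar>"] elim by (intro mult_nonneg_nonneg peak_poly_nonneg) auto
    qed
    have "ennreal (\<integral>z. ?g z \<partial>sph) = (\<integral>\<^sup>+z. ennreal (?g z) \<partial>sph)"
      by (rule nn_integral_eq_integral[symmetric, OF int nn])
    also have "\<dots> \<le> (\<integral>\<^sup>+z. ennreal (poly (peak_poly m) ((x \<bullet> z)\<^sup>2)) * ennreal (majorant (chord y z)) \<partial>sph)"
    proof (rule nn_integral_mono_AE)
      show "AE z in sph. ennreal (?g z) \<le> ennreal (poly (peak_poly m) ((x \<bullet> z)\<^sup>2)) * ennreal (majorant (chord y z))"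
        using AEy
      proof eventually_elim
        case (elim z)
        then have "h \<bar>y \<bullet> z\<bar> \<le> majorant (chord y z)" using majorant_compare(2)[of "\<bar>y \<bullet> z\<bar>"] by (simp add: chord_def)
        then have "?g z \<le> poly (peak_poly m) ((x \<bullet> z)\<^sup>2) * majorant (chord y z)" by (intro mult_left_mono peak_poly_nonneg)
        then show ?case by (simp add: ennreal_mult'[symmetric] peak_poly_nonneg ennreal_leI)
      qed
    qed
    also have "\<dots> \<le> ennreal (C * majorant (chord x y))" using C(2) x y t by (simp add: chord_def)
    also have "\<dots> \<le> ennreal ((C * D) * h \<bar>x \<bullet> y\<bar>)"
      using mult_left_mono[OF majorant_compare(3)[of "\<bar>x \<bullet> y\<bar>"] C(1)] t by (intro ennreal_leI) (simp add: chord_def mult.assoc)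
    finally have "(\<integral>z. ?g z \<partial>sph) \<le> (C * D) * h \<bar>x \<bullet> y\<bar>"
      using majorant_compare(1)[of "\<bar>x \<bullet> y\<bar>"] t C D by (subst (asm) ennreal_le_iff) auto
    moreover have "0 \<le> (\<integral>z. ?g z \<partial>sph)" by (rule integral_nonneg_AE[OF nn])
    ultimately show ?thesis by simp
  qed
  then show ?thesis by (intro exI[of _ "C * D"]) auto
qed

end

section \<open>Minimality and uniqueness\<close>

text \<open>For an integrand bounded below by \<open>- c\<close>, the difference of the integrals of positive and negative parts is the
  integral of the nonnegative function \<open>g + c\<close>, minus \<open>c\<close>.\<close>

lemma ereal_integral_shift:
  assumes "prob_space M" and G[measurable]: "G \<in> borel_measurable M" and c: "0 \<le> c"
    and g: "\<And>x. x \<in> space M \<Longrightarrow> g x = enn2ereal (G x) - ereal c"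
  shows "ereal_integral M g = enn2ereal (\<integral>\<^sup>+x. G x \<partial>M) - ereal c"
proof -
  interpret prob_space M by fact
  let ?P = "\<lambda>x. e2ennreal (enn2ereal (G x) - ereal c)" and ?N = "\<lambda>x. e2ennreal (- (enn2ereal (G x) - ereal c))"
  have pw: "?P x + ennreal c = G x + ?N x" "?N x \<le> ennreal c" for x
  proof -
    have "?P x + ennreal c = G x + ?N x \<and> ?N x \<le> ennreal c"
    proof (cases "G x")
      case (real r)
      have "?P x = ennreal (r - c)" "?N x = ennreal (c - r)" using real by (simp_all add: e2ennreal_ereal)
      then show ?thesis using real c
        by (cases "c \<le> r") (auto simp: ennreal_neg ennreal_plus[symmetric] ennreal_leI simp del: ennreal_plus)
    next
      case top
      then show ?thesis by (simp add: e2ennreal_neg)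
    qed
    then show "?P x + ennreal c = G x + ?N x" "?N x \<le> ennreal c" by auto
  qed
  have [measurable]: "?P \<in> borel_measurable M" "?N \<in> borel_measurable M" by measurable
  have "(\<integral>\<^sup>+x. ?P x \<partial>M) + ennreal c = (\<integral>\<^sup>+x. ?P x + ennreal c \<partial>M)"
    by (subst nn_integral_add) (auto simp: emeasure_space_1)
  also have "\<dots> = (\<integral>\<^sup>+x. G x + ?N x \<partial>M)" by (simp only: pw(1))
  also have "\<dots> = (\<integral>\<^sup>+x. G x \<partial>M) + (\<integral>\<^sup>+x. ?N x \<partial>M)" by (rule nn_integral_add) auto
  finally have eq: "(\<integral>\<^sup>+x. ?P x \<partial>M) + ennreal c = (\<integral>\<^sup>+x. G x \<partial>M) + (\<integral>\<^sup>+x. ?N x \<partial>M)" .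
  have "(\<integral>\<^sup>+x. ?N x \<partial>M) \<le> (\<integral>\<^sup>+x. ennreal c \<partial>M)" by (rule nn_integral_mono) (rule pw(2))
  then have N: "(\<integral>\<^sup>+x. ?N x \<partial>M) \<le> ennreal c" by (simp add: emeasure_space_1)
  have alg: "enn2ereal p - enn2ereal n = enn2ereal q - ereal c" if pq: "p + ennreal c = q + n" and nc: "n \<le> ennreal c" for p q n
  proof -
    obtain n' where n': "n = ennreal n'" "0 \<le> n'" using nc by (cases n) (auto simp: top_unique)
    show ?thesis
    proof (cases q)
      case (real q')
      then obtain p' where p': "p = ennreal p'" "0 \<le> p'" using pq n' by (cases p) (auto simp: ennreal_plus[symmetric] simp del: ennreal_plus)
      have "ennreal (p' + c) = ennreal (q' + n')" using pq real n' p' c by simp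
      then have "p' + c = q' + n'" using real n' p' c by (subst (asm) ennreal_inj) auto
      then show ?thesis using real n' p' by simp
    next
      case top
      then have "p = top" using pq by (cases p) (auto simp: ennreal_plus[symmetric] simp del: ennreal_plus)
      then show ?thesis using top n' by simp
    qed
  qed
  have "ereal_integral M g = enn2ereal (\<integral>\<^sup>+x. ?P x \<partial>M) - enn2ereal (\<integral>\<^sup>+x. ?N x \<partial>M)"
    unfolding ereal_integral_def by (intro arg_cong2[where f="(-)"] arg_cong[where f=enn2ereal] nn_integral_cong) (simp_all add: g)
  then show ?thesis using alg[OF eq N] by simp
qed

lemma sphere_prob_measures_facts:
  assumes "\<mu> \<in> sphere_prob_measures"
  shows "prob_space \<mu>" "space \<mu> = sphere 0 1" "(\<lambda>x. x) \<in> \<mu> \<rightarrow>\<^sub>M borel"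
proof -
  have s: "sets \<mu> = sets (restrict_space borel (sphere 0 1))" and p: "prob_space \<mu>"
    using assms by (auto simp: sphere_prob_measures_def)
  show "prob_space \<mu>" by fact
  show "space \<mu> = sphere 0 1" using sets_eq_imp_space_eq[OF s] by (simp add: space_restrict_space)
  show "(\<lambda>x. x) \<in> \<mu> \<rightarrow>\<^sub>M borel"
    unfolding measurable_cong_sets[OF s refl] by (rule measurable_restrict_space1) simp
qed

lemma line_angle_eq:
  assumes "norm x = 1" "norm y = 1"
  shows "line_angle x y = arccos \<bar>x \<bullet> y\<bar>"
proof -
  have t: "\<bar>x \<bullet> y\<bar> \<le> 1" by (rule abs_inner_unit_le[OF assms])
  have h: "arccos \<bar>x \<bullet> y\<bar> \<le> pi / 2" using t by (intro arccos_le_pi2) auto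
  show ?thesis
  proof (cases "0 \<le> x \<bullet> y")
    case True
    then show ?thesis using h by (simp add: line_angle_def min_def)
  next
    case False
    then have "arccos (x \<bullet> y) = pi - arccos \<bar>x \<bullet> y\<bar>" using t arccos_minus[of "- (x \<bullet> y)"] by simp
    then show ?thesis using h by (simp add: line_angle_def min_def)
  qed
qed

text \<open>Even continuous functions determine a measure on symmetric sets. The functional
  \<open>J M A\<close>, which is \<open>measure M A + measure M (- A)\<close>, is the integral of an even function for every \<open>A\<close>. Two
  measures give it the same value for open \<open>A\<close>, by approximating the indicator from below, and hence for all
  Borel sets by the \<open>\<pi>\<close>-\<open>\<lambda>\<close> theorem. On a symmetric set it is twice the measure.\<close>

lemma emeasure_symmetric_set_eqI:
  fixes \<mu> \<nu> :: "'a::euclidean_space measure"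
  assumes mu: "prob_space \<mu>" "sets \<mu> = sets borel" and nu: "prob_space \<nu>" "sets \<nu> = sets borel"
    and eq: "\<And>f B. continuous_on UNIV f \<Longrightarrow> (\<And>x. f (- x) = f x) \<Longrightarrow> (\<And>x. \<bar>f x\<bar> \<le> (B::real)) \<Longrightarrow>
      (\<integral>x. f x \<partial>\<mu>) = (\<integral>x. f x \<partial>\<nu>)"
    and A: "A \<in> sets borel" "uminus ` A = A"
  shows "emeasure \<mu> A = emeasure \<nu> A"
proof -
  note [measurable_cong] = mu(2) nu(2)
  interpret mu: prob_space \<mu> by fact
  interpret nu: prob_space \<nu> by fact
  have sp: "space \<mu> = UNIV" "space \<nu> = UNIV" using sets_eq_imp_space_eq[OF mu(2)] sets_eq_imp_space_eq[OF nu(2)] by auto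
  define J where "J M A = (\<integral>x. indicat_real A x + indicat_real A (- x) \<partial>M)" for M :: "'a measure" and A :: "'a set"
  have int: "integrable M (\<lambda>x. indicat_real A x + indicat_real A (- x))"
    if "A \<in> sets borel" "M = \<mu> \<or> M = \<nu>" for A M
  proof -
    have [measurable]: "A \<in> sets borel" by fact
    from that(2) show ?thesis
    proof
      assume M: "M = \<mu>"
      show ?thesis unfolding M by (rule mu.integrable_const_bound[where B=2]) (auto simp: indicator_def)
    next
      assume M: "M = \<nu>"
      show ?thesis unfolding M by (rule nu.integrable_const_bound[where B=2]) (auto simp: indicator_def)
    qed
  qed
  have open_case: "J \<mu> U = J \<nu> U" if U: "open U" for U
  proof (cases "U = UNIV")
    case True
    then show ?thesis using eq[of "\<lambda>_. 1" 1] by (simp add: J_def)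
  next
    case False
    define f where "f m x = min 1 (real m * infdist x (- U))" for m :: nat and x
    define g where "g m x = f m x + f m (- x)" for m x
    have fb: "0 \<le> f m x" "f m x \<le> 1" for m x by (auto simp: f_def infdist_nonneg)
    have gc: "continuous_on UNIV (g m)" for m
      unfolding g_def f_def by (intro continuous_intros)
    have [measurable]: "g m \<in> borel_measurable borel" for m using gc by (rule borel_measurable_continuous_onI)
    have [measurable]: "U \<in> sets borel" using U by simp
    have flim: "(\<lambda>m. f m x) \<longlonglongrightarrow> indicator U x" for x
    proof (cases "x \<in> U")
      case True
      have "closed (- U)" "- U \<noteq> {}" using U False by auto
      then have pos: "0 < infdist x (- U)" using True by (simp add: infdist_pos_not_in_closed)
      obtain m0 :: nat where m0: "1 / infdist x (- U) < real m0" using reals_Archimedean2 by blast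
      have "\<forall>\<^sub>F m in sequentially. f m x = 1"
        using eventually_ge_at_top[of m0]
      proof eventually_elim
        case (elim m)
        then have "real m0 \<le> real m" by simp
        then have "1 / infdist x (- U) \<le> real m" using m0 by linarith
        then have "1 \<le> real m * infdist x (- U)" using pos by (simp add: field_simps)
        then show ?case by (simp add: f_def)
      qed
      then show ?thesis using True by (simp add: tendsto_eventually)
    next
      case False
      then have "infdist x (- U) = 0" by simp
      then show ?thesis using False by (simp add: f_def)
    qed
    have glim: "(\<lambda>m. g m x) \<longlonglongrightarrow> indicator U x + indicator U (- x)" for x
      unfolding g_def by (intro tendsto_add flim)
    have gb: "\<bar>g m x\<bar> \<le> 2" for m x using fb[of m x] fb[of m "- x"] by (simp add: g_def)
    have "(\<lambda>m. \<integral>x. g m x \<partial>\<mu>) \<longlonglongrightarrow> J \<mu> U" unfolding J_def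
      by (rule integral_dominated_convergence[where w="\<lambda>x. 2"]) (use glim gb in auto)
    moreover have "(\<lambda>m. \<integral>x. g m x \<partial>\<nu>) \<longlonglongrightarrow> J \<nu> U" unfolding J_def
      by (rule integral_dominated_convergence[where w="\<lambda>x. 2"]) (use glim gb in auto)
    moreover have "(\<integral>x. g m x \<partial>\<mu>) = (\<integral>x. g m x \<partial>\<nu>)" for m
      by (rule eq[OF gc _ gb]) (simp add: g_def)
    ultimately show ?thesis using LIMSEQ_unique by simp
  qed
  have J_eq: "J \<mu> A = J \<nu> A" if "A \<in> sets borel" for A
  proof -
    have "Int_stable {S :: 'a set. open S}" "{S :: 'a set. open S} \<subseteq> Pow UNIV" by (auto simp: Int_stable_def)
    moreover have "A \<in> sigma_sets UNIV {S :: 'a set. open S}" using that by (simp add: borel_def)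
    ultimately show ?thesis
    proof (induction rule: sigma_sets_induct_disjoint)
      case (basic A) then show ?case using open_case by simp
    next
      case empty then show ?case by (simp add: J_def)
    next
      case (compl A)
      then have A: "A \<in> sets borel" by (simp add: borel_def)
      have c: "J M (UNIV - A) = 2 - J M A" if "M = \<mu> \<or> M = \<nu>" for M
      proof -
        have "measure M (space M) = 1" using that mu.prob_space nu.prob_space by auto
        have "J M (UNIV - A) = (\<integral>x. 2 - (indicator A x + indicator A (- x)) \<partial>M)"
          unfolding J_def by (intro Bochner_Integration.integral_cong refl) (auto simp: indicator_def)
        also have "\<dots> = (\<integral>x. 2 \<partial>M) - J M A"
          unfolding J_def using that mu.finite_measure_axioms nu.finite_measure_axioms
          by (intro Bochner_Integration.integral_diff int A that) auto
        also have "(\<integral>x. (2::real) \<partial>M) = 2" using \<open>measure M (space M) = 1\<close> by simp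
        finally show ?thesis .
      qed
      show ?case using compl(2) by (simp add: c)
    next
      case (union F)
      have F: "F i \<in> sets borel" for i using union(2) by (auto simp: borel_def)
      have s: "(\<lambda>i. J M (F i)) sums J M (\<Union>i. F i)" if M: "M = \<mu> \<or> M = \<nu>" for M
      proof -
        have dis: "disjoint_family F" by fact
        have ind: "(\<lambda>i. indicat_real (F i) x) sums indicator (\<Union>i. F i) x" for x
        proof (cases "\<exists>i. x \<in> F i")
          case True
          then obtain i where i: "x \<in> F i" by auto
          have "x \<notin> F j" if "j \<noteq> i" for j using dis i that by (auto simp: disjoint_family_on_def)
          then have "(\<lambda>j. indicat_real (F j) x) = (\<lambda>j. if j = i then 1 else 0)" using i by (auto simp: fun_eq_iff)
          moreover have "indicat_real (\<Union>i. F i) x = 1" using i by (auto simp: indicator_def)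
          ultimately show ?thesis using sums_single[of i "\<lambda>_. 1::real"] by (simp only:)
        next
          case False
          then have "(\<lambda>j. indicat_real (F j) x) = (\<lambda>j. 0)" by auto
          moreover have "indicat_real (\<Union>i. F i) x = 0" using False by (auto simp: indicator_def)
          ultimately show ?thesis by (simp only: sums_zero)
        qed
        have "(\<lambda>n. \<integral>x. (\<Sum>i<n. indicator (F i) x + indicator (F i) (- x)) \<partial>M) \<longlonglongrightarrow> J M (\<Union>i. F i)"
          unfolding J_def
        proof (rule integral_dominated_convergence[where w="\<lambda>x. 2"])
          have [measurable]: "F i \<in> sets borel" for i by (rule F)
          have [measurable]: "(\<Union>i. F i) \<in> sets borel" using F by auto
          show "integrable M (\<lambda>x. 2::real)" using M by auto
          have sM: "sets M = sets borel" using M mu(2) nu(2) by auto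
          note [measurable_cong] = sM
          show "(\<lambda>x. indicat_real (\<Union>i. F i) x + indicat_real (\<Union>i. F i) (- x)) \<in> borel_measurable M" by measurable
          show "(\<lambda>x. \<Sum>i<n. indicat_real (F i) x + indicat_real (F i) (- x)) \<in> borel_measurable M" for n by measurable
          have s2: "(\<lambda>i. indicat_real (F i) x + indicat_real (F i) (- x)) sums (indicator (\<Union>i. F i) x + indicator (\<Union>i. F i) (- x))" for x
            by (intro sums_add ind)
          then show "AE x in M. (\<lambda>n. \<Sum>i<n. indicat_real (F i) x + indicat_real (F i) (- x)) \<longlonglongrightarrow> indicator (\<Union>i. F i) x + indicator (\<Union>i. F i) (- x)"
            by (simp add: sums_def)
          show "AE x in M. norm (\<Sum>i<n. indicat_real (F i) x + indicat_real (F i) (- x)) \<le> 2" for n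
          proof (rule AE_I2)
            fix x
            have "(\<Sum>i<n. indicat_real (F i) x + indicat_real (F i) (- x)) \<le> (\<Sum>i. indicat_real (F i) x + indicat_real (F i) (- x))"
              using s2[of x] by (intro sum_le_suminf) (auto simp: sums_iff)
            also have "\<dots> \<le> 2" using s2[of x] by (auto simp: sums_iff indicator_def)
            finally show "norm (\<Sum>i<n. indicat_real (F i) x + indicat_real (F i) (- x)) \<le> 2"
              by (simp add: sum_nonneg)
          qed
        qed
        moreover have "(\<integral>x. (\<Sum>i<n. indicator (F i) x + indicator (F i) (- x)) \<partial>M) = (\<Sum>i<n. J M (F i))" for n
          unfolding J_def using int[OF F M] by (intro Bochner_Integration.integral_sum) auto
        ultimately show ?thesis by (simp add: sums_def)
      qed
      have "(\<lambda>i. J \<mu> (F i)) sums J \<nu> (\<Union>i. F i)" using s[of \<nu>] union(3) by simp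
      then show ?case using s[of \<mu>] sums_unique2 by blast
    qed
  qed
  have J2: "J M A = 2 * measure M A" if M: "M = \<mu> \<or> M = \<nu>" for M
  proof -
    have "indicat_real A (- x) = indicator A x" for x
    proof -
      have "- y \<in> A" if "y \<in> A" for y using A(2) that by (metis imageI)
      from this[of x] this[of "- x"] show ?thesis by (auto simp: indicator_def)
    qed
    then have "J M A = (\<integral>x. 2 * indicator A x \<partial>M)" unfolding J_def by (intro Bochner_Integration.integral_cong) auto
    then show ?thesis using M A(1) sp by auto
  qed
  have "measure \<mu> A = measure \<nu> A" using J_eq[OF A(1)] J2 by simp
  then show ?thesis by (simp add: mu.emeasure_eq_measure nu.emeasure_eq_measure)
qed

context angle_profile begin

text \<open>The kernel shifted to be nonnegative, with values in \<open>ennreal\<close> and the correct value on the diagonal.\<close>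

definition shift :: real where "shift = (if l = 0 then ln 4 else 0)"
definition ext_kernel :: "'a \<Rightarrow> 'a \<Rightarrow> ennreal" where
  "ext_kernel x y = (if \<bar>x \<bullet> y\<bar> < 1 then ennreal (h \<bar>x \<bullet> y\<bar>) else \<infinity>)"
definition energy :: "'a measure \<Rightarrow> ennreal" where
  "energy \<mu> = (\<integral>\<^sup>+y. (\<integral>\<^sup>+x. ext_kernel x y \<partial>\<mu>) \<partial>\<mu>)"

lemma shift_nonneg: "0 \<le> shift" by (simp add: shift_def)

lemma ext_kernel_measurable[measurable]: "(\<lambda>p. ext_kernel (fst p) (snd p)) \<in> borel_measurable (borel \<Otimes>\<^sub>M borel)"
proof -
  have "(\<lambda>p::'a \<times> 'a. h \<bar>fst p \<bullet> snd p\<bar>) \<in> borel_measurable (borel \<Otimes>\<^sub>M borel)"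
    by (rule measurable_compose[OF _ h_abs_measurable(1), of "\<lambda>p. fst p \<bullet> snd p"]) measurable
  then show ?thesis unfolding ext_kernel_def by measurable
qed

lemma ext_kernel_commute: "ext_kernel x y = ext_kernel y x"
  by (simp add: ext_kernel_def inner_commute)

lemma angle_kernel_eq:
  assumes x: "norm x = 1" and y: "norm (y::'a) = 1"
  shows "angle_kernel l x y = enn2ereal (ext_kernel x y) - ereal shift"
proof -
  let ?t = "\<bar>x \<bullet> y\<bar>"
  have t: "?t \<le> 1" by (rule abs_inner_unit_le[OF x y])
  have la: "line_angle x y = arccos ?t" by (rule line_angle_eq[OF x y])
  show ?thesis
  proof (cases "?t < 1")
    case False
    then have "?t = 1" using t by simp
    then show ?thesis using l_nonpos by (simp add: angle_kernel_def la ext_kernel_def)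
  next
    case True
    have th: "0 < arccos ?t" using arccos_chord_bounds(1)[of ?t] True by simp
    have h0: "0 \<le> h ?t" using majorant_compare(1)[of ?t] True by simp
    have ht: "h ?t = f (arccos ?t)" using True by (simp add: h_def)
    have "angle_kernel l x y = ereal (h ?t - shift)"
    proof (cases "l = 0")
      case True
      then show ?thesis unfolding ht f_def shift_def angle_kernel_def la using th by (simp add: ln_div)
    next
      case False
      then show ?thesis unfolding ht f_def shift_def angle_kernel_def la using th by simp
    qed
    then show ?thesis using True h0 by (simp add: ext_kernel_def)
  qed
qed

lemma angle_energy_eq:
  assumes mu: "(\<mu> :: 'a measure) \<in> sphere_prob_measures"
  shows "angle_energy l \<mu> = enn2ereal (energy (distr \<mu> borel (\<lambda>x. x))) - ereal shift"
proof -
  note F = sphere_prob_measures_facts[OF mu]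
  interpret mu: prob_space \<mu> by (rule F(1))
  note [measurable] = F(3)
  have m1: "(\<lambda>x. ext_kernel x y) \<in> borel_measurable borel" for y
    using measurable_compose[of "\<lambda>x. (x, y)" borel "borel \<Otimes>\<^sub>M borel", OF _ ext_kernel_measurable] by simp
  have mb: "(\<lambda>x. ext_kernel x y) \<in> borel_measurable \<mu>" for y
    using measurable_compose[OF F(3) m1] by simp
  interpret dm: prob_space "distr \<mu> borel (\<lambda>x. x)" by (rule mu.prob_space_distr) (rule F(3))
  have "(\<lambda>p. ext_kernel (snd p) (fst p)) \<in> borel_measurable (borel \<Otimes>\<^sub>M distr \<mu> borel (\<lambda>x. x))"
    using measurable_compose[of "\<lambda>p. (snd p, fst p)" "borel \<Otimes>\<^sub>M distr \<mu> borel (\<lambda>x. x)" "borel \<Otimes>\<^sub>M borel", OF _ ext_kernel_measurable]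
    by simp
  then have m2: "(\<lambda>y. \<integral>\<^sup>+x. ext_kernel x y \<partial>distr \<mu> borel (\<lambda>x. x)) \<in> borel_measurable borel"
    by (intro dm.borel_measurable_nn_integral) (simp add: case_prod_beta')
  have G: "(\<lambda>y. \<integral>\<^sup>+x. ext_kernel x y \<partial>\<mu>) = (\<lambda>y. \<integral>\<^sup>+x. ext_kernel x y \<partial>distr \<mu> borel (\<lambda>x. x))"
    using m1 by (simp add: nn_integral_distr)
  have inner: "ereal_integral \<mu> (\<lambda>x. angle_kernel l x y) = enn2ereal (\<integral>\<^sup>+x. ext_kernel x y \<partial>\<mu>) - ereal shift"
    if "y \<in> space \<mu>" for y
    by (rule ereal_integral_shift[OF F(1) mb shift_nonneg]) (use that F(2) angle_kernel_eq in auto)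
  have "angle_energy l \<mu> = enn2ereal (\<integral>\<^sup>+y. (\<integral>\<^sup>+x. ext_kernel x y \<partial>\<mu>) \<partial>\<mu>) - ereal shift"
    unfolding angle_energy_def
    by (rule ereal_integral_shift[OF F(1) _ shift_nonneg inner]) (use measurable_compose[OF F(3) m2] G in simp_all)
  also have "(\<integral>\<^sup>+y. (\<integral>\<^sup>+x. ext_kernel x y \<partial>\<mu>) \<partial>\<mu>) = energy (distr \<mu> borel (\<lambda>x. x))"
    unfolding energy_def G using m2 by (simp add: nn_integral_distr)
  finally show ?thesis .
qed

text \<open>The potential of the surface measure is constant on the sphere.\<close>

lemma energy_sph: "energy sph = ennreal (eigenvalue (\<lambda>t. h \<bar>t\<bar>) 0)"
proof -
  have "energy sph = (\<integral>\<^sup>+y. ennreal (eigenvalue (\<lambda>t. h \<bar>t\<bar>) 0) \<partial>(sph :: 'a measure))"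
    unfolding energy_def
  proof (rule nn_integral_cong_AE)
    show "AE y in sph. (\<integral>\<^sup>+x. ext_kernel x y \<partial>sph) = ennreal (eigenvalue (\<lambda>t. h \<bar>t\<bar>) 0)"
      using AE_sph_norm
    proof eventually_elim
      case (elim y)
      have AE: "AE x in sph. \<bar>y \<bullet> x\<bar> < 1" by (rule AE_sph_abs_inner_less_1[OF elim dim])
      have "(\<integral>\<^sup>+x. ext_kernel x y \<partial>sph) = (\<integral>\<^sup>+x. ennreal (h \<bar>y \<bullet> x\<bar>) \<partial>sph)"
      proof (rule nn_integral_cong_AE)
        show "AE x in sph. ext_kernel x y = ennreal (h \<bar>y \<bullet> x\<bar>)"
          using AE by eventually_elim (simp add: ext_kernel_def inner_commute)
      qed
      also have "\<dots> = ennreal (\<integral>x. h \<bar>y \<bullet> x\<bar> \<partial>sph)"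
      proof (rule nn_integral_eq_integral[OF zonal_kernel_integrable[OF zonal_h elim]])
        show "AE x in sph. 0 \<le> h \<bar>y \<bullet> x\<bar>"
          using AE by eventually_elim (use majorant_compare(1) in simp)
      qed
      also have "(\<integral>x. h \<bar>y \<bullet> x\<bar> \<partial>sph) = eigenvalue (\<lambda>t. h \<bar>t\<bar>) 0"
        using zonal_integral_eq[OF zonal_h elim] by (simp add: eigenvalue_0)
      finally show ?case .
    qed
  qed
  then show ?thesis by (simp add: sph.emeasure_space_1[unfolded space_sph])
qed

end

locale angle_prob = angle_profile dummy l + sphere_prob dummy \<mu>
  for dummy :: "'a::euclidean_space itself" and l \<mu>
begin

interpretation mm: pair_prob_space \<mu> \<mu> ..

text \<open>A measure of finite energy does not charge the diagonal, so the real-valued kernel \<open>h \<bar>x \<bullet> y\<bar>\<close> has the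
  same energy and \<open>energy_lower_bound\<close> applies.\<close>

lemma energy_lower:
  assumes n: "n \<ge> 1"
  shows "ennreal (eigenvalue (\<lambda>t. h \<bar>t\<bar>) 0 + eigenvalue (\<lambda>t. h \<bar>t\<bar>) n * zonal_energy n) \<le> energy \<mu>"
proof (cases "energy \<mu> = \<infinity>")
  case False
  let ?k = "\<lambda>p::'a \<times> 'a. h \<bar>fst p \<bullet> snd p\<bar>"
  have m: "(\<lambda>p. ext_kernel (fst p) (snd p)) \<in> borel_measurable (\<mu> \<Otimes>\<^sub>M \<mu>)" by measurable
  have "energy \<mu> = (\<integral>\<^sup>+y. (\<integral>\<^sup>+x. ext_kernel y x \<partial>\<mu>) \<partial>\<mu>)"
    unfolding energy_def by (intro nn_integral_cong) (rule ext_kernel_commute)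
  also have "\<dots> = (\<integral>\<^sup>+p. ext_kernel (fst p) (snd p) \<partial>(\<mu> \<Otimes>\<^sub>M \<mu>))"
    using mu.nn_integral_fst[OF m] by simp
  finally have E: "energy \<mu> = (\<integral>\<^sup>+p. ext_kernel (fst p) (snd p) \<partial>(\<mu> \<Otimes>\<^sub>M \<mu>))" .
  have "AE p in \<mu> \<Otimes>\<^sub>M \<mu>. ext_kernel (fst p) (snd p) \<noteq> \<infinity>"
    by (rule nn_integral_PInf_AE[OF m]) (use False E in simp)
  then have diag: "AE p in \<mu> \<Otimes>\<^sub>M \<mu>. \<bar>fst p \<bullet> snd p\<bar> < 1"
    by eventually_elim (auto simp: ext_kernel_def split: if_splits)
  have k0: "AE p in \<mu> \<Otimes>\<^sub>M \<mu>. 0 \<le> ?k p"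
    using diag by eventually_elim (use majorant_compare(1) in simp)
  have E': "energy \<mu> = (\<integral>\<^sup>+p. ennreal (?k p) \<partial>(\<mu> \<Otimes>\<^sub>M \<mu>))"
    unfolding E
  proof (rule nn_integral_cong_AE)
    show "AE p in \<mu> \<Otimes>\<^sub>M \<mu>. ext_kernel (fst p) (snd p) = ennreal (?k p)"
      using diag by eventually_elim (simp add: ext_kernel_def)
  qed
  have km: "?k \<in> borel_measurable (\<mu> \<Otimes>\<^sub>M \<mu>)"
    using measurable_compose[OF _ h_abs_measurable(1), of "\<lambda>p. fst p \<bullet> snd p" "\<mu> \<Otimes>\<^sub>M \<mu>"] by simp
  have int: "integrable (\<mu> \<Otimes>\<^sub>M \<mu>) ?k"
    by (rule integrableI_nonneg[OF km k0]) (use False E' in \<open>simp add: less_top\<close>)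
  obtain C where C: "\<forall>m (x::'a) y. norm x = 1 \<longrightarrow> norm y = 1 \<longrightarrow> \<bar>x \<bullet> y\<bar> < 1 \<longrightarrow>
       \<bar>\<integral>z. poly (peak_poly m) ((x \<bullet> z)\<^sup>2) * h \<bar>y \<bullet> z\<bar> \<partial>sph\<bar> \<le> C * h \<bar>x \<bullet> y\<bar>"
    using peak_poly_convolution_bound by (elim exE)
  have "eigenvalue (\<lambda>t. h \<bar>t\<bar>) 0 + eigenvalue (\<lambda>t. h \<bar>t\<bar>) n * zonal_energy n \<le> (\<integral>p. ?k p \<partial>(\<mu> \<Otimes>\<^sub>M \<mu>))"
  proof (rule energy_lower_bound[where k="\<lambda>t. h \<bar>t\<bar>", OF zonal_h h_cont _ _ diag int n])
    show "\<bar>\<integral>z. poly (peak_poly m) ((x \<bullet> z)\<^sup>2) * h \<bar>y \<bullet> z\<bar> \<partial>sph\<bar> \<le> C * h \<bar>x \<bullet> y\<bar>"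
      if "norm x = 1" "norm y = 1" "\<bar>x \<bullet> y\<bar> < 1" for m and x y :: 'a using C that by simp
    show "0 \<le> eigenvalue (\<lambda>t. h \<bar>t\<bar>) n" if "n \<ge> 1" for n using eigenvalue_h_pos[OF that] by simp
  qed
  then have "ennreal (eigenvalue (\<lambda>t. h \<bar>t\<bar>) 0 + eigenvalue (\<lambda>t. h \<bar>t\<bar>) n * zonal_energy n) \<le> ennreal (\<integral>p. ?k p \<partial>(\<mu> \<Otimes>\<^sub>M \<mu>))"
    by (rule ennreal_leI)
  also have "\<dots> = energy \<mu>" unfolding E' by (rule nn_integral_eq_integral[symmetric, OF int k0])
  finally show ?thesis .
qed simp

lemma eigenvalue_h_0_nonneg: "0 \<le> eigenvalue (\<lambda>t. h \<bar>t\<bar>) 0"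
  unfolding eigenvalue_0
proof (rule integral_nonneg_AE)
  show "AE x in sph. 0 \<le> h \<bar>pole \<bullet> x\<bar>"
    using AE_sph_abs_inner_less_1[OF norm_pole dim] by eventually_elim (use majorant_compare(1) in simp)
qed

lemma energy_sph_le: "energy sph \<le> energy \<mu>"
proof -
  have "0 \<le> eigenvalue (\<lambda>t. h \<bar>t\<bar>) 1 * zonal_energy 1" using eigenvalue_h_pos[of 1] zonal_energy_nonneg[of 1] by simp
  then have "energy sph \<le> ennreal (eigenvalue (\<lambda>t. h \<bar>t\<bar>) 0 + eigenvalue (\<lambda>t. h \<bar>t\<bar>) 1 * zonal_energy 1)"
    unfolding energy_sph by (intro ennreal_leI) simp
  also have "\<dots> \<le> energy \<mu>" by (rule energy_lower) simp
  finally show ?thesis .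
qed

lemma energy_eq_imp_symmetric_eq:
  assumes "energy \<mu> \<le> energy sph" and A: "A \<in> sets borel" "uminus ` A = A"
  shows "emeasure \<mu> A = emeasure sph A"
proof (rule emeasure_symmetric_set_eqI[OF _ _ _ _ _ A])
  \<comment> \<open>Equality leaves no room for the nonnegative term of degree \<open>2 * n\<close>, whose coefficient is positive.\<close>
  have z: "zonal_energy n = 0" if n: "n \<ge> 1" for n
  proof -
    have "ennreal (eigenvalue (\<lambda>t. h \<bar>t\<bar>) 0 + eigenvalue (\<lambda>t. h \<bar>t\<bar>) n * zonal_energy n) \<le> ennreal (eigenvalue (\<lambda>t. h \<bar>t\<bar>) 0)"
      using order_trans[OF energy_lower[OF n] assms(1)] by (simp only: energy_sph)
    then have "eigenvalue (\<lambda>t. h \<bar>t\<bar>) n * zonal_energy n \<le> 0" using eigenvalue_h_0_nonneg by (subst (asm) ennreal_le_iff) auto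
    then show ?thesis using eigenvalue_h_pos[OF n] zonal_energy_nonneg[of n] by (simp add: mult_le_0_iff)
  qed
  show "(\<integral>x. f x \<partial>\<mu>) = (\<integral>x. f x \<partial>sph)"
    if "continuous_on UNIV f" "\<And>x. f (- x) = f x" "\<And>x. \<bar>f x\<bar> \<le> B" for f :: "'a \<Rightarrow> real" and B
    by (rule integral_eq_uniform[OF z that])
qed (use prob_space_sph mu.prob_space_axioms in auto)

end

lemma angle_prob_distr:
  assumes "(\<mu> :: 'a::euclidean_space measure) \<in> sphere_prob_measures" and "angle_profile TYPE('a) l"
  shows "angle_prob l (distr \<mu> borel (\<lambda>x. x))"
proof -
  note F = sphere_prob_measures_facts[OF assms(1)]
  interpret angle_profile "TYPE('a)" l by fact
  interpret mu: prob_space \<mu> by (rule F(1))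
  interpret dm: prob_space "distr \<mu> borel (\<lambda>x. x)" by (rule mu.prob_space_distr) (rule F(3))
  show ?thesis
  proof
    show "AE x in distr \<mu> borel (\<lambda>x. x). norm x = 1"
      using F(2,3) by (subst AE_distr_iff) auto
  qed simp
qed

text \<open>The same statement for an arbitrary Euclidean space.\<close>

theorem uniform_sphere_measure_minimizes:
  fixes d :: nat and l :: real
  assumes "DIM('a::euclidean_space) = d + 1" and "d \<ge> 2" and "l \<in> {- real d <.. - real d + 2}"
  shows "is_arg_min (angle_energy l) (\<lambda>\<mu>. \<mu> \<in> sphere_prob_measures) (uniform_sphere_measure :: 'a measure)
       \<and> (\<forall>\<nu>. is_arg_min (angle_energy l) (\<lambda>\<mu>. \<mu> \<in> sphere_prob_measures) \<nu>
             \<longrightarrow> antipodally_equal \<nu> (uniform_sphere_measure :: 'a measure))"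
proof -
  let ?\<sigma> = "uniform_sphere_measure :: 'a measure"
  interpret angle_profile "TYPE('a)" l
    by unfold_locales (use assms in auto)
  have sig: "?\<sigma> \<in> sphere_prob_measures" by (rule uniform_sphere_measure_in_sphere_prob_measures)
  have Es: "angle_energy l ?\<sigma> = enn2ereal (energy sph) - ereal shift"
    unfolding angle_energy_eq[OF sig] distr_uniform_sphere_measure ..
  have le: "angle_energy l ?\<sigma> \<le> angle_energy l \<nu>" if nu: "\<nu> \<in> sphere_prob_measures" for \<nu> :: "'a measure"
  proof -
    interpret p: angle_prob "TYPE('a)" l "distr \<nu> borel (\<lambda>x. x)"
      by (rule angle_prob_distr[OF nu angle_profile_axioms])
    show ?thesis unfolding Es angle_energy_eq[OF nu]
      using p.energy_sph_le by (intro ereal_minus_mono) (auto simp: less_eq_ennreal.rep_eq)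
  qed
  have "antipodally_equal \<nu> ?\<sigma>"
    if min: "is_arg_min (angle_energy l) (\<lambda>\<mu>. \<mu> \<in> sphere_prob_measures) \<nu>" for \<nu>
  proof -
    have nu: "\<nu> \<in> sphere_prob_measures" and "\<not> angle_energy l ?\<sigma> < angle_energy l \<nu>"
      using min sig by (auto simp: is_arg_min_def)
    then have "angle_energy l \<nu> \<le> angle_energy l ?\<sigma>" by (simp add: not_less)
    then have "enn2ereal (energy (distr \<nu> borel (\<lambda>x. x))) \<le> enn2ereal (energy sph)"
      unfolding Es angle_energy_eq[OF nu]
      by (cases "enn2ereal (energy (distr \<nu> borel (\<lambda>x. x)))"; cases "enn2ereal (energy (sph :: 'a measure))") auto
    then have E: "energy (distr \<nu> borel (\<lambda>x. x)) \<le> energy sph" by (simp add: less_eq_ennreal.rep_eq)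
    interpret p: angle_prob "TYPE('a)" l "distr \<nu> borel (\<lambda>x. x)"
      by (rule angle_prob_distr[OF nu angle_profile_axioms])
    note F = sphere_prob_measures_facts[OF nu] and G = sphere_prob_measures_facts[OF sig]
    show ?thesis
      unfolding antipodally_equal_def
    proof (intro allI impI)
      fix X :: "'a set" assume X: "X \<in> sets borel \<and> X \<subseteq> sphere 0 1"
      let ?A = "X \<union> uminus ` X"
      have "uminus ` X = uminus -` X" by force
      moreover have "uminus -` X \<in> sets borel"
        using measurable_sets[of uminus borel borel X] X by simp
      ultimately have A: "?A \<in> sets borel" using X by auto
      have sub: "?A \<subseteq> sphere 0 1" using X by auto
      have "uminus ` ?A = ?A" by (auto simp: image_Un image_image)
      from p.energy_eq_imp_symmetric_eq[OF E A this]
      have "emeasure (distr \<nu> borel (\<lambda>x. x)) ?A = emeasure (distr ?\<sigma> borel (\<lambda>x. x)) ?A"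
        by (simp only: distr_uniform_sphere_measure)
      moreover have "emeasure (distr \<nu> borel (\<lambda>x. x)) ?A = emeasure \<nu> ?A"
        using sub F(2) by (subst emeasure_distr[OF F(3) A]) (auto intro!: arg_cong[where f="emeasure \<nu>"])
      moreover have "emeasure (distr ?\<sigma> borel (\<lambda>x. x)) ?A = emeasure ?\<sigma> ?A"
        using sub G(2) by (subst emeasure_distr[OF G(3) A]) (auto intro!: arg_cong[where f="emeasure ?\<sigma>"])
      ultimately show "emeasure \<nu> ?A = emeasure ?\<sigma> ?A" by simp
    qed
  qed
  moreover have "is_arg_min (angle_energy l) (\<lambda>\<mu>. \<mu> \<in> sphere_prob_measures) ?\<sigma>"
    using sig le by (auto simp: is_arg_min_def not_less)
  ultimately show ?thesis by blast
qed

theorem theorem1p1: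
  fixes d :: nat and l :: real
  assumes "CARD('n::finite) = d + 1"
    and "d \<ge> 2"
    and "l \<in> {- real d <.. - real d + 2}"
  shows "is_arg_min (angle_energy l) (\<lambda>\<mu>. \<mu> \<in> sphere_prob_measures)
           (uniform_sphere_measure :: (real ^ 'n) measure)
       \<and> (\<forall>\<nu>. is_arg_min (angle_energy l) (\<lambda>\<mu>. \<mu> \<in> sphere_prob_measures) \<nu>
             \<longrightarrow> antipodally_equal \<nu> (uniform_sphere_measure :: (real ^ 'n) measure))"
  by (rule uniform_sphere_measure_minimizes) (use assms in simp_all)

end
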